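(* The 2-category $\mathbf{DscCompCat}$ of comprehension categories with discrete fibration and the 2-category $\mathbf{CwF}$ of categories with families are adjoint 2-equivalent. The adjoint 2-equivalence restricts to the wide 2-full sub-2-categories on the pseudo morphisms and to those on the strict morphisms.
   Context: "Wide" means with the same 0-cells; "2-full" means with all 2-cells between the retained 1-cells. **Fibrations.** "Fibration" means Grothendieck fibration. $\mathbf{Fib}$: 0-cells are fibrations $p\colon\mathcal E\to\mathcal B$; a 1-cell $p\to p'$ is a pair of functors $(B\colon\mathcal B\to\mathcal B',\,E\colon\mathcal E\to\mathcal E')$ with $p'E=Bp$ and $E$ preserving cartesian arrows; a 2-cell $(B_1,E_1)\Rightarrow(B_2,E_2)$ is a pair of natural transformations $(\psi\colon B_1\Rightarrow B_2,\ \phi\colon E_1\Rightarrow E_2)$ with $p'\phi=\psi p$. **Comprehension categories.** $\mathcal B^2$ is the arrow category. A comprehension category $(p,\chi)$ is a fibration $p\colon\mathcal E\to\mathcal B$ with a functor $\chi\colon\mathcal E\to\mathcal B^2$ such that $\mathrm{cod}\circ\chi=p$ and $\chi$ maps $p$-cartesian arrows to pullback squares ($\mathcal B$ need not have a terminal object). A lax morphism $(p,\chi)\to(p',\chi')$ is a triple $(B,H,\zeta)$ with $(B,H)\colon p\to p'$ a 1-cell in $\mathbf{Fib}$ and $\zeta\colon B^2\chi\Rightarrow\chi'H$ a natural transformation with $\mathrm{cod}\,\zeta=\mathrm{id}_{Bp}$; it is pseudo (strict) if $\zeta$ is invertible (the identity). Composition: $(B_2B_1,H_2H_1,(\zeta_2H_1)(B_2^2\zeta_1))$.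 $\mathbf{CompCat}$ has these as 0- and 1-cells; a 2-cell $(B_1,H_1,\zeta_1)\Rightarrow(B_2,H_2,\zeta_2)$ is a 2-cell $(\psi,\phi)\colon(B_1,H_1)\Rightarrow(B_2,H_2)$ in $\mathbf{Fib}$ with $\chi'\phi\circ\zeta_1=\zeta_2\circ\psi^2\chi$. $\mathbf{DscCompCat}$ is the full sub-2-category of $\mathbf{CompCat}$ on those $(p,\chi)$ with $p$ a discrete fibration. **Categories with families.** A generalised category with families (gcwf) $(u,\dot u,\Sigma\dashv\Delta)$ consists of fibrations $u\colon\mathcal U\to\mathcal B$ and $\dot u\colon\dot{\mathcal U}\to\mathcal B$, a functor $\Sigma\colon\dot{\mathcal U}\to\mathcal U$ with $u\Sigma=\dot u$ preserving cartesian arrows, and a right adjoint $\Delta$ of $\Sigma$ (not required to commute with the fibrations) such that all components of the unit are $\dot u$-cartesian and all components of the counit are $u$-cartesian. A (lax) gcwf morphism $(u,\dot u,\Sigma\dashv\Delta)\to(u',\dot u',\Sigma'\dashv\Delta')$ is a triple $(C,H,\dot H)$ with $(C,H)\colon u\to u'$ and $(C,\dot H)\colon\dot u\to\dot u'$ 1-cells in $\mathbf{Fib}$ and $\Sigma'\dot H=H\Sigma$. It is pseudo (strict) if the mate $(\Delta'H\epsilon)(\eta'\dot H\Delta)\colon\dot H\Delta\Rightarrow\Delta'H$ of the identity is invertible (the identity), where $\epsilon$ is the counit of $\Sigma\dashv\Delta$ and $\eta'$ the unit of $\Sigma'\dashv\Delta'$. A 2-cell $(C_1,H_1,\dot H_1)\to(C_2,H_2,\dot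 H_2)$ is a triple $(\psi\colon C_1\Rightarrow C_2,\phi\colon H_1\Rightarrow H_2,\dot\phi\colon\dot H_1\Rightarrow\dot H_2)$ such that $(\psi,\phi)$ and $(\psi,\dot\phi)$ are 2-cells in $\mathbf{Fib}$ and $\Sigma'\dot\phi=\phi\Sigma$. $\mathbf{CwF}$ is by definition the full sub-2-category, of the 2-category of gcwfs and gcwf morphisms, on the discrete gcwfs, i.e. those with $u$ and $\dot u$ discrete fibrations (no terminal object in the base is required). *)

theory Defs
  imports "HOL-Library.FuncSet"
begin

section \<open>Categories, functors, natural transformations\<close>

text \<open>
  All structure maps are extensional (\<^const>\<open>undefined\<close> outside their domain), and functors and
  natural transformations record their source and target.  Hence HOL equality of categories,
  functors and natural transformations is exactly the mathematical (strict) equality.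
\<close>

record ('o, 'a) cat =
  Ob :: "'o set"
  Ar :: "'a set"
  Dom :: "'a \<Rightarrow> 'o"
  Cod :: "'a \<Rightarrow> 'o"
  Idn :: "'o \<Rightarrow> 'a"
  Cmp :: "'a \<Rightarrow> 'a \<Rightarrow> 'a"  \<comment> \<open>\<open>Cmp C g f\<close> is \<open>g\<close> after \<open>f\<close>\<close>

definition hom :: "('o, 'a) cat \<Rightarrow> 'o \<Rightarrow> 'o \<Rightarrow> 'a set" where
  "hom C x y = {f \<in> Ar C. Dom C f = x \<and> Cod C f = y}"

locale category =
  fixes C :: "('o, 'a) cat"
  assumes Dom: "Dom C \<in> Ar C \<rightarrow>\<^sub>E Ob C"
    and Cod: "Cod C \<in> Ar C \<rightarrow>\<^sub>E Ob C"
    and Idn_ext: "Idn C \<in> extensional (Ob C)"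
    and Idn: "x \<in> Ob C \<Longrightarrow> Idn C x \<in> hom C x x"
    and Cmp_ext: "\<not> (f \<in> Ar C \<and> g \<in> Ar C \<and> Cod C f = Dom C g) \<Longrightarrow> Cmp C g f = undefined"
    and Cmp: "f \<in> hom C x y \<Longrightarrow> g \<in> hom C y z \<Longrightarrow> Cmp C g f \<in> hom C x z"
    and Cmp_Idn_left: "f \<in> hom C x y \<Longrightarrow> Cmp C (Idn C y) f = f"
    and Cmp_Idn_right: "f \<in> hom C x y \<Longrightarrow> Cmp C f (Idn C x) = f"
    and Cmp_assoc: "f \<in> hom C w x \<Longrightarrow> g \<in> hom C x y \<Longrightarrow> h \<in> hom C y z \<Longrightarrow>
      Cmp C h (Cmp C g f) = Cmp C (Cmp C h g) f"

record ('o, 'a, 'p, 'b) func =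
  Src :: "('o, 'a) cat"
  Trg :: "('p, 'b) cat"
  FO :: "'o \<Rightarrow> 'p"
  FA :: "'a \<Rightarrow> 'b"

definition is_functor :: "('o, 'a, 'p, 'b) func \<Rightarrow> bool" where
  "is_functor F \<longleftrightarrow>
    category (Src F) \<and> category (Trg F) \<and>
    FO F \<in> extensional (Ob (Src F)) \<and> FA F \<in> extensional (Ar (Src F)) \<and>
    (\<forall>x \<in> Ob (Src F). FO F x \<in> Ob (Trg F)) \<and>
    (\<forall>x y. \<forall>f \<in> hom (Src F) x y. FA F f \<in> hom (Trg F) (FO F x) (FO F y)) \<and>
    (\<forall>x \<in> Ob (Src F). FA F (Idn (Src F) x) = Idn (Trg F) (FO F x)) \<and>
    (\<forall>x y z. \<forall>f \<in> hom (Src F) x y. \<forall>g \<in> hom (Src F) y z.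
      FA F (Cmp (Src F) g f) = Cmp (Trg F) (FA F g) (FA F f))"

definition Fun :: "('o, 'a) cat \<Rightarrow> ('p, 'b) cat \<Rightarrow> ('o, 'a, 'p, 'b) func set" where
  "Fun C D = {F. is_functor F \<and> Src F = C \<and> Trg F = D}"

definition id_func :: "('o, 'a) cat \<Rightarrow> ('o, 'a, 'o, 'a) func" where
  "id_func C = \<lparr>Src = C, Trg = C, FO = restrict (\<lambda>x. x) (Ob C), FA = restrict (\<lambda>f. f) (Ar C)\<rparr>"

definition comp_func ::
  "('p, 'b, 'q, 'c) func \<Rightarrow> ('o, 'a, 'p, 'b) func \<Rightarrow> ('o, 'a, 'q, 'c) func" (infixl "\<odot>" 75) where
  "G \<odot> F = \<lparr>Src = Src F, Trg = Trg G,
     FO = compose (Ob (Src F)) (FO G) (FO F), FA = compose (Ar (Src F)) (FA G) (FA F)\<rparr>"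

record ('o, 'a, 'p, 'b) ntrans =
  NSrc :: "('o, 'a, 'p, 'b) func"
  NTrg :: "('o, 'a, 'p, 'b) func"
  NT :: "'o \<Rightarrow> 'b"

definition Ntr :: "('o, 'a, 'p, 'b) func \<Rightarrow> ('o, 'a, 'p, 'b) func \<Rightarrow> ('o, 'a, 'p, 'b) ntrans set" where
  "Ntr F G = {\<alpha>. NSrc \<alpha> = F \<and> NTrg \<alpha> = G \<and>
    is_functor F \<and> is_functor G \<and> Src F = Src G \<and> Trg F = Trg G \<and>
    NT \<alpha> \<in> extensional (Ob (Src F)) \<and>
    (\<forall>x \<in> Ob (Src F). NT \<alpha> x \<in> hom (Trg F) (FO F x) (FO G x)) \<and>
    (\<forall>x y. \<forall>f \<in> hom (Src F) x y.
      Cmp (Trg F) (FA G f) (NT \<alpha> x) = Cmp (Trg F) (NT \<alpha> y) (FA F f))}"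

definition id_nt :: "('o, 'a, 'p, 'b) func \<Rightarrow> ('o, 'a, 'p, 'b) ntrans" where
  "id_nt F = \<lparr>NSrc = F, NTrg = F, NT = (\<lambda>x \<in> Ob (Src F). Idn (Trg F) (FO F x))\<rparr>"

text \<open>Vertical composition: \<open>\<beta> \<bullet> \<alpha>\<close> is \<open>\<beta>\<close> after \<open>\<alpha>\<close>.\<close>

definition vcomp_nt ::
  "('o, 'a, 'p, 'b) ntrans \<Rightarrow> ('o, 'a, 'p, 'b) ntrans \<Rightarrow> ('o, 'a, 'p, 'b) ntrans" (infixl "\<bullet>" 70) where
  "\<beta> \<bullet> \<alpha> = \<lparr>NSrc = NSrc \<alpha>, NTrg = NTrg \<beta>,
     NT = (\<lambda>x \<in> Ob (Src (NSrc \<alpha>)). Cmp (Trg (NSrc \<alpha>)) (NT \<beta> x) (NT \<alpha> x))\<rparr>"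

text \<open>Whiskering: \<open>G \<lhd> \<alpha>\<close> is \<open>G \<alpha>\<close> and \<open>\<alpha> \<rhd> F\<close> is \<open>\<alpha> F\<close>.\<close>

definition whisker_left ::
  "('p, 'b, 'q, 'c) func \<Rightarrow> ('o, 'a, 'p, 'b) ntrans \<Rightarrow> ('o, 'a, 'q, 'c) ntrans" (infixr "\<lhd>" 73) where
  "G \<lhd> \<alpha> = \<lparr>NSrc = G \<odot> NSrc \<alpha>, NTrg = G \<odot> NTrg \<alpha>,
     NT = (\<lambda>x \<in> Ob (Src (NSrc \<alpha>)). FA G (NT \<alpha> x))\<rparr>"

definition whisker_right ::
  "('p, 'b, 'q, 'c) ntrans \<Rightarrow> ('o, 'a, 'p, 'b) func \<Rightarrow> ('o, 'a, 'q, 'c) ntrans" (infixl "\<rhd>" 73) where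
  "\<alpha> \<rhd> F = \<lparr>NSrc = NSrc \<alpha> \<odot> F, NTrg = NTrg \<alpha> \<odot> F,
     NT = (\<lambda>x \<in> Ob (Src F). NT \<alpha> (FO F x))\<rparr>"

definition hcomp_nt ::
  "('p, 'b, 'q, 'c) ntrans \<Rightarrow> ('o, 'a, 'p, 'b) ntrans \<Rightarrow> ('o, 'a, 'q, 'c) ntrans" (infixl "\<star>" 72) where
  "\<beta> \<star> \<alpha> = (\<beta> \<rhd> NTrg \<alpha>) \<bullet> (NSrc \<beta> \<lhd> \<alpha>)"

definition invertible_nt :: "('o, 'a, 'p, 'b) ntrans \<Rightarrow> bool" where
  "invertible_nt \<alpha> \<longleftrightarrow>
    (\<exists>\<beta> \<in> Ntr (NTrg \<alpha>) (NSrc \<alpha>). \<beta> \<bullet> \<alpha> = id_nt (NSrc \<alpha>) \<and> \<alpha> \<bullet> \<beta> = id_nt (NTrg \<alpha>))"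

section \<open>The arrow category\<close>

text \<open>An arrow \<open>f \<rightarrow> g\<close> of the arrow category is \<open>(f, g, h, k)\<close> with \<open>g h = k f\<close>: the top side
  is \<open>h\<close> (between domains), the bottom side is \<open>k\<close> (between codomains).\<close>

definition squares :: "('o, 'a) cat \<Rightarrow> ('a \<times> 'a \<times> 'a \<times> 'a) set" where
  "squares C = {(f, g, h, k). f \<in> Ar C \<and> g \<in> Ar C \<and>
     h \<in> hom C (Dom C f) (Dom C g) \<and> k \<in> hom C (Cod C f) (Cod C g) \<and>
     Cmp C g h = Cmp C k f}"

definition arr_cat :: "('o, 'a) cat \<Rightarrow> ('a, 'a \<times> 'a \<times> 'a \<times> 'a) cat" where
  "arr_cat C = \<lparr>Ob = Ar C, Ar = squares C,
     Dom = (\<lambda>(f, g, h, k) \<in> squares C. f),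
     Cod = (\<lambda>(f, g, h, k) \<in> squares C. g),
     Idn = (\<lambda>f \<in> Ar C. (f, f, Idn C (Dom C f), Idn C (Cod C f))),
     Cmp = (\<lambda>(f', g', h', k') (f, g, h, k).
       if (f, g, h, k) \<in> squares C \<and> (f', g', h', k') \<in> squares C \<and> g = f'
       then (f, g', Cmp C h' h, Cmp C k' k) else undefined)\<rparr>"

definition cod_func :: "('o, 'a) cat \<Rightarrow> ('a, 'a \<times> 'a \<times> 'a \<times> 'a, 'o, 'a) func" where
  "cod_func C = \<lparr>Src = arr_cat C, Trg = C, FO = restrict (Cod C) (Ar C),
     FA = (\<lambda>(f, g, h, k) \<in> squares C. k)\<rparr>"

definition arr_func ::
  "('o, 'a, 'p, 'b) func \<Rightarrow> ('a, 'a \<times> 'a \<times> 'a \<times> 'a, 'b, 'b \<times> 'b \<times> 'b \<times> 'b) func" where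
  "arr_func F = \<lparr>Src = arr_cat (Src F), Trg = arr_cat (Trg F), FO = restrict (FA F) (Ar (Src F)),
     FA = (\<lambda>(f, g, h, k) \<in> squares (Src F). (FA F f, FA F g, FA F h, FA F k))\<rparr>"

definition arr_nt ::
  "('o, 'a, 'p, 'b) ntrans \<Rightarrow> ('a, 'a \<times> 'a \<times> 'a \<times> 'a, 'b, 'b \<times> 'b \<times> 'b \<times> 'b) ntrans" where
  "arr_nt \<psi> = \<lparr>NSrc = arr_func (NSrc \<psi>), NTrg = arr_func (NTrg \<psi>),
     NT = (\<lambda>f \<in> Ar (Src (NSrc \<psi>)).
       (FA (NSrc \<psi>) f, FA (NTrg \<psi>) f,
        NT \<psi> (Dom (Src (NSrc \<psi>)) f), NT \<psi> (Cod (Src (NSrc \<psi>)) f)))\<rparr>"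

text \<open>The square \<open>(f, g, h, k)\<close> is a pullback of \<open>g\<close> and \<open>k\<close>.\<close>

definition pullback_square :: "('o, 'a) cat \<Rightarrow> 'a \<times> 'a \<times> 'a \<times> 'a \<Rightarrow> bool" where
  "pullback_square C = (\<lambda>(f, g, h, k). (f, g, h, k) \<in> squares C \<and>
     (\<forall>z. \<forall>a \<in> hom C z (Dom C g). \<forall>b \<in> hom C z (Cod C f). Cmp C g a = Cmp C k b \<longrightarrow>
       (\<exists>!w. w \<in> hom C z (Dom C f) \<and> Cmp C h w = a \<and> Cmp C f w = b)))"

section \<open>Fibrations\<close>

definition cartesian :: "('o, 'a, 'p, 'b) func \<Rightarrow> 'a \<Rightarrow> bool" where
  "cartesian p f \<longleftrightarrow> f \<in> Ar (Src p) \<and>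
     (\<forall>x. \<forall>g \<in> hom (Src p) x (Cod (Src p) f).
       \<forall>w \<in> hom (Trg p) (FO p x) (FO p (Dom (Src p) f)). Cmp (Trg p) (FA p f) w = FA p g \<longrightarrow>
         (\<exists>!h. h \<in> hom (Src p) x (Dom (Src p) f) \<and> FA p h = w \<and> Cmp (Src p) f h = g))"

definition fibration :: "('o, 'a, 'p, 'b) func \<Rightarrow> bool" where
  "fibration p \<longleftrightarrow> is_functor p \<and>
     (\<forall>e \<in> Ob (Src p). \<forall>s \<in> Ar (Trg p). Cod (Trg p) s = FO p e \<longrightarrow>
       (\<exists>f. cartesian p f \<and> Cod (Src p) f = e \<and> FA p f = s))"

definition discrete_fibration :: "('o, 'a, 'p, 'b) func \<Rightarrow> bool" where
  "discrete_fibration p \<longleftrightarrow> is_functor p \<and>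
     (\<forall>e \<in> Ob (Src p). \<forall>s \<in> Ar (Trg p). Cod (Trg p) s = FO p e \<longrightarrow>
       (\<exists>!f. f \<in> Ar (Src p) \<and> Cod (Src p) f = e \<and> FA p f = s))"

section \<open>Strict 2-categories\<close>

text \<open>
  \<open>Hom1 K X Y\<close> is the set of 1-cells \<open>X \<rightarrow> Y\<close> and \<open>Hom2 K X Y f g\<close> the set of 2-cells \<open>f \<Rightarrow> g\<close>.
  As for hom-sets in enriched category theory, different hom-sets need not be disjoint, so maps
  out of them (the action of a 2-functor) are indexed by the boundary.
\<close>

record ('x, 'f, 'c) two_cat =
  Obj :: "'x set"
  Hom1 :: "'x \<Rightarrow> 'x \<Rightarrow> 'f set"
  Hom2 :: "'x \<Rightarrow> 'x \<Rightarrow> 'f \<Rightarrow> 'f \<Rightarrow> 'c set"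
  id1 :: "'x \<Rightarrow> 'f"
  comp1 :: "'f \<Rightarrow> 'f \<Rightarrow> 'f"
  id2 :: "'f \<Rightarrow> 'c"
  vcomp :: "'c \<Rightarrow> 'c \<Rightarrow> 'c"
  hcomp :: "'c \<Rightarrow> 'c \<Rightarrow> 'c"

locale two_category =
  fixes K :: "('x, 'f, 'c) two_cat"
  assumes id1: "X \<in> Obj K \<Longrightarrow> id1 K X \<in> Hom1 K X X"
    and comp1: "\<lbrakk>X \<in> Obj K; Y \<in> Obj K; Z \<in> Obj K; f \<in> Hom1 K X Y; g \<in> Hom1 K Y Z\<rbrakk> \<Longrightarrow>
      comp1 K g f \<in> Hom1 K X Z"
    and comp1_id1_left: "\<lbrakk>X \<in> Obj K; Y \<in> Obj K; f \<in> Hom1 K X Y\<rbrakk> \<Longrightarrow> comp1 K (id1 K Y) f = f"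
    and comp1_id1_right: "\<lbrakk>X \<in> Obj K; Y \<in> Obj K; f \<in> Hom1 K X Y\<rbrakk> \<Longrightarrow> comp1 K f (id1 K X) = f"
    and comp1_assoc: "\<lbrakk>W \<in> Obj K; X \<in> Obj K; Y \<in> Obj K; Z \<in> Obj K;
      f \<in> Hom1 K W X; g \<in> Hom1 K X Y; h \<in> Hom1 K Y Z\<rbrakk> \<Longrightarrow>
      comp1 K h (comp1 K g f) = comp1 K (comp1 K h g) f"
    and id2: "\<lbrakk>X \<in> Obj K; Y \<in> Obj K; f \<in> Hom1 K X Y\<rbrakk> \<Longrightarrow> id2 K f \<in> Hom2 K X Y f f"
    and vcomp: "\<lbrakk>X \<in> Obj K; Y \<in> Obj K; f \<in> Hom1 K X Y; g \<in> Hom1 K X Y; h \<in> Hom1 K X Y;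
      \<alpha> \<in> Hom2 K X Y f g; \<beta> \<in> Hom2 K X Y g h\<rbrakk> \<Longrightarrow> vcomp K \<beta> \<alpha> \<in> Hom2 K X Y f h"
    and vcomp_id2_left: "\<lbrakk>X \<in> Obj K; Y \<in> Obj K; f \<in> Hom1 K X Y; g \<in> Hom1 K X Y;
      \<alpha> \<in> Hom2 K X Y f g\<rbrakk> \<Longrightarrow> vcomp K (id2 K g) \<alpha> = \<alpha>"
    and vcomp_id2_right: "\<lbrakk>X \<in> Obj K; Y \<in> Obj K; f \<in> Hom1 K X Y; g \<in> Hom1 K X Y;
      \<alpha> \<in> Hom2 K X Y f g\<rbrakk> \<Longrightarrow> vcomp K \<alpha> (id2 K f) = \<alpha>"
    and vcomp_assoc: "\<lbrakk>X \<in> Obj K; Y \<in> Obj K;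
      f \<in> Hom1 K X Y; g \<in> Hom1 K X Y; h \<in> Hom1 K X Y; k \<in> Hom1 K X Y;
      \<alpha> \<in> Hom2 K X Y f g; \<beta> \<in> Hom2 K X Y g h; \<gamma> \<in> Hom2 K X Y h k\<rbrakk> \<Longrightarrow>
      vcomp K \<gamma> (vcomp K \<beta> \<alpha>) = vcomp K (vcomp K \<gamma> \<beta>) \<alpha>"
    and hcomp: "\<lbrakk>X \<in> Obj K; Y \<in> Obj K; Z \<in> Obj K;
      f \<in> Hom1 K X Y; f' \<in> Hom1 K X Y; g \<in> Hom1 K Y Z; g' \<in> Hom1 K Y Z;
      \<alpha> \<in> Hom2 K X Y f f'; \<beta> \<in> Hom2 K Y Z g g'\<rbrakk> \<Longrightarrow>
      hcomp K \<beta> \<alpha> \<in> Hom2 K X Z (comp1 K g f) (comp1 K g' f')"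
    and hcomp_id2: "\<lbrakk>X \<in> Obj K; Y \<in> Obj K; Z \<in> Obj K; f \<in> Hom1 K X Y; g \<in> Hom1 K Y Z\<rbrakk> \<Longrightarrow>
      hcomp K (id2 K g) (id2 K f) = id2 K (comp1 K g f)"
    and interchange: "\<lbrakk>X \<in> Obj K; Y \<in> Obj K; Z \<in> Obj K;
      f \<in> Hom1 K X Y; f' \<in> Hom1 K X Y; f'' \<in> Hom1 K X Y;
      g \<in> Hom1 K Y Z; g' \<in> Hom1 K Y Z; g'' \<in> Hom1 K Y Z;
      \<alpha> \<in> Hom2 K X Y f f'; \<alpha>' \<in> Hom2 K X Y f' f'';
      \<beta> \<in> Hom2 K Y Z g g'; \<beta>' \<in> Hom2 K Y Z g' g''\<rbrakk> \<Longrightarrow>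
      hcomp K (vcomp K \<beta>' \<beta>) (vcomp K \<alpha>' \<alpha>) = vcomp K (hcomp K \<beta>' \<alpha>') (hcomp K \<beta> \<alpha>)"
    and hcomp_id1_left: "\<lbrakk>X \<in> Obj K; Y \<in> Obj K; f \<in> Hom1 K X Y; g \<in> Hom1 K X Y;
      \<alpha> \<in> Hom2 K X Y f g\<rbrakk> \<Longrightarrow> hcomp K (id2 K (id1 K Y)) \<alpha> = \<alpha>"
    and hcomp_id1_right: "\<lbrakk>X \<in> Obj K; Y \<in> Obj K; f \<in> Hom1 K X Y; g \<in> Hom1 K X Y;
      \<alpha> \<in> Hom2 K X Y f g\<rbrakk> \<Longrightarrow> hcomp K \<alpha> (id2 K (id1 K X)) = \<alpha>"
    and hcomp_assoc: "\<lbrakk>W \<in> Obj K; X \<in> Obj K; Y \<in> Obj K; Z \<in> Obj K;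
      f \<in> Hom1 K W X; f' \<in> Hom1 K W X; g \<in> Hom1 K X Y; g' \<in> Hom1 K X Y;
      h \<in> Hom1 K Y Z; h' \<in> Hom1 K Y Z;
      \<alpha> \<in> Hom2 K W X f f'; \<beta> \<in> Hom2 K X Y g g'; \<gamma> \<in> Hom2 K Y Z h h'\<rbrakk> \<Longrightarrow>
      hcomp K \<gamma> (hcomp K \<beta> \<alpha>) = hcomp K (hcomp K \<gamma> \<beta>) \<alpha>"

definition full_sub :: "('x, 'f, 'c) two_cat \<Rightarrow> ('x \<Rightarrow> bool) \<Rightarrow> ('x, 'f, 'c) two_cat" where
  "full_sub K P = K\<lparr>Obj := {X \<in> Obj K. P X}\<rparr>"

definition wide_2full_sub ::
  "('x, 'f, 'c) two_cat \<Rightarrow> ('x \<Rightarrow> 'x \<Rightarrow> 'f \<Rightarrow> bool) \<Rightarrow> ('x, 'f, 'c) two_cat" where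
  "wide_2full_sub K P = K\<lparr>Hom1 := (\<lambda>X Y. {f \<in> Hom1 K X Y. P X Y f})\<rparr>"

record ('x, 'f, 'c, 'y, 'g, 'd) two_func =
  on0 :: "'x \<Rightarrow> 'y"
  on1 :: "'x \<Rightarrow> 'x \<Rightarrow> 'f \<Rightarrow> 'g"
  on2 :: "'x \<Rightarrow> 'x \<Rightarrow> 'f \<Rightarrow> 'f \<Rightarrow> 'c \<Rightarrow> 'd"

locale two_functor = K: two_category K + L: two_category L
  for K :: "('x, 'f, 'c) two_cat" and L :: "('y, 'g, 'd) two_cat" +
  fixes F :: "('x, 'f, 'c, 'y, 'g, 'd) two_func"
  assumes on0: "X \<in> Obj K \<Longrightarrow> on0 F X \<in> Obj L"
    and on1: "\<lbrakk>X \<in> Obj K; Y \<in> Obj K; f \<in> Hom1 K X Y\<rbrakk> \<Longrightarrow>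
      on1 F X Y f \<in> Hom1 L (on0 F X) (on0 F Y)"
    and on2: "\<lbrakk>X \<in> Obj K; Y \<in> Obj K; f \<in> Hom1 K X Y; g \<in> Hom1 K X Y; \<alpha> \<in> Hom2 K X Y f g\<rbrakk> \<Longrightarrow>
      on2 F X Y f g \<alpha> \<in> Hom2 L (on0 F X) (on0 F Y) (on1 F X Y f) (on1 F X Y g)"
    and on1_id1: "X \<in> Obj K \<Longrightarrow> on1 F X X (id1 K X) = id1 L (on0 F X)"
    and on1_comp1: "\<lbrakk>X \<in> Obj K; Y \<in> Obj K; Z \<in> Obj K; f \<in> Hom1 K X Y; g \<in> Hom1 K Y Z\<rbrakk> \<Longrightarrow>
      on1 F X Z (comp1 K g f) = comp1 L (on1 F Y Z g) (on1 F X Y f)"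
    and on2_id2: "\<lbrakk>X \<in> Obj K; Y \<in> Obj K; f \<in> Hom1 K X Y\<rbrakk> \<Longrightarrow>
      on2 F X Y f f (id2 K f) = id2 L (on1 F X Y f)"
    and on2_vcomp: "\<lbrakk>X \<in> Obj K; Y \<in> Obj K; f \<in> Hom1 K X Y; g \<in> Hom1 K X Y; h \<in> Hom1 K X Y;
      \<alpha> \<in> Hom2 K X Y f g; \<beta> \<in> Hom2 K X Y g h\<rbrakk> \<Longrightarrow>
      on2 F X Y f h (vcomp K \<beta> \<alpha>) = vcomp L (on2 F X Y g h \<beta>) (on2 F X Y f g \<alpha>)"
    and on2_hcomp: "\<lbrakk>X \<in> Obj K; Y \<in> Obj K; Z \<in> Obj K;
      f \<in> Hom1 K X Y; f' \<in> Hom1 K X Y; g \<in> Hom1 K Y Z; g' \<in> Hom1 K Y Z;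
      \<alpha> \<in> Hom2 K X Y f f'; \<beta> \<in> Hom2 K Y Z g g'\<rbrakk> \<Longrightarrow>
      on2 F X Z (comp1 K g f) (comp1 K g' f') (hcomp K \<beta> \<alpha>) =
        hcomp L (on2 F Y Z g g' \<beta>) (on2 F X Y f f' \<alpha>)"

definition id_2func :: "('x, 'f, 'c, 'x, 'f, 'c) two_func" where
  "id_2func = \<lparr>on0 = (\<lambda>X. X), on1 = (\<lambda>X Y f. f), on2 = (\<lambda>X Y f g \<alpha>. \<alpha>)\<rparr>"

definition comp_2func ::
  "('y, 'g, 'd, 'z, 'h, 'e) two_func \<Rightarrow> ('x, 'f, 'c, 'y, 'g, 'd) two_func \<Rightarrow>
   ('x, 'f, 'c, 'z, 'h, 'e) two_func" where
  "comp_2func G F = \<lparr>on0 = (\<lambda>X. on0 G (on0 F X)),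
     on1 = (\<lambda>X Y f. on1 G (on0 F X) (on0 F Y) (on1 F X Y f)),
     on2 = (\<lambda>X Y f g \<alpha>. on2 G (on0 F X) (on0 F Y) (on1 F X Y f) (on1 F X Y g) (on2 F X Y f g \<alpha>))\<rparr>"

definition iso1 :: "('x, 'f, 'c) two_cat \<Rightarrow> 'x \<Rightarrow> 'x \<Rightarrow> 'f \<Rightarrow> bool" where
  "iso1 K X Y f \<longleftrightarrow> f \<in> Hom1 K X Y \<and>
     (\<exists>g \<in> Hom1 K Y X. comp1 K g f = id1 K X \<and> comp1 K f g = id1 K Y)"

text \<open>Strictly 2-natural isomorphisms \<open>F \<Rightarrow> G\<close>.\<close>

locale two_natural_iso = F: two_functor K L F + G: two_functor K L G
  for K :: "('x, 'f, 'c) two_cat" and L :: "('y, 'g, 'd) two_cat"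
    and F :: "('x, 'f, 'c, 'y, 'g, 'd) two_func" and G :: "('x, 'f, 'c, 'y, 'g, 'd) two_func" +
  fixes \<theta> :: "'x \<Rightarrow> 'g"
  assumes component_iso: "X \<in> Obj K \<Longrightarrow> iso1 L (on0 F X) (on0 G X) (\<theta> X)"
    and natural1: "\<lbrakk>X \<in> Obj K; Y \<in> Obj K; f \<in> Hom1 K X Y\<rbrakk> \<Longrightarrow>
      comp1 L (on1 G X Y f) (\<theta> X) = comp1 L (\<theta> Y) (on1 F X Y f)"
    and natural2: "\<lbrakk>X \<in> Obj K; Y \<in> Obj K; f \<in> Hom1 K X Y; g \<in> Hom1 K X Y;
      \<alpha> \<in> Hom2 K X Y f g\<rbrakk> \<Longrightarrow>
      hcomp L (on2 G X Y f g \<alpha>) (id2 L (\<theta> X)) = hcomp L (id2 L (\<theta> Y)) (on2 F X Y f g \<alpha>)"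

locale adjoint_2equivalence =
    F: two_functor K L F + G: two_functor L K G +
    unit: two_natural_iso K K id_2func "comp_2func G F" \<eta> +
    counit: two_natural_iso L L "comp_2func F G" id_2func \<epsilon>
  for K :: "('x, 'f, 'c) two_cat" and L :: "('y, 'g, 'd) two_cat"
    and F :: "('x, 'f, 'c, 'y, 'g, 'd) two_func" and G :: "('y, 'g, 'd, 'x, 'f, 'c) two_func"
    and \<eta> :: "'x \<Rightarrow> 'f" and \<epsilon> :: "'y \<Rightarrow> 'g" +
  assumes triangle_left: "X \<in> Obj K \<Longrightarrow>
      comp1 L (\<epsilon> (on0 F X)) (on1 F X (on0 G (on0 F X)) (\<eta> X)) = id1 L (on0 F X)"
    and triangle_right: "Y \<in> Obj L \<Longrightarrow>
      comp1 K (on1 G (on0 F (on0 G Y)) Y (\<epsilon> Y)) (\<eta> (on0 G Y)) = id1 K (on0 G Y)"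

section \<open>The 2-category of fibrations\<close>

text \<open>The type \<open>'v\<close> plays the role of the universe: small categories have their objects and their
  arrows in \<open>'v\<close>.\<close>

type_synonym 'v scat = "('v, 'v) cat"
type_synonym 'v sfunc = "('v, 'v, 'v, 'v) func"
type_synonym 'v snt = "('v, 'v, 'v, 'v) ntrans"

definition Fib :: "('v sfunc, 'v sfunc \<times> 'v sfunc, 'v snt \<times> 'v snt) two_cat" where
  "Fib = \<lparr>Obj = {p. fibration p},
     Hom1 = (\<lambda>p p'. {(B, E). B \<in> Fun (Trg p) (Trg p') \<and> E \<in> Fun (Src p) (Src p') \<and>
       p' \<odot> E = B \<odot> p \<and> (\<forall>f. cartesian p f \<longrightarrow> cartesian p' (FA E f))}),
     Hom2 = (\<lambda>p p' (B1, E1) (B2, E2). {(\<psi>, \<phi>). \<psi> \<in> Ntr B1 B2 \<and> \<phi> \<in> Ntr E1 E2 \<and>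
       p' \<lhd> \<phi> = \<psi> \<rhd> p}),
     id1 = (\<lambda>p. (id_func (Trg p), id_func (Src p))),
     comp1 = (\<lambda>(B2, E2) (B1, E1). (B2 \<odot> B1, E2 \<odot> E1)),
     id2 = (\<lambda>(B, E). (id_nt B, id_nt E)),
     vcomp = (\<lambda>(\<psi>2, \<phi>2) (\<psi>1, \<phi>1). (\<psi>2 \<bullet> \<psi>1, \<phi>2 \<bullet> \<phi>1)),
     hcomp = (\<lambda>(\<psi>2, \<phi>2) (\<psi>1, \<phi>1). (\<psi>2 \<star> \<psi>1, \<phi>2 \<star> \<phi>1))\<rparr>"

section \<open>Comprehension categories\<close>

type_synonym 'v to_arr_func = "('v, 'v, 'v, 'v \<times> 'v \<times> 'v \<times> 'v) func"
type_synonym 'v to_arr_nt = "('v, 'v, 'v, 'v \<times> 'v \<times> 'v \<times> 'v) ntrans"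

type_synonym 'v cc = "'v sfunc \<times> 'v to_arr_func"
type_synonym 'v cc_mor = "'v sfunc \<times> 'v sfunc \<times> 'v to_arr_nt"

definition comprehension_category :: "'v cc \<Rightarrow> bool" where
  "comprehension_category = (\<lambda>(p, \<chi>). fibration p \<and> \<chi> \<in> Fun (Src p) (arr_cat (Trg p)) \<and>
     cod_func (Trg p) \<odot> \<chi> = p \<and>
     (\<forall>f. cartesian p f \<longrightarrow> pullback_square (Trg p) (FA \<chi> f)))"

definition CompCat :: "('v cc, 'v cc_mor, 'v snt \<times> 'v snt) two_cat" where
  "CompCat = \<lparr>Obj = {X. comprehension_category X},
     Hom1 = (\<lambda>(p, \<chi>) (p', \<chi>'). {(B, H, \<zeta>). (B, H) \<in> Hom1 Fib p p' \<and>
       \<zeta> \<in> Ntr (arr_func B \<odot> \<chi>) (\<chi>' \<odot> H) \<and> cod_func (Trg p') \<lhd> \<zeta> = id_nt (B \<odot> p)}),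
     Hom2 = (\<lambda>(p, \<chi>) (p', \<chi>') (B1, H1, \<zeta>1) (B2, H2, \<zeta>2).
       {(\<psi>, \<phi>). (\<psi>, \<phi>) \<in> Hom2 Fib p p' (B1, H1) (B2, H2) \<and>
         (\<chi>' \<lhd> \<phi>) \<bullet> \<zeta>1 = \<zeta>2 \<bullet> (arr_nt \<psi> \<rhd> \<chi>)}),
     id1 = (\<lambda>(p, \<chi>). (id_func (Trg p), id_func (Src p), id_nt \<chi>)),
     comp1 = (\<lambda>(B2, H2, \<zeta>2) (B1, H1, \<zeta>1).
       (B2 \<odot> B1, H2 \<odot> H1, (\<zeta>2 \<rhd> H1) \<bullet> (arr_func B2 \<lhd> \<zeta>1))),
     id2 = (\<lambda>(B, H, \<zeta>). (id_nt B, id_nt H)),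
     vcomp = vcomp Fib,
     hcomp = hcomp Fib\<rparr>"

definition pseudo_cc :: "'v cc \<Rightarrow> 'v cc \<Rightarrow> 'v cc_mor \<Rightarrow> bool" where
  "pseudo_cc X Y = (\<lambda>(B, H, \<zeta>). invertible_nt \<zeta>)"

definition strict_cc :: "'v cc \<Rightarrow> 'v cc \<Rightarrow> 'v cc_mor \<Rightarrow> bool" where
  "strict_cc X Y = (\<lambda>(B, H, \<zeta>). \<zeta> = id_nt (NSrc \<zeta>))"

definition DscCompCat :: "('v cc, 'v cc_mor, 'v snt \<times> 'v snt) two_cat" where
  "DscCompCat = full_sub CompCat (\<lambda>(p, \<chi>). discrete_fibration p)"

section \<open>Categories with families\<close>

record 'v gcwf_data =
  ty :: "'v sfunc"   \<comment> \<open>\<open>u\<close>\<close>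
  tm :: "'v sfunc"   \<comment> \<open>\<open>u\<close> dotted\<close>
  Sgm :: "'v sfunc"
  Dlt :: "'v sfunc"
  unt :: "'v snt"    \<comment> \<open>unit of the adjunction \<open>Sgm \<stileturn> Dlt\<close>\<close>
  cnt :: "'v snt"    \<comment> \<open>counit\<close>

type_synonym 'v gcwf_mor = "'v sfunc \<times> 'v sfunc \<times> 'v sfunc"
type_synonym 'v gcwf_cell = "'v snt \<times> 'v snt \<times> 'v snt"

definition adjunction ::
  "('o, 'a, 'p, 'b) func \<Rightarrow> ('p, 'b, 'o, 'a) func \<Rightarrow>
   ('o, 'a, 'o, 'a) ntrans \<Rightarrow> ('p, 'b, 'p, 'b) ntrans \<Rightarrow> bool" where
  "adjunction L R \<eta> \<epsilon> \<longleftrightarrow> L \<in> Fun (Trg R) (Src R) \<and> R \<in> Fun (Trg L) (Src L) \<and>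
     \<eta> \<in> Ntr (id_func (Src L)) (R \<odot> L) \<and> \<epsilon> \<in> Ntr (L \<odot> R) (id_func (Trg L)) \<and>
     (\<epsilon> \<rhd> L) \<bullet> (L \<lhd> \<eta>) = id_nt L \<and> (R \<lhd> \<epsilon>) \<bullet> (\<eta> \<rhd> R) = id_nt R"

definition is_gcwf :: "'v gcwf_data \<Rightarrow> bool" where
  "is_gcwf X \<longleftrightarrow> fibration (ty X) \<and> fibration (tm X) \<and>
     Sgm X \<in> Fun (Src (tm X)) (Src (ty X)) \<and> ty X \<odot> Sgm X = tm X \<and>
     (\<forall>f. cartesian (tm X) f \<longrightarrow> cartesian (ty X) (FA (Sgm X) f)) \<and>
     adjunction (Sgm X) (Dlt X) (unt X) (cnt X) \<and>
     (\<forall>a \<in> Ob (Src (tm X)). cartesian (tm X) (NT (unt X) a)) \<and>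
     (\<forall>A \<in> Ob (Src (ty X)). cartesian (ty X) (NT (cnt X) A))"

definition GCwF :: "('v gcwf_data, 'v gcwf_mor, 'v gcwf_cell) two_cat" where
  "GCwF = \<lparr>Obj = {X. is_gcwf X},
     Hom1 = (\<lambda>X Y. {(C, H, H'). (C, H) \<in> Hom1 Fib (ty X) (ty Y) \<and>
       (C, H') \<in> Hom1 Fib (tm X) (tm Y) \<and> Sgm Y \<odot> H' = H \<odot> Sgm X}),
     Hom2 = (\<lambda>X Y (C1, H1, H1') (C2, H2, H2').
       {(\<psi>, \<phi>, \<phi>'). (\<psi>, \<phi>) \<in> Hom2 Fib (ty X) (ty Y) (C1, H1) (C2, H2) \<and>
         (\<psi>, \<phi>') \<in> Hom2 Fib (tm X) (tm Y) (C1, H1') (C2, H2') \<and>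
         Sgm Y \<lhd> \<phi>' = \<phi> \<rhd> Sgm X}),
     id1 = (\<lambda>X. (id_func (Trg (ty X)), id_func (Src (ty X)), id_func (Src (tm X)))),
     comp1 = (\<lambda>(C2, H2, H2') (C1, H1, H1'). (C2 \<odot> C1, H2 \<odot> H1, H2' \<odot> H1')),
     id2 = (\<lambda>(C, H, H'). (id_nt C, id_nt H, id_nt H')),
     vcomp = (\<lambda>(\<psi>2, \<phi>2, \<phi>2') (\<psi>1, \<phi>1, \<phi>1'). (\<psi>2 \<bullet> \<psi>1, \<phi>2 \<bullet> \<phi>1, \<phi>2' \<bullet> \<phi>1')),
     hcomp = (\<lambda>(\<psi>2, \<phi>2, \<phi>2') (\<psi>1, \<phi>1, \<phi>1'). (\<psi>2 \<star> \<psi>1, \<phi>2 \<star> \<phi>1, \<phi>2' \<star> \<phi>1'))\<rparr>"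

text \<open>The mate of the identity \<open>Sgm Y \<odot> H' = H \<odot> Sgm X\<close>; it goes from \<open>H' \<odot> Dlt X\<close> to \<open>Dlt Y \<odot> H\<close>.\<close>

definition mate :: "'v gcwf_data \<Rightarrow> 'v gcwf_data \<Rightarrow> 'v gcwf_mor \<Rightarrow> 'v snt" where
  "mate X Y = (\<lambda>(C, H, H'). ((Dlt Y \<odot> H) \<lhd> cnt X) \<bullet> (unt Y \<rhd> (H' \<odot> Dlt X)))"

definition pseudo_gcwf :: "'v gcwf_data \<Rightarrow> 'v gcwf_data \<Rightarrow> 'v gcwf_mor \<Rightarrow> bool" where
  "pseudo_gcwf X Y m \<longleftrightarrow> invertible_nt (mate X Y m)"

definition strict_gcwf :: "'v gcwf_data \<Rightarrow> 'v gcwf_data \<Rightarrow> 'v gcwf_mor \<Rightarrow> bool" where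
  "strict_gcwf X Y m \<longleftrightarrow> mate X Y m = id_nt (NSrc (mate X Y m))"

definition CwF :: "('v gcwf_data, 'v gcwf_mor, 'v gcwf_cell) two_cat" where
  "CwF = full_sub GCwF (\<lambda>X. discrete_fibration (ty X) \<and> discrete_fibration (tm X))"

end

theory Submission
  imports Defs
begin

text \<open>
  A discrete gcwf \<open>X\<close> has the comprehension functor \<open>A \<mapsto> u \<epsilon>\<^sub>A\<close>, and the mate of a gcwf morphism, projected to
  the base, is the \<open>\<zeta>\<close> of a lax morphism; this is a 2-functor from discrete gcwfs to discrete comprehension
  categories.  It is bijective on 1-cells and on 2-cells: in a discrete fibration an arrow is determined by its
  codomain and its image, so the functor on terms must send \<open>a\<close> to the domain of the lift, to
  \<open>\<Delta>' H \<Sigma> a\<close>, of \<open>\<zeta>\<^bsub>\<Sigma>a\<^esub>\<close> composed with the image of the section \<open>u \<eta>\<^sub>a\<close>.  It is also strictly surjective on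
  0-cells, by taking the sections of display maps as terms.  Such a 2-functor has an adjoint inverse with
  identity unit, whose counit is mapped to an identity.  A morphism is pseudo (strict) on either side iff the
  domain components of \<open>\<zeta>\<close> are invertible (identities).
\<close>

section \<open>Functors and natural transformations\<close>

text \<open>The comprehension functor forgets the fibration of terms, so strict surjectivity on
  objects is not formal: the gcwf of sections has to return both \<open>p\<close> and its
  comprehension functor by HOL equality. Its terms are pairs of a type and an arrow of the base,
  which must again be elements of \<open>'v\<close>; this is the reason for the infinite universe,
  where pairs can be coded bijectively. Since \<open>Dlt\<close> does not commute with the
  fibrations, a mate has no reason to lie over an identity, and its image is a genuine arrow from
  \<open>C\<close> of a context extension to the extension by the image type. Equations between
  mates are proved by transposing along the adjunction and then projected. Most other equations of
  arrows are proved from equal codomains and equal images; the equality of the domains is then a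
  conclusion, and it shows that what is reconstructed from base data has the right type. The unit
  can be an identity because the comprehension category of the chosen gcwf is the given one on the
  nose. Pseudo and strict morphisms correspond under the 2-functor, so the same inverse, unit and
  counit serve in all three cases.\<close>

context category
begin

lemma Dom_in [simp]: "f \<in> Ar C \<Longrightarrow> Dom C f \<in> Ob C"
  and Cod_in [simp]: "f \<in> Ar C \<Longrightarrow> Cod C f \<in> Ob C"
  using Dom Cod by auto

lemma Idn_in [simp]: "x \<in> Ob C \<Longrightarrow> Idn C x \<in> Ar C"
  and Dom_Idn [simp]: "x \<in> Ob C \<Longrightarrow> Dom C (Idn C x) = x"
  and Cod_Idn [simp]: "x \<in> Ob C \<Longrightarrow> Cod C (Idn C x) = x"
  using Idn by (auto simp: hom_def)

lemma Cmp_in [simp]: "\<lbrakk>f \<in> Ar C; g \<in> Ar C; Cod C f = Dom C g\<rbrakk> \<Longrightarrow> Cmp C g f \<in> Ar C"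
  and Dom_Cmp [simp]: "\<lbrakk>f \<in> Ar C; g \<in> Ar C; Cod C f = Dom C g\<rbrakk> \<Longrightarrow> Dom C (Cmp C g f) = Dom C f"
  and Cod_Cmp [simp]: "\<lbrakk>f \<in> Ar C; g \<in> Ar C; Cod C f = Dom C g\<rbrakk> \<Longrightarrow> Cod C (Cmp C g f) = Cod C g"
  using Cmp[of f "Dom C f" "Cod C f" g "Cod C g"] by (auto simp: hom_def)

lemma Cmp_Idn_l [simp]: "\<lbrakk>f \<in> Ar C; Cod C f = y\<rbrakk> \<Longrightarrow> Cmp C (Idn C y) f = f"
  and Cmp_Idn_r [simp]: "\<lbrakk>f \<in> Ar C; Dom C f = x\<rbrakk> \<Longrightarrow> Cmp C f (Idn C x) = f"
  using Cmp_Idn_left[of f "Dom C f" y] Cmp_Idn_right[of f x "Cod C f"] by (auto simp: hom_def)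

lemma assoc: "\<lbrakk>f \<in> Ar C; g \<in> Ar C; h \<in> Ar C; Cod C f = Dom C g; Cod C g = Dom C h\<rbrakk> \<Longrightarrow>
    Cmp C (Cmp C h g) f = Cmp C h (Cmp C g f)"
  using Cmp_assoc[of f "Dom C f" "Dom C g" g "Dom C h" h "Cod C h"] by (auto simp: hom_def)

end

lemma categoryI:
  assumes "\<And>f. f \<in> Ar C \<Longrightarrow> Dom C f \<in> Ob C" "\<And>f. f \<in> Ar C \<Longrightarrow> Cod C f \<in> Ob C"
    and "Dom C \<in> extensional (Ar C)" "Cod C \<in> extensional (Ar C)" "Idn C \<in> extensional (Ob C)"
    and "\<And>x. x \<in> Ob C \<Longrightarrow> Idn C x \<in> Ar C \<and> Dom C (Idn C x) = x \<and> Cod C (Idn C x) = x"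
    and "\<And>f g. \<not> (f \<in> Ar C \<and> g \<in> Ar C \<and> Cod C f = Dom C g) \<Longrightarrow> Cmp C g f = undefined"
    and "\<And>f g. \<lbrakk>f \<in> Ar C; g \<in> Ar C; Cod C f = Dom C g\<rbrakk> \<Longrightarrow>
      Cmp C g f \<in> Ar C \<and> Dom C (Cmp C g f) = Dom C f \<and> Cod C (Cmp C g f) = Cod C g"
    and "\<And>f. f \<in> Ar C \<Longrightarrow> Cmp C (Idn C (Cod C f)) f = f \<and> Cmp C f (Idn C (Dom C f)) = f"
    and "\<And>f g h. \<lbrakk>f \<in> Ar C; g \<in> Ar C; h \<in> Ar C; Cod C f = Dom C g; Cod C g = Dom C h\<rbrakk> \<Longrightarrow>
      Cmp C h (Cmp C g f) = Cmp C (Cmp C h g) f"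
  shows "category C"
  using assms by unfold_locales (auto simp: hom_def extensional_def PiE_def)

text \<open>Naming source and target makes \<open>Src F = C\<close> and \<open>Trg F = D\<close>
  rewrite rules, so that typing side conditions are stated in terms of \<open>C\<close> and
  \<open>D\<close> and discharged by simplification.\<close>

locale fctr =
  fixes F :: "('o, 'a, 'p, 'b) func" and C D
  assumes Fun: "F \<in> Fun C D"
begin

sublocale C: category C using Fun by (auto simp: Fun_def is_functor_def)
sublocale D: category D using Fun by (auto simp: Fun_def is_functor_def)

lemma is_functor [simp]: "is_functor F" and Src [simp]: "Src F = C" and Trg [simp]: "Trg F = D"
  using Fun by (auto simp: Fun_def)

lemma FO_ext: "FO F \<in> extensional (Ob C)" and FA_ext: "FA F \<in> extensional (Ar C)"
  using Fun by (auto simp: Fun_def is_functor_def)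

lemma FO_in [simp]: "x \<in> Ob C \<Longrightarrow> FO F x \<in> Ob D"
  and FA_in [simp]: "f \<in> Ar C \<Longrightarrow> FA F f \<in> Ar D"
  and Dom_FA [simp]: "f \<in> Ar C \<Longrightarrow> Dom D (FA F f) = FO F (Dom C f)"
  and Cod_FA [simp]: "f \<in> Ar C \<Longrightarrow> Cod D (FA F f) = FO F (Cod C f)"
  and FA_Idn [simp]: "x \<in> Ob C \<Longrightarrow> FA F (Idn C x) = Idn D (FO F x)"
  and FA_Cmp [simp]: "\<lbrakk>f \<in> Ar C; g \<in> Ar C; Cod C f = Dom C g\<rbrakk> \<Longrightarrow>
    FA F (Cmp C g f) = Cmp D (FA F g) (FA F f)"
  using Fun by (auto simp: Fun_def is_functor_def hom_def)

end

lemma FunI: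
  assumes "category C" "category D" "Src F = C" "Trg F = D"
    and "FO F \<in> extensional (Ob C)" "FA F \<in> extensional (Ar C)"
    and "\<And>x. x \<in> Ob C \<Longrightarrow> FO F x \<in> Ob D"
    and "\<And>f. f \<in> Ar C \<Longrightarrow> FA F f \<in> Ar D \<and> Dom D (FA F f) = FO F (Dom C f) \<and> Cod D (FA F f) = FO F (Cod C f)"
    and "\<And>x. x \<in> Ob C \<Longrightarrow> FA F (Idn C x) = Idn D (FO F x)"
    and "\<And>f g. \<lbrakk>f \<in> Ar C; g \<in> Ar C; Cod C f = Dom C g\<rbrakk> \<Longrightarrow> FA F (Cmp C g f) = Cmp D (FA F g) (FA F f)"
  shows "F \<in> Fun C D"
  using assms by (auto simp: Fun_def is_functor_def hom_def)

lemma Fun_eqI: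
  assumes "F \<in> Fun C D" "G \<in> Fun C D"
    and "\<And>x. x \<in> Ob C \<Longrightarrow> FO F x = FO G x" "\<And>f. f \<in> Ar C \<Longrightarrow> FA F f = FA G f"
  shows "F = G"
proof -
  interpret F: fctr F C D by unfold_locales fact
  interpret G: fctr G C D by unfold_locales fact
  show ?thesis
    using extensionalityI[OF F.FO_ext G.FO_ext] extensionalityI[OF F.FA_ext G.FA_ext] assms(3,4)
    by (intro func.equality) auto
qed

lemma FO_id [simp]: "x \<in> Ob C \<Longrightarrow> FO (id_func C) x = x"
  and FA_id [simp]: "f \<in> Ar C \<Longrightarrow> FA (id_func C) f = f"
  and Src_id [simp]: "Src (id_func C) = C" and Trg_id [simp]: "Trg (id_func C) = C"
  by (auto simp: id_func_def)

lemma FO_comp [simp]: "x \<in> Ob (Src F) \<Longrightarrow> FO (G \<odot> F) x = FO G (FO F x)"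
  and FA_comp [simp]: "f \<in> Ar (Src F) \<Longrightarrow> FA (G \<odot> F) f = FA G (FA F f)"
  and Src_comp [simp]: "Src (G \<odot> F) = Src F" and Trg_comp [simp]: "Trg (G \<odot> F) = Trg G"
  by (auto simp: comp_func_def compose_def)

lemma id_Fun: "category C \<Longrightarrow> id_func C \<in> Fun C C"
proof -
  assume "category C"
  then interpret category C .
  show ?thesis by (rule FunI) (auto simp: category_axioms, auto simp: id_func_def)
qed

lemma comp_Fun: assumes "F \<in> Fun C D" "G \<in> Fun D E" shows "G \<odot> F \<in> Fun C E"
proof -
  interpret F: fctr F C D by unfold_locales fact
  interpret G: fctr G D E by unfold_locales fact
  show ?thesis by (rule FunI) (auto simp: F.C.category_axioms G.D.category_axioms, auto simp: comp_func_def)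
qed

lemma Fun_category: "F \<in> Fun C D \<Longrightarrow> category C \<and> category D"
  by (auto simp: Fun_def is_functor_def)

lemma comp_id_left: "F \<in> Fun C D \<Longrightarrow> id_func D \<odot> F = F"
proof -
  assume F: "F \<in> Fun C D"
  then interpret fctr F C D by unfold_locales
  show ?thesis by (rule Fun_eqI[OF comp_Fun[OF F id_Fun] F]) (auto simp: D.category_axioms)
qed

lemma comp_id_right: "F \<in> Fun C D \<Longrightarrow> F \<odot> id_func C = F"
proof -
  assume F: "F \<in> Fun C D"
  then interpret fctr F C D by unfold_locales
  show ?thesis by (rule Fun_eqI[OF comp_Fun[OF id_Fun F] F]) (auto simp: C.category_axioms)
qed

lemma comp_assoc:
  assumes F: "F \<in> Fun B C" and G: "G \<in> Fun C D" and H: "H \<in> Fun D E"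
  shows "H \<odot> (G \<odot> F) = (H \<odot> G) \<odot> F"
proof -
  interpret F: fctr F B C by unfold_locales fact
  interpret G: fctr G C D by unfold_locales fact
  show ?thesis
    by (rule Fun_eqI[OF comp_Fun[OF comp_Fun[OF F G] H] comp_Fun[OF F comp_Fun[OF G H]]]) auto
qed

locale ntr = F: fctr F C D + G: fctr G C D for F G :: "('o, 'a, 'p, 'b) func" and C D +
  fixes \<alpha>
  assumes Ntr: "\<alpha> \<in> Ntr F G"
begin

lemma NSrc [simp]: "NSrc \<alpha> = F" and NTrg [simp]: "NTrg \<alpha> = G"
  and ext: "NT \<alpha> \<in> extensional (Ob C)"
  using Ntr by (auto simp: Ntr_def)

lemma NT_in [simp]: "x \<in> Ob C \<Longrightarrow> NT \<alpha> x \<in> Ar D"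
  and Dom_NT [simp]: "x \<in> Ob C \<Longrightarrow> Dom D (NT \<alpha> x) = FO F x"
  and Cod_NT [simp]: "x \<in> Ob C \<Longrightarrow> Cod D (NT \<alpha> x) = FO G x"
  and nat: "f \<in> Ar C \<Longrightarrow> Cmp D (FA G f) (NT \<alpha> (Dom C f)) = Cmp D (NT \<alpha> (Cod C f)) (FA F f)"
  using Ntr by (auto simp: Ntr_def hom_def)

end

lemma NtrI:
  assumes "F \<in> Fun C D" "G \<in> Fun C D" "NSrc \<alpha> = F" "NTrg \<alpha> = G" "NT \<alpha> \<in> extensional (Ob C)"
    and "\<And>x. x \<in> Ob C \<Longrightarrow> NT \<alpha> x \<in> Ar D \<and> Dom D (NT \<alpha> x) = FO F x \<and> Cod D (NT \<alpha> x) = FO G x"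
    and "\<And>f. f \<in> Ar C \<Longrightarrow> Cmp D (FA G f) (NT \<alpha> (Dom C f)) = Cmp D (NT \<alpha> (Cod C f)) (FA F f)"
  shows "\<alpha> \<in> Ntr F G"
  using assms by (auto simp: Ntr_def Fun_def hom_def)

lemma ntrI: "\<lbrakk>F \<in> Fun C D; G \<in> Fun C D; \<alpha> \<in> Ntr F G\<rbrakk> \<Longrightarrow> ntr F G C D \<alpha>"
  by unfold_locales auto

text \<open>Membership in \<open>Ntr F G\<close> already forces \<open>G\<close> to be a functor
  between the same categories as \<open>F\<close>, so typing one end suffices.\<close>

lemma ntrI': "\<lbrakk>F \<in> Fun C D; \<alpha> \<in> Ntr F G\<rbrakk> \<Longrightarrow> ntr F G C D \<alpha>"
  by unfold_locales (auto simp: Ntr_def Fun_def)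

lemma Ntr_eqI:
  assumes "\<alpha> \<in> Ntr F G" "\<beta> \<in> Ntr F G" "F \<in> Fun C D" "\<And>x. x \<in> Ob C \<Longrightarrow> NT \<alpha> x = NT \<beta> x"
  shows "\<alpha> = \<beta>"
proof -
  have "NT \<alpha> = NT \<beta>" by (rule extensionalityI[of _ "Ob C"]) (use assms in \<open>auto simp: Ntr_def Fun_def\<close>)
  then show ?thesis using assms(1,2) by (intro ntrans.equality) (auto simp: Ntr_def)
qed

lemma NT_id [simp]: "x \<in> Ob (Src F) \<Longrightarrow> NT (id_nt F) x = Idn (Trg F) (FO F x)"
  and NSrc_id [simp]: "NSrc (id_nt F) = F" and NTrg_id [simp]: "NTrg (id_nt F) = F"
  by (auto simp: id_nt_def)

lemma NT_vcomp [simp]: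
  "x \<in> Ob (Src (NSrc \<alpha>)) \<Longrightarrow> NT (\<beta> \<bullet> \<alpha>) x = Cmp (Trg (NSrc \<alpha>)) (NT \<beta> x) (NT \<alpha> x)"
  and NSrc_vcomp [simp]: "NSrc (\<beta> \<bullet> \<alpha>) = NSrc \<alpha>" and NTrg_vcomp [simp]: "NTrg (\<beta> \<bullet> \<alpha>) = NTrg \<beta>"
  by (auto simp: vcomp_nt_def)

lemma NT_whisker_left [simp]: "x \<in> Ob (Src (NSrc \<alpha>)) \<Longrightarrow> NT (G \<lhd> \<alpha>) x = FA G (NT \<alpha> x)"
  and NSrc_whisker_left [simp]: "NSrc (G \<lhd> \<alpha>) = G \<odot> NSrc \<alpha>"
  and NTrg_whisker_left [simp]: "NTrg (G \<lhd> \<alpha>) = G \<odot> NTrg \<alpha>"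
  by (auto simp: whisker_left_def)

lemma NT_whisker_right [simp]: "x \<in> Ob (Src F) \<Longrightarrow> NT (\<alpha> \<rhd> F) x = NT \<alpha> (FO F x)"
  and NSrc_whisker_right [simp]: "NSrc (\<alpha> \<rhd> F) = NSrc \<alpha> \<odot> F"
  and NTrg_whisker_right [simp]: "NTrg (\<alpha> \<rhd> F) = NTrg \<alpha> \<odot> F"
  by (auto simp: whisker_right_def)

lemma id_Ntr: assumes "F \<in> Fun C D" shows "id_nt F \<in> Ntr F F"
proof -
  interpret fctr F C D by unfold_locales fact
  show ?thesis by (rule NtrI[of _ C D]) (auto simp: Fun, auto simp: id_nt_def)
qed

lemma vcomp_Ntr:
  assumes "F \<in> Fun C D" "\<alpha> \<in> Ntr F G" "\<beta> \<in> Ntr G H" shows "\<beta> \<bullet> \<alpha> \<in> Ntr F H"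
proof -
  interpret a: ntr F G C D \<alpha> by (rule ntrI') fact+
  interpret b: ntr G H C D \<beta> by (rule ntrI') (use assms a.G.Fun in auto)
  show ?thesis
  proof (rule NtrI[OF a.F.Fun b.G.Fun])
    fix f assume f: "f \<in> Ar C"
    show "Cmp D (FA H f) (NT (\<beta> \<bullet> \<alpha>) (Dom C f)) = Cmp D (NT (\<beta> \<bullet> \<alpha>) (Cod C f)) (FA F f)"
    proof -
      have "Cmp D (FA H f) (NT (\<beta> \<bullet> \<alpha>) (Dom C f)) = Cmp D (Cmp D (FA H f) (NT \<beta> (Dom C f))) (NT \<alpha> (Dom C f))"
        using f by (simp add: a.F.D.assoc)
      also have "\<dots> = Cmp D (NT \<beta> (Cod C f)) (Cmp D (FA G f) (NT \<alpha> (Dom C f)))"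
        using f by (simp add: b.nat a.F.D.assoc)
      also have "\<dots> = Cmp D (NT (\<beta> \<bullet> \<alpha>) (Cod C f)) (FA F f)"
        using f by (simp add: a.nat a.F.D.assoc)
      finally show ?thesis .
    qed
  qed (auto, auto simp: vcomp_nt_def)
qed

lemma whisker_left_Ntr:
  assumes "F \<in> Fun C D" "\<alpha> \<in> Ntr F F'" "G \<in> Fun D E" shows "G \<lhd> \<alpha> \<in> Ntr (G \<odot> F) (G \<odot> F')"
proof -
  interpret a: ntr F F' C D \<alpha> by (rule ntrI') fact+
  interpret G: fctr G D E by unfold_locales fact
  show ?thesis
  proof (rule NtrI[OF comp_Fun[OF a.F.Fun G.Fun] comp_Fun[OF a.G.Fun G.Fun]])
    fix f assume f: "f \<in> Ar C"
    show "Cmp E (FA (G \<odot> F') f) (NT (G \<lhd> \<alpha>) (Dom C f)) = Cmp E (NT (G \<lhd> \<alpha>) (Cod C f)) (FA (G \<odot> F) f)"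
      using f arg_cong[OF a.nat[OF f], of "FA G"] by simp
  qed (auto, auto simp: whisker_left_def)
qed

lemma whisker_right_Ntr:
  assumes "F \<in> Fun C D" "G \<in> Fun D E" "\<alpha> \<in> Ntr G G'" shows "\<alpha> \<rhd> F \<in> Ntr (G \<odot> F) (G' \<odot> F)"
proof -
  interpret a: ntr G G' D E \<alpha> by (rule ntrI') fact+
  interpret F: fctr F C D by unfold_locales fact
  show ?thesis
  proof (rule NtrI[OF comp_Fun[OF F.Fun a.F.Fun] comp_Fun[OF F.Fun a.G.Fun]])
    fix f assume f: "f \<in> Ar C"
    show "Cmp E (FA (G' \<odot> F) f) (NT (\<alpha> \<rhd> F) (Dom C f)) = Cmp E (NT (\<alpha> \<rhd> F) (Cod C f)) (FA (G \<odot> F) f)"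
      using f a.nat[of "FA F f"] by simp
  qed (auto, auto simp: whisker_right_def)
qed

lemma hcomp_Ntr:
  assumes "F \<in> Fun C D" "\<alpha> \<in> Ntr F F'" "G \<in> Fun D E" "\<beta> \<in> Ntr G G'"
  shows "\<beta> \<star> \<alpha> \<in> Ntr (G \<odot> F) (G' \<odot> F')"
proof -
  interpret a: ntr F F' C D \<alpha> by (rule ntrI') fact+
  interpret b: ntr G G' D E \<beta> by (rule ntrI') fact+
  show ?thesis unfolding hcomp_nt_def
    by (rule vcomp_Ntr[OF comp_Fun[OF a.F.Fun b.F.Fun]])
      (use assms a.G.Fun in \<open>auto intro: whisker_left_Ntr whisker_right_Ntr\<close>)
qed

lemma NT_hcomp:
  assumes "F \<in> Fun C D" "\<alpha> \<in> Ntr F F'" "G \<in> Fun D E" "\<beta> \<in> Ntr G G'" "x \<in> Ob C"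
  shows "NT (\<beta> \<star> \<alpha>) x = Cmp E (NT \<beta> (FO F' x)) (FA G (NT \<alpha> x))"
proof -
  interpret a: ntr F F' C D \<alpha> by (rule ntrI') fact+
  interpret b: ntr G G' D E \<beta> by (rule ntrI') fact+
  show ?thesis unfolding hcomp_nt_def using \<open>x \<in> Ob C\<close> by simp
qed

text \<open>Object and arrow types are fixed, hence all categories involved share one type.
  \<open>Cat\<close> receives three projections of \<open>CwF\<close>, so that its axioms settle
  those of \<open>CwF\<close> for base, types and terms at once.\<close>

definition Cat :: "(('o, 'a) cat, ('o, 'a, 'o, 'a) func, ('o, 'a, 'o, 'a) ntrans) two_cat" where
  "Cat = \<lparr>Obj = {C. category C}, Hom1 = Fun, Hom2 = (\<lambda>C D. Ntr), id1 = id_func, comp1 = (\<odot>),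
     id2 = id_nt, vcomp = (\<bullet>), hcomp = (\<star>)\<rparr>"

lemma two_category_Cat: "two_category (Cat :: (('o, 'a) cat, _, _) two_cat)"
proof -
  have id_left: "id_nt g \<bullet> \<alpha> = \<alpha>" and id_right: "\<alpha> \<bullet> id_nt f = \<alpha>"
    and hid_left: "id_nt (id_func D) \<star> \<alpha> = \<alpha>" and hid_right: "\<alpha> \<star> id_nt (id_func C) = \<alpha>"
    if f: "f \<in> Fun C D" and g: "g \<in> Fun C D" and a: "\<alpha> \<in> Ntr f g"
    for C D :: "('o, 'a) cat" and f g \<alpha>
  proof -
    interpret f: fctr f C D by unfold_locales fact
    interpret a: ntr f g C D \<alpha> by (rule ntrI) fact+
    show "id_nt g \<bullet> \<alpha> = \<alpha>" by (rule Ntr_eqI[OF vcomp_Ntr[OF f a id_Ntr[OF g]] a f]) auto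
    show "\<alpha> \<bullet> id_nt f = \<alpha>" by (rule Ntr_eqI[OF vcomp_Ntr[OF f id_Ntr[OF f] a] a f]) auto
    show "id_nt (id_func D) \<star> \<alpha> = \<alpha>"
      by (rule Ntr_eqI[OF _ a f])
        (use hcomp_Ntr[OF f a id_Fun id_Ntr[OF id_Fun]] in
          \<open>auto simp: f.D.category_axioms NT_hcomp[OF f a id_Fun id_Ntr[OF id_Fun]] comp_id_left[OF f] comp_id_left[OF g]\<close>)
    show "\<alpha> \<star> id_nt (id_func C) = \<alpha>"
      by (rule Ntr_eqI[OF _ a f])
        (use hcomp_Ntr[OF id_Fun id_Ntr[OF id_Fun] f a] in
          \<open>auto simp: f.C.category_axioms NT_hcomp[OF id_Fun id_Ntr[OF id_Fun] f a] comp_id_right[OF f] comp_id_right[OF g]\<close>)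
  qed
  have assoc: "\<gamma> \<bullet> (\<beta> \<bullet> \<alpha>) = \<gamma> \<bullet> \<beta> \<bullet> \<alpha>"
    if f: "f \<in> Fun C D" and g: "g \<in> Fun C D" and h: "h \<in> Fun C D" and k: "k \<in> Fun C D"
    and a: "\<alpha> \<in> Ntr f g" and b: "\<beta> \<in> Ntr g h" and c: "\<gamma> \<in> Ntr h k"
    for C D :: "('o, 'a) cat" and f g h k \<alpha> \<beta> \<gamma>
  proof -
    interpret a: ntr f g C D \<alpha> by (rule ntrI) fact+
    interpret b: ntr g h C D \<beta> by (rule ntrI) fact+
    interpret c: ntr h k C D \<gamma> by (rule ntrI) fact+
    show ?thesis
      by (rule Ntr_eqI[OF vcomp_Ntr[OF f vcomp_Ntr[OF f a b] c] vcomp_Ntr[OF f a vcomp_Ntr[OF g b c]] f])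
        (auto simp: a.F.D.assoc)
  qed
  have hid: "id_nt g \<star> id_nt f = id_nt (g \<odot> f)" if f: "f \<in> Fun C D" and g: "g \<in> Fun D E"
    for C D E :: "('o, 'a) cat" and f g
  proof -
    interpret f: fctr f C D by unfold_locales fact
    interpret g: fctr g D E by unfold_locales fact
    show ?thesis
      by (rule Ntr_eqI[OF hcomp_Ntr[OF f id_Ntr[OF f] g id_Ntr[OF g]] id_Ntr[OF comp_Fun[OF f g]] comp_Fun[OF f g]])
        (auto simp: NT_hcomp[OF f id_Ntr[OF f] g id_Ntr[OF g]])
  qed
  have inter: "(\<beta>' \<bullet> \<beta>) \<star> (\<alpha>' \<bullet> \<alpha>) = \<beta>' \<star> \<alpha>' \<bullet> \<beta> \<star> \<alpha>"
    if f: "f \<in> Fun C D" "f' \<in> Fun C D" "f'' \<in> Fun C D" and g: "g \<in> Fun D E" "g' \<in> Fun D E" "g'' \<in> Fun D E"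
      and a: "\<alpha> \<in> Ntr f f'" and a': "\<alpha>' \<in> Ntr f' f''" and b: "\<beta> \<in> Ntr g g'" and b': "\<beta>' \<in> Ntr g' g''"
    for C D E :: "('o, 'a) cat" and f f' f'' g g' g'' \<alpha> \<alpha>' \<beta> \<beta>'
  proof -
    interpret a: ntr f f' C D \<alpha> by (rule ntrI) fact+
    interpret a': ntr f' f'' C D \<alpha>' by (rule ntrI) fact+
    interpret b: ntr g g' D E \<beta> by (rule ntrI) fact+
    interpret b': ntr g' g'' D E \<beta>' by (rule ntrI) fact+
    have N: "NSrc (\<beta> \<star> \<alpha>) = g \<odot> f" by (simp add: hcomp_nt_def)
    show ?thesis
    proof (rule Ntr_eqI[OF hcomp_Ntr[OF f(1) vcomp_Ntr[OF f(1) a a'] g(1) vcomp_Ntr[OF g(1) b b']]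
          vcomp_Ntr[OF comp_Fun[OF f(1) g(1)] hcomp_Ntr[OF f(1) a g(1) b] hcomp_Ntr[OF f(2) a' g(2) b']] comp_Fun[OF f(1) g(1)]])
      fix x assume x: "x \<in> Ob C"
      \<comment> \<open>Naturality of \<open>\<beta>\<close> at the arrow
        \<open>NT \<alpha>' x\<close> exchanges the two middle factors; the rest of the interchange
        law is associativity.\<close>
      have "Cmp E (NT \<beta> (FO f'' x)) (Cmp E (FA g (NT \<alpha>' x)) (FA g (NT \<alpha> x))) =
        Cmp E (FA g' (NT \<alpha>' x)) (Cmp E (NT \<beta> (FO f' x)) (FA g (NT \<alpha> x)))"
        using x b.nat[of "NT \<alpha>' x"] by (simp add: b.F.D.assoc[symmetric])
      then show "NT ((\<beta>' \<bullet> \<beta>) \<star> (\<alpha>' \<bullet> \<alpha>)) x = NT (\<beta>' \<star> \<alpha>' \<bullet> \<beta> \<star> \<alpha>) x"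
        using x by (simp add: N NT_hcomp[OF f(1) vcomp_Ntr[OF f(1) a a'] g(1) vcomp_Ntr[OF g(1) b b']]
            NT_hcomp[OF f(1) a g(1) b] NT_hcomp[OF f(2) a' g(2) b'] b.F.D.assoc)
    qed
  qed
  have hassoc: "\<gamma> \<star> (\<beta> \<star> \<alpha>) = \<gamma> \<star> \<beta> \<star> \<alpha>"
    if f: "f \<in> Fun B C" "f' \<in> Fun B C" and g: "g \<in> Fun C D" "g' \<in> Fun C D" and h: "h \<in> Fun D E" "h' \<in> Fun D E"
      and a: "\<alpha> \<in> Ntr f f'" and b: "\<beta> \<in> Ntr g g'" and c: "\<gamma> \<in> Ntr h h'"
    for B C D E :: "('o, 'a) cat" and f f' g g' h h' \<alpha> \<beta> \<gamma>
  proof -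
    interpret a: ntr f f' B C \<alpha> by (rule ntrI) fact+
    interpret b: ntr g g' C D \<beta> by (rule ntrI) fact+
    interpret c: ntr h h' D E \<gamma> by (rule ntrI) fact+
    note ba = hcomp_Ntr[OF f(1) a g(1) b] and cb = hcomp_Ntr[OF g(1) b h(1) c]
      and gf = comp_Fun[OF f(1) g(1)] and hg = comp_Fun[OF g(1) h(1)]
    have 1: "\<gamma> \<star> \<beta> \<star> \<alpha> \<in> Ntr (h \<odot> (g \<odot> f)) (h' \<odot> (g' \<odot> f'))"
      using hcomp_Ntr[OF f(1) a hg cb] comp_assoc[OF f(1) g(1) h(1)] comp_assoc[OF f(2) g(2) h(2)] by simp
    show ?thesis
      by (rule Ntr_eqI[OF hcomp_Ntr[OF gf ba h(1) c] 1 comp_Fun[OF gf h(1)]])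
        (auto simp: NT_hcomp[OF gf ba h(1) c] NT_hcomp[OF f(1) a hg cb] NT_hcomp[OF f(1) a g(1) b]
          NT_hcomp[OF g(1) b h(1) c] c.F.D.assoc)
  qed
  show ?thesis
    by (rule two_category.intro; simp add: Cat_def)
      (auto simp: id_Fun comp_id_left comp_id_right id_left id_right hid_left hid_right assoc hid inter hassoc
        intro: comp_Fun comp_assoc id_Ntr vcomp_Ntr hcomp_Ntr)
qed

section \<open>Discrete fibrations and the 2-category of discrete gcwfs\<close>

locale discrete_fib = fctr p E B for p :: "('o, 'a, 'p, 'b) func" and E B +
  assumes disc: "discrete_fibration p"
begin

lemma lift_ex1: "\<lbrakk>e \<in> Ob E; s \<in> Ar B; Cod B s = FO p e\<rbrakk> \<Longrightarrow> \<exists>!f. f \<in> Ar E \<and> Cod E f = e \<and> FA p f = s"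
  using disc by (simp add: discrete_fibration_def)

text \<open>No assumption relates the two domains: their equality comes with that of the arrows.
  This is used throughout to find the domain of a lift.\<close>

lemma arr_eqI:
  assumes "f \<in> Ar E" "g \<in> Ar E" "Cod E f = Cod E g" "FA p f = FA p g"
  shows "f = g"
  using lift_ex1[of "Cod E g" "FA p g"] assms by auto

definition lift :: "'o \<Rightarrow> 'b \<Rightarrow> 'a" where
  "lift e s = (THE f. f \<in> Ar E \<and> Cod E f = e \<and> FA p f = s)"

lemma
  assumes "e \<in> Ob E" "s \<in> Ar B" "Cod B s = FO p e"
  shows lift_in [simp]: "lift e s \<in> Ar E" and Cod_lift [simp]: "Cod E (lift e s) = e"
    and FA_lift [simp]: "FA p (lift e s) = s" and FO_Dom_lift [simp]: "FO p (Dom E (lift e s)) = Dom B s"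
proof -
  show 1: "lift e s \<in> Ar E" and "Cod E (lift e s) = e" and 2: "FA p (lift e s) = s"
    using theI'[OF lift_ex1[OF assms]] by (auto simp: lift_def)
  show "FO p (Dom E (lift e s)) = Dom B s" using Dom_FA[OF 1] 2 by simp
qed

text \<open>The factorisation of \<open>g\<close> through \<open>f\<close> over \<open>w\<close> can
  only be the lift of \<open>w\<close> to the domain of \<open>f\<close>, and composing it with
  \<open>f\<close> gives an arrow with the codomain and the image of \<open>g\<close>, that is,
  \<open>g\<close>.\<close>

lemma cartesian_iff: "cartesian p f \<longleftrightarrow> f \<in> Ar E"
proof
  assume f: "f \<in> Ar E"
  show "cartesian p f" unfolding cartesian_def Src Trg
  proof (intro conjI allI ballI impI)
    fix x g w
    assume "g \<in> hom E x (Cod E f)" and "w \<in> hom B (FO p x) (FO p (Dom E f))" and e: "Cmp B (FA p f) w = FA p g"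
    then have g: "g \<in> Ar E \<and> Dom E g = x \<and> Cod E g = Cod E f"
      and w: "w \<in> Ar B \<and> Dom B w = FO p x \<and> Cod B w = FO p (Dom E f)" by (auto simp: hom_def)
    let ?h = "lift (Dom E f) w"
    have "Cmp E f ?h = g" by (rule arr_eqI) (use f g w e in auto)
    \<comment> \<open>The composite equals \<open>g\<close>, so it starts where \<open>g\<close>
      does; this fixes the domain of the lift.\<close>
    moreover from this have "Dom E ?h = x" using C.Dom_Cmp[of ?h f] f g w by auto
    ultimately show "\<exists>!h. h \<in> hom E x (Dom E f) \<and> FA p h = w \<and> Cmp E f h = g"
    proof (intro ex1I[of _ ?h])
      show "h = ?h" if "h \<in> hom E x (Dom E f) \<and> FA p h = w \<and> Cmp E f h = g" for h
        by (rule arr_eqI) (use that f w in \<open>auto simp: hom_def\<close>)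
    qed (use f w in \<open>simp add: hom_def\<close>)
  qed (rule f)
qed (simp add: cartesian_def)

lemma fibration: "fibration p"
  unfolding fibration_def cartesian_iff using lift_ex1 by fastforce

end

lemma discrete_fib_iff: "p \<in> Fun E B \<Longrightarrow> discrete_fib p E B \<longleftrightarrow> discrete_fibration p"
  by (simp add: discrete_fib_def fctr_def discrete_fib_axioms_def)

lemma discrete_fibI: "discrete_fibration p \<Longrightarrow> discrete_fib p (Src p) (Trg p)"
  by (subst discrete_fib_iff) (auto simp: discrete_fibration_def Fun_def)

lemma discrete_fibration_fibration: "discrete_fibration p \<Longrightarrow> fibration p"
  using discrete_fib.fibration[OF discrete_fibI] .

lemma discrete_cartesian: "discrete_fibration p \<Longrightarrow> cartesian p f \<longleftrightarrow> f \<in> Ar (Src p)"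
  using discrete_fib.cartesian_iff[OF discrete_fibI] .

text \<open>Here \<open>p\<close> and \<open>p'\<close> are arbitrary functors, since the same
  pasting facts are applied to the squares over \<open>ty\<close>, over \<open>tm\<close> and over
  \<open>Sgm\<close>. The two whiskered transformations have equal ends because both functor squares
  commute, so only their components have to be compared.\<close>

lemma square_iff:
  assumes "p \<in> Fun E B" "p' \<in> Fun E' B'" "e1 \<in> Fun E E'" "b1 \<in> Fun B B'"
    and "p' \<odot> e1 = b1 \<odot> p" "p' \<odot> e2 = b2 \<odot> p" "\<phi> \<in> Ntr e1 e2" "\<psi> \<in> Ntr b1 b2"
  shows "p' \<lhd> \<phi> = \<psi> \<rhd> p \<longleftrightarrow> (\<forall>x \<in> Ob E. FA p' (NT \<phi> x) = NT \<psi> (FO p x))"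
proof -
  interpret f: ntr e1 e2 E E' \<phi> by (rule ntrI') fact+
  interpret g: ntr b1 b2 B B' \<psi> by (rule ntrI') fact+
  interpret p: fctr p E B by unfold_locales fact
  have 1: "p' \<lhd> \<phi> \<in> Ntr (p' \<odot> e1) (p' \<odot> e2)" by (rule whisker_left_Ntr) fact+
  have 2: "\<psi> \<rhd> p \<in> Ntr (p' \<odot> e1) (p' \<odot> e2)" unfolding assms(5,6) by (rule whisker_right_Ntr) fact+
  show ?thesis
  proof (intro iffI ballI)
    fix x assume "p' \<lhd> \<phi> = \<psi> \<rhd> p" and x: "x \<in> Ob E"
    then have "NT (p' \<lhd> \<phi>) x = NT (\<psi> \<rhd> p) x" by simp
    then show "FA p' (NT \<phi> x) = NT \<psi> (FO p x)" using x by simp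
  next
    assume "\<forall>x \<in> Ob E. FA p' (NT \<phi> x) = NT \<psi> (FO p x)"
    then show "p' \<lhd> \<phi> = \<psi> \<rhd> p"
      by (intro Ntr_eqI[OF 1 2 comp_Fun[OF assms(3,2)]]) simp
  qed
qed

lemma square_comp:
  assumes "p \<in> Fun E B" "p' \<in> Fun E' B'" "p'' \<in> Fun E'' B''" "e \<in> Fun E E'" "b \<in> Fun B B'" "e' \<in> Fun E' E''" "b' \<in> Fun B' B''"
    and "p' \<odot> e = b \<odot> p" "p'' \<odot> e' = b' \<odot> p'"
  shows "p'' \<odot> (e' \<odot> e) = (b' \<odot> b) \<odot> p"
  using comp_assoc[OF assms(4,6,3)] comp_assoc[OF assms(4,2,7)] comp_assoc[OF assms(1,5,7)] assms(8,9) by simp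

lemma square_vcomp:
  assumes "p \<in> Fun E B" "p' \<in> Fun E' B'" "e1 \<in> Fun E E'" "b1 \<in> Fun B B'"
    and "p' \<odot> e1 = b1 \<odot> p" "p' \<odot> e2 = b2 \<odot> p" "p' \<odot> e3 = b3 \<odot> p"
    and "\<phi>1 \<in> Ntr e1 e2" "\<psi>1 \<in> Ntr b1 b2" "\<phi>2 \<in> Ntr e2 e3" "\<psi>2 \<in> Ntr b2 b3"
    and "p' \<lhd> \<phi>1 = \<psi>1 \<rhd> p" "p' \<lhd> \<phi>2 = \<psi>2 \<rhd> p"
  shows "p' \<lhd> (\<phi>2 \<bullet> \<phi>1) = (\<psi>2 \<bullet> \<psi>1) \<rhd> p"
proof -
  interpret p: fctr p E B by unfold_locales fact
  interpret p': fctr p' E' B' by unfold_locales fact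
  interpret f1: ntr e1 e2 E E' \<phi>1 by (rule ntrI') fact+
  interpret g1: ntr b1 b2 B B' \<psi>1 by (rule ntrI') fact+
  interpret f2: ntr e2 e3 E E' \<phi>2 by (rule ntrI'[OF f1.G.Fun]) fact
  interpret g2: ntr b2 b3 B B' \<psi>2 by (rule ntrI'[OF g1.G.Fun]) fact
  show ?thesis
    using square_iff[OF assms(1-6,8,9)] square_iff[OF assms(1,2) f1.G.Fun g1.G.Fun assms(6,7,10,11)]
      square_iff[OF assms(1-5,7) vcomp_Ntr[OF assms(3,8,10)] vcomp_Ntr[OF assms(4,9,11)]] assms(12,13)
    by simp
qed

lemma square_hcomp:
  assumes p: "p \<in> Fun E B" "p' \<in> Fun E' B'" "p'' \<in> Fun E'' B''"
    and e: "e1 \<in> Fun E E'" "b1 \<in> Fun B B'" "e2 \<in> Fun E' E''" "b2 \<in> Fun B' B''"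
    and sq: "p' \<odot> e1 = b1 \<odot> p" "p' \<odot> e1' = b1' \<odot> p" "p'' \<odot> e2 = b2 \<odot> p'" "p'' \<odot> e2' = b2' \<odot> p'"
    and nt: "\<phi>1 \<in> Ntr e1 e1'" "\<psi>1 \<in> Ntr b1 b1'" "\<phi>2 \<in> Ntr e2 e2'" "\<psi>2 \<in> Ntr b2 b2'"
    and eq: "p' \<lhd> \<phi>1 = \<psi>1 \<rhd> p" "p'' \<lhd> \<phi>2 = \<psi>2 \<rhd> p'"
  shows "p'' \<lhd> (\<phi>2 \<star> \<phi>1) = (\<psi>2 \<star> \<psi>1) \<rhd> p"
proof -
  interpret p: fctr p E B by unfold_locales fact
  interpret p': fctr p' E' B' by unfold_locales fact
  interpret p'': fctr p'' E'' B'' by unfold_locales fact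
  interpret f1: ntr e1 e1' E E' \<phi>1 by (rule ntrI') fact+
  interpret g1: ntr b1 b1' B B' \<psi>1 by (rule ntrI') fact+
  interpret f2: ntr e2 e2' E' E'' \<phi>2 by (rule ntrI') fact+
  interpret g2: ntr b2 b2' B' B'' \<psi>2 by (rule ntrI') fact+
  have 1: "FO p' (FO e1' x) = FO b1' (FO p x)" if "x \<in> Ob E" for x
    using arg_cong[OF sq(2), of "\<lambda>F. FO F x"] that by simp
  have 2: "FA p'' (FA e2 f) = FA b2 (FA p' f)" if "f \<in> Ar E'" for f
    using arg_cong[OF sq(3), of "\<lambda>F. FA F f"] that by simp
  have "\<forall>x \<in> Ob E. FA p'' (NT (\<phi>2 \<star> \<phi>1) x) = NT (\<psi>2 \<star> \<psi>1) (FO p x)"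
    using square_iff[OF p(1,2) e(1,2) sq(1,2) nt(1,2)] square_iff[OF p(2,3) e(3,4) sq(3,4) nt(3,4)] eq
    by (simp add: NT_hcomp[OF e(1) nt(1) e(3) nt(3)] NT_hcomp[OF e(2) nt(2) e(4) nt(4)] 1 2)
  then show ?thesis
    using square_iff[OF p(1,3) comp_Fun[OF e(1,3)] comp_Fun[OF e(2,4)]
        square_comp[OF p e(1-4) sq(1,3)] square_comp[OF p f1.G.Fun g1.G.Fun f2.G.Fun g2.G.Fun sq(2,4)]
        hcomp_Ntr[OF e(1) nt(1) e(3) nt(3)] hcomp_Ntr[OF e(2) nt(2) e(4) nt(4)]] by blast
qed

section \<open>Cells of the 2-category of discrete gcwfs\<close>

abbreviation "base X \<equiv> Trg (ty X)"
abbreviation "Ty X \<equiv> Src (ty X)"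
abbreviation "Tm X \<equiv> Src (tm X)"

text \<open>Every arrow of a discrete fibration is cartesian, so the cartesianness clauses of
  \<open>is_gcwf\<close> reduce to membership in the arrow sets, which functors and transformations
  satisfy.\<close>

lemma CwF_Obj:
  "X \<in> Obj CwF \<longleftrightarrow> discrete_fibration (ty X) \<and> discrete_fibration (tm X) \<and>
     Sgm X \<in> Fun (Tm X) (Ty X) \<and> ty X \<odot> Sgm X = tm X \<and> adjunction (Sgm X) (Dlt X) (unt X) (cnt X)"
proof (cases "discrete_fibration (ty X) \<and> discrete_fibration (tm X) \<and> Sgm X \<in> Fun (Tm X) (Ty X) \<and>
   adjunction (Sgm X) (Dlt X) (unt X) (cnt X)")
  case True
  then have S: "Sgm X \<in> Fun (Tm X) (Ty X)" by blast
  then have ST: "Src (Sgm X) = Tm X" "Trg (Sgm X) = Ty X" by (auto simp: Fun_def)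
  then have D: "Dlt X \<in> Fun (Ty X) (Tm X)"
    and e: "unt X \<in> Ntr (id_func (Tm X)) (Dlt X \<odot> Sgm X)" and c: "cnt X \<in> Ntr (Sgm X \<odot> Dlt X) (id_func (Ty X))"
    using True unfolding adjunction_def ST by blast+
  interpret S: fctr "Sgm X" "Tm X" "Ty X" by unfold_locales fact
  interpret e: ntr "id_func (Tm X)" "Dlt X \<odot> Sgm X" "Tm X" "Tm X" "unt X"
    by (rule ntrI'[OF id_Fun e]) (simp add: S.C.category_axioms)
  interpret c: ntr "Sgm X \<odot> Dlt X" "id_func (Ty X)" "Ty X" "Ty X" "cnt X"
    by (rule ntrI'[OF comp_Fun[OF D S] c])
  show ?thesis
    unfolding CwF_def full_sub_def GCwF_def is_gcwf_def two_cat.simps mem_Collect_eq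
    using True discrete_cartesian[of "ty X"] discrete_cartesian[of "tm X"] e.NT_in c.NT_in S.FA_in
      discrete_fibration_fibration[of "ty X"] discrete_fibration_fibration[of "tm X"] by blast
next
  case False then show ?thesis
    unfolding CwF_def full_sub_def GCwF_def is_gcwf_def two_cat.simps mem_Collect_eq by blast
qed

lemma CwF_base: "X \<in> Obj CwF \<Longrightarrow> Trg (tm X) = base X"
  using Trg_comp[of "ty X" "Sgm X"] CwF_Obj[of X] by metis

lemma CwF_Hom1:
  assumes "X \<in> Obj CwF" "Y \<in> Obj CwF"
  shows "(C, H, H') \<in> Hom1 CwF X Y \<longleftrightarrow> C \<in> Fun (base X) (base Y) \<and> H \<in> Fun (Ty X) (Ty Y) \<and> H' \<in> Fun (Tm X) (Tm Y) \<and>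
    ty Y \<odot> H = C \<odot> ty X \<and> tm Y \<odot> H' = C \<odot> tm X \<and> Sgm Y \<odot> H' = H \<odot> Sgm X"
proof -
  have d: "discrete_fibration (ty X)" "discrete_fibration (tm X)" "discrete_fibration (ty Y)" "discrete_fibration (tm Y)"
    using assms by (auto simp: CwF_Obj)
  show ?thesis
    by (auto simp: CwF_def full_sub_def GCwF_def Fib_def discrete_cartesian[OF d(1)] discrete_cartesian[OF d(2)]
        discrete_cartesian[OF d(3)] discrete_cartesian[OF d(4)] assms[THEN CwF_base] intro: fctr.FA_in[OF fctr.intro])
qed

lemma CwF_Hom2:
  "(\<psi>, \<phi>, \<phi>') \<in> Hom2 CwF X Y (C1, H1, H1') (C2, H2, H2') \<longleftrightarrow>
    \<psi> \<in> Ntr C1 C2 \<and> \<phi> \<in> Ntr H1 H2 \<and> \<phi>' \<in> Ntr H1' H2' \<and>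
    ty Y \<lhd> \<phi> = \<psi> \<rhd> ty X \<and> tm Y \<lhd> \<phi>' = \<psi> \<rhd> tm X \<and> Sgm Y \<lhd> \<phi>' = \<phi> \<rhd> Sgm X"
  by (auto simp: CwF_def full_sub_def GCwF_def Fib_def)

lemma CwF_ops:
  "id1 CwF X = (id_func (base X), id_func (Ty X), id_func (Tm X))"
  "comp1 CwF (C2, H2, H2') (C1, H1, H1') = (C2 \<odot> C1, H2 \<odot> H1, H2' \<odot> H1')"
  "id2 CwF (C, H, H') = (id_nt C, id_nt H, id_nt H')"
  "vcomp CwF (\<psi>2, \<phi>2, \<phi>2') (\<psi>1, \<phi>1, \<phi>1') = (\<psi>2 \<bullet> \<psi>1, \<phi>2 \<bullet> \<phi>1, \<phi>2' \<bullet> \<phi>1')"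
  "hcomp CwF (\<psi>2, \<phi>2, \<phi>2') (\<psi>1, \<phi>1, \<phi>1') = (\<psi>2 \<star> \<psi>1, \<phi>2 \<star> \<phi>1, \<phi>2' \<star> \<phi>1')"
  by (simp_all add: CwF_def full_sub_def GCwF_def)

lemma CwF_Fun:
  assumes "X \<in> Obj CwF"
  shows "ty X \<in> Fun (Ty X) (base X)" "tm X \<in> Fun (Tm X) (base X)" "Sgm X \<in> Fun (Tm X) (Ty X)"
    "Dlt X \<in> Fun (Ty X) (Tm X)"
    "category (base X)" "category (Ty X)" "category (Tm X)"
proof -
  show 1: "ty X \<in> Fun (Ty X) (base X)" "tm X \<in> Fun (Tm X) (base X)" "Sgm X \<in> Fun (Tm X) (Ty X)"
    using assms CwF_base[OF assms] by (auto simp: CwF_Obj discrete_fibration_def Fun_def)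
  show "Dlt X \<in> Fun (Ty X) (Tm X)"
    using assms 1(3) by (auto simp: CwF_Obj adjunction_def Fun_def)
  show "category (base X)" "category (Ty X)" "category (Tm X)" using Fun_category[OF 1(1)] Fun_category[OF 1(2)] by auto
qed

lemma CwF_comp1:
  assumes X: "X \<in> Obj CwF" and Y: "Y \<in> Obj CwF" and Z: "Z \<in> Obj CwF" and f: "f \<in> Hom1 CwF X Y" and g: "g \<in> Hom1 CwF Y Z"
  shows "comp1 CwF g f \<in> Hom1 CwF X Z"
proof -
  obtain C H H' D I I' where fg: "f = (C, H, H')" "g = (D, I, I')" by (metis prod_cases3)
  note f = f[unfolded fg CwF_Hom1[OF X Y]] and g = g[unfolded fg CwF_Hom1[OF Y Z]]
  show ?thesis
    unfolding fg CwF_ops CwF_Hom1[OF X Z] using f g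
    by (auto intro: comp_Fun square_comp[OF CwF_Fun(1)[OF X] CwF_Fun(1)[OF Y] CwF_Fun(1)[OF Z]]
      square_comp[OF CwF_Fun(2)[OF X] CwF_Fun(2)[OF Y] CwF_Fun(2)[OF Z]]
      square_comp[OF CwF_Fun(3)[OF X] CwF_Fun(3)[OF Y] CwF_Fun(3)[OF Z]])
qed

lemma CwF_vcomp:
  assumes X: "X \<in> Obj CwF" and Y: "Y \<in> Obj CwF"
    and f: "f \<in> Hom1 CwF X Y" and g: "g \<in> Hom1 CwF X Y" and h: "h \<in> Hom1 CwF X Y"
    and a: "\<alpha> \<in> Hom2 CwF X Y f g" and b: "\<beta> \<in> Hom2 CwF X Y g h"
  shows "vcomp CwF \<beta> \<alpha> \<in> Hom2 CwF X Y f h"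
proof -
  obtain C1 H1 H1' C2 H2 H2' C3 H3 H3' where m: "f = (C1, H1, H1')" "g = (C2, H2, H2')" "h = (C3, H3, H3')"
    by (metis prod_cases3)
  obtain a1 a2 a3 b1 b2 b3 where c: "\<alpha> = (a1, a2, a3)" "\<beta> = (b1, b2, b3)" by (metis prod_cases3)
  note f = f[unfolded m CwF_Hom1[OF X Y]] and g = g[unfolded m CwF_Hom1[OF X Y]] and h = h[unfolded m CwF_Hom1[OF X Y]]
  note a = a[unfolded m c CwF_Hom2] and b = b[unfolded m c CwF_Hom2]
  show ?thesis
    unfolding m c CwF_ops CwF_Hom2 using f g h a b
    by (auto intro: vcomp_Ntr square_vcomp[OF CwF_Fun(1)[OF X] CwF_Fun(1)[OF Y]]
      square_vcomp[OF CwF_Fun(2)[OF X] CwF_Fun(2)[OF Y]] square_vcomp[OF CwF_Fun(3)[OF X] CwF_Fun(3)[OF Y]])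
qed

lemma CwF_hcomp:
  assumes X: "X \<in> Obj CwF" and Y: "Y \<in> Obj CwF" and Z: "Z \<in> Obj CwF"
    and f: "f \<in> Hom1 CwF X Y" and f': "f' \<in> Hom1 CwF X Y" and g: "g \<in> Hom1 CwF Y Z" and g': "g' \<in> Hom1 CwF Y Z"
    and a: "\<alpha> \<in> Hom2 CwF X Y f f'" and b: "\<beta> \<in> Hom2 CwF Y Z g g'"
  shows "hcomp CwF \<beta> \<alpha> \<in> Hom2 CwF X Z (comp1 CwF g f) (comp1 CwF g' f')"
proof -
  obtain C1 H1 H1' C2 H2 H2' where m: "f = (C1, H1, H1')" "f' = (C2, H2, H2')" by (metis prod_cases3)
  obtain D1 I1 I1' D2 I2 I2' where n: "g = (D1, I1, I1')" "g' = (D2, I2, I2')" by (metis prod_cases3)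
  obtain a1 a2 a3 b1 b2 b3 where c: "\<alpha> = (a1, a2, a3)" "\<beta> = (b1, b2, b3)" by (metis prod_cases3)
  note f = f[unfolded m CwF_Hom1[OF X Y]] f'[unfolded m CwF_Hom1[OF X Y]]
    and g = g[unfolded n CwF_Hom1[OF Y Z]] g'[unfolded n CwF_Hom1[OF Y Z]]
  note a = a[unfolded m c CwF_Hom2] and b = b[unfolded n c CwF_Hom2]
  show ?thesis
    unfolding m n c CwF_ops CwF_Hom2 using f g a b
    by (auto intro: hcomp_Ntr square_hcomp[OF CwF_Fun(1)[OF X] CwF_Fun(1)[OF Y] CwF_Fun(1)[OF Z]]
      square_hcomp[OF CwF_Fun(2)[OF X] CwF_Fun(2)[OF Y] CwF_Fun(2)[OF Z]]
      square_hcomp[OF CwF_Fun(3)[OF X] CwF_Fun(3)[OF Y] CwF_Fun(3)[OF Z]])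
qed

lemma square_id:
  assumes "p \<in> Fun E B" "p' \<in> Fun E' B'" "e \<in> Fun E E'" "b \<in> Fun B B'" "p' \<odot> e = b \<odot> p"
  shows "p' \<lhd> id_nt e = id_nt b \<rhd> p"
proof -
  interpret p: fctr p E B by unfold_locales fact
  interpret p': fctr p' E' B' by unfold_locales fact
  interpret e: fctr e E E' by unfold_locales fact
  interpret b: fctr b B B' by unfold_locales fact
  have 1: "FO p' (FO e x) = FO b (FO p x)" if "x \<in> Ob E" for x
    using arg_cong[OF assms(5), of "\<lambda>F. FO F x"] that by simp
  show ?thesis
    using square_iff[OF assms(1-5,5) id_Ntr[OF assms(3)] id_Ntr[OF assms(4)]] by (simp add: 1)
qed

text \<open>An equation between cells of \<open>K\<close> holds once all its projections to
  \<open>C\<close> hold, because the projections are jointly injective and preserve the operations.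
  Only closure of the cells under the operations has to be checked in \<open>K\<close>
  itself.\<close>

lemma two_category_jointly_faithful:
  fixes K :: "('x, 'f, 'c) two_cat" and C :: "('y, 'g, 'd) two_cat" and po :: "'i \<Rightarrow> 'x \<Rightarrow> 'y"
  assumes "two_category C"
    and id1: "\<And>X. X \<in> Obj K \<Longrightarrow> id1 K X \<in> Hom1 K X X"
    and comp1: "\<And>X Y Z f g. \<lbrakk>X \<in> Obj K; Y \<in> Obj K; Z \<in> Obj K; f \<in> Hom1 K X Y; g \<in> Hom1 K Y Z\<rbrakk> \<Longrightarrow>
      comp1 K g f \<in> Hom1 K X Z"
    and id2: "\<And>X Y f. \<lbrakk>X \<in> Obj K; Y \<in> Obj K; f \<in> Hom1 K X Y\<rbrakk> \<Longrightarrow> id2 K f \<in> Hom2 K X Y f f"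
    and vcomp: "\<And>X Y f g h \<alpha> \<beta>. \<lbrakk>X \<in> Obj K; Y \<in> Obj K; f \<in> Hom1 K X Y; g \<in> Hom1 K X Y; h \<in> Hom1 K X Y;
      \<alpha> \<in> Hom2 K X Y f g; \<beta> \<in> Hom2 K X Y g h\<rbrakk> \<Longrightarrow> vcomp K \<beta> \<alpha> \<in> Hom2 K X Y f h"
    and hcomp: "\<And>X Y Z f f' g g' \<alpha> \<beta>. \<lbrakk>X \<in> Obj K; Y \<in> Obj K; Z \<in> Obj K;
      f \<in> Hom1 K X Y; f' \<in> Hom1 K X Y; g \<in> Hom1 K Y Z; g' \<in> Hom1 K Y Z;
      \<alpha> \<in> Hom2 K X Y f f'; \<beta> \<in> Hom2 K Y Z g g'\<rbrakk> \<Longrightarrow>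
      hcomp K \<beta> \<alpha> \<in> Hom2 K X Z (comp1 K g f) (comp1 K g' f')"
    and po: "\<And>i X. X \<in> Obj K \<Longrightarrow> po i X \<in> Obj C"
    and pf: "\<And>i X Y f. \<lbrakk>X \<in> Obj K; Y \<in> Obj K; f \<in> Hom1 K X Y\<rbrakk> \<Longrightarrow> pf i f \<in> Hom1 C (po i X) (po i Y)"
    and pc: "\<And>i X Y f g \<alpha>. \<lbrakk>X \<in> Obj K; Y \<in> Obj K; f \<in> Hom1 K X Y; g \<in> Hom1 K X Y; \<alpha> \<in> Hom2 K X Y f g\<rbrakk> \<Longrightarrow>
      pc i \<alpha> \<in> Hom2 C (po i X) (po i Y) (pf i f) (pf i g)"
    and ext1: "\<And>f g. (\<And>i. pf i f = pf i g) \<Longrightarrow> f = g"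
    and ext2: "\<And>\<alpha> \<beta>. (\<And>i. pc i \<alpha> = pc i \<beta>) \<Longrightarrow> \<alpha> = \<beta>"
    and ops: "\<And>i X. pf i (id1 K X) = id1 C (po i X)" "\<And>i f g. pf i (comp1 K g f) = comp1 C (pf i g) (pf i f)"
      "\<And>i f. pc i (id2 K f) = id2 C (pf i f)" "\<And>i \<alpha> \<beta>. pc i (vcomp K \<beta> \<alpha>) = vcomp C (pc i \<beta>) (pc i \<alpha>)"
      "\<And>i \<alpha> \<beta>. pc i (hcomp K \<beta> \<alpha>) = hcomp C (pc i \<beta>) (pc i \<alpha>)"
  shows "two_category K"
proof -
  interpret C: two_category C by fact
  show ?thesis
  proof (rule two_category.intro, goal_cases)
    case (1 X) then show ?case by (rule id1)
  next
    case (2 X Y Z f g) then show ?case by (rule comp1)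
  next
    case (3 X Y f) show ?case
      by (rule ext1, unfold ops) (rule C.comp1_id1_left[OF po po pf]; rule 3)
  next
    case (4 X Y f) show ?case
      by (rule ext1, unfold ops) (rule C.comp1_id1_right[OF po po pf]; rule 4)
  next
    case (5 W X Y Z f g h) show ?case
      by (rule ext1, unfold ops) (rule C.comp1_assoc[OF po po po po pf pf pf]; rule 5)
  next
    case (6 X Y f) then show ?case by (rule id2)
  next
    case (7 X Y f g h \<alpha> \<beta>) then show ?case by (rule vcomp)
  next
    case (8 X Y f g \<alpha>) show ?case
      by (rule ext2, unfold ops) (rule C.vcomp_id2_left[OF po po pf pf pc]; rule 8)
  next
    case (9 X Y f g \<alpha>) show ?case
      by (rule ext2, unfold ops) (rule C.vcomp_id2_right[OF po po pf pf pc]; rule 9)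
  next
    case (10 X Y f g h k \<alpha> \<beta> \<gamma>) show ?case
      by (rule ext2, unfold ops) (rule C.vcomp_assoc[OF po po pf pf pf pf pc pc pc]; rule 10)
  next
    case (11 X Y Z f f' g g' \<alpha> \<beta>) then show ?case by (rule hcomp)
  next
    case (12 X Y Z f g) show ?case
      by (rule ext2, unfold ops) (rule C.hcomp_id2[OF po po po pf pf]; rule 12)
  next
    case (13 X Y Z f f' f'' g g' g'' \<alpha> \<alpha>' \<beta> \<beta>') show ?case
      by (rule ext2, unfold ops)
        (rule C.interchange[OF po po po pf pf pf pf pf pf pc pc pc pc]; rule 13)
  next
    case (14 X Y f g \<alpha>) show ?case
      by (rule ext2, unfold ops) (rule C.hcomp_id1_left[OF po po pf pf pc]; rule 14)
  next
    case (15 X Y f g \<alpha>) show ?case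
      by (rule ext2, unfold ops) (rule C.hcomp_id1_right[OF po po pf pf pc]; rule 15)
  next
    case (16 W X Y Z f f' g g' h h' \<alpha> \<beta> \<gamma>) show ?case
      by (rule ext2, unfold ops)
        (rule C.hcomp_assoc[OF po po po po pf pf pf pf pf pf pc pc pc]; rule 16)
  qed
qed

text \<open>The projections are indexed by a whole type, so every index from 2 on selects the third
  component.\<close>

definition proj3 :: "nat \<Rightarrow> 'a \<times> 'a \<times> 'a \<Rightarrow> 'a" where
  "proj3 i = (\<lambda>(x, y, z). if i = 0 then x else if i = 1 then y else z)"

lemma proj3_ext:
  assumes "\<And>i. proj3 i s = proj3 i t"
  shows "s = t"
  using assms[of 0] assms[of 1] assms[of 2] by (auto simp: proj3_def split: prod.splits)

lemma two_category_CwF: "two_category (CwF :: ('v gcwf_data, _, _) two_cat)"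
proof (rule two_category_jointly_faithful[where po = "\<lambda>i X. proj3 i (base X, Ty X, Tm X)" and pf = proj3 and pc = proj3,
      OF two_category_Cat])
  fix X Y :: "'v gcwf_data" and f i
  assume X: "X \<in> Obj CwF"
  show "id1 CwF X \<in> Hom1 CwF X X"
    unfolding CwF_ops CwF_Hom1[OF X X] using X
    by (simp add: CwF_Fun id_Fun CwF_Fun(1-3)[THEN comp_id_left] CwF_Fun(1-3)[THEN comp_id_right])
  show "proj3 i (base X, Ty X, Tm X) \<in> Obj Cat" using X by (simp add: Cat_def proj3_def CwF_Fun)
  assume Y: "Y \<in> Obj CwF" and f: "f \<in> Hom1 CwF X Y"
  show "id2 CwF f \<in> Hom2 CwF X Y f f"
    using f by (cases f)
      (auto simp: CwF_ops CwF_Hom1[OF X Y] CwF_Hom2 intro: id_Ntr square_id[OF CwF_Fun(1)[OF X] CwF_Fun(1)[OF Y]]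
          square_id[OF CwF_Fun(2)[OF X] CwF_Fun(2)[OF Y]] square_id[OF CwF_Fun(3)[OF X] CwF_Fun(3)[OF Y]])
  show "proj3 i f \<in> Hom1 Cat (proj3 i (base X, Ty X, Tm X)) (proj3 i (base Y, Ty Y, Tm Y))"
    using f by (cases f) (simp add: CwF_Hom1[OF X Y] proj3_def Cat_def)
  show "proj3 i \<alpha> \<in> Hom2 Cat (proj3 i (base X, Ty X, Tm X)) (proj3 i (base Y, Ty Y, Tm Y)) (proj3 i f) (proj3 i g)"
    if "\<alpha> \<in> Hom2 CwF X Y f g" for g \<alpha>
    using that by (cases f; cases g; cases \<alpha>) (simp add: CwF_Hom2 proj3_def Cat_def)
next
  show "s = t" if "\<And>i. proj3 i s = proj3 i t" for s t :: "'v sfunc \<times> 'v sfunc \<times> 'v sfunc" using that by (rule proj3_ext)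
  show "s = t" if "\<And>i. proj3 i s = proj3 i t" for s t :: "'v snt \<times> 'v snt \<times> 'v snt" using that by (rule proj3_ext)
qed (auto intro: CwF_comp1 CwF_vcomp CwF_hcomp simp: CwF_ops Cat_def proj3_def split: prod.splits)

section \<open>Surjective equivalences of 2-categories\<close>

lemma two_functorI:
  assumes "two_category K" "two_category L" and "two_functor_axioms K L F"
  shows "two_functor K L F"
  using assms by (simp add: two_functor_def)

lemma two_functor_id: "two_category K \<Longrightarrow> two_functor K K id_2func"
  by (intro two_functorI two_functor_axioms.intro) (auto simp: id_2func_def)

lemma two_functor_comp:
  assumes F: "two_functor K L F" and G: "two_functor L M G"
  shows "two_functor K M (comp_2func G F)"
proof -
  interpret F: two_functor K L F by fact
  interpret G: two_functor L M G by fact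
  show ?thesis
    by (intro two_functorI two_functor_axioms.intro F.K.two_category_axioms G.L.two_category_axioms)
      (simp_all add: comp_2func_def F.on0 F.on1 F.on2 G.on0 G.on1 G.on2 F.on1_id1 G.on1_id1 F.on1_comp1[where Y = Y for Y]
        G.on1_comp1 F.on2_id2 G.on2_id2 F.on2_vcomp[of _ _ _ g for g] G.on2_vcomp F.on2_hcomp G.on2_hcomp)
qed

text \<open>
  Only \<open>L\<close> is assumed to be a 2-category: since \<open>G\<close> preserves the operations and is surjective on all cells,
  the axioms for \<open>K\<close> follow.
\<close>

locale strict_surjective_equivalence = L: two_category L for L :: "('y, 'g, 'd) two_cat" +
  fixes K :: "('x, 'f, 'c) two_cat" and G :: "('y, 'g, 'd, 'x, 'f, 'c) two_func"
    and f0 :: "'x \<Rightarrow> 'y" and lft1 :: "'y \<Rightarrow> 'y \<Rightarrow> 'f \<Rightarrow> 'g" and lft2 :: "'y \<Rightarrow> 'y \<Rightarrow> 'g \<Rightarrow> 'g \<Rightarrow> 'c \<Rightarrow> 'd"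
  assumes G0: "Y \<in> Obj L \<Longrightarrow> on0 G Y \<in> Obj K"
    and G1: "\<lbrakk>X \<in> Obj L; Y \<in> Obj L; f \<in> Hom1 L X Y\<rbrakk> \<Longrightarrow> on1 G X Y f \<in> Hom1 K (on0 G X) (on0 G Y)"
    and G2: "\<lbrakk>X \<in> Obj L; Y \<in> Obj L; f \<in> Hom1 L X Y; g \<in> Hom1 L X Y; \<alpha> \<in> Hom2 L X Y f g\<rbrakk> \<Longrightarrow>
      on2 G X Y f g \<alpha> \<in> Hom2 K (on0 G X) (on0 G Y) (on1 G X Y f) (on1 G X Y g)"
    and G_id1: "X \<in> Obj L \<Longrightarrow> on1 G X X (id1 L X) = id1 K (on0 G X)"
    and G_comp1: "\<lbrakk>X \<in> Obj L; Y \<in> Obj L; Z \<in> Obj L; f \<in> Hom1 L X Y; g \<in> Hom1 L Y Z\<rbrakk> \<Longrightarrow>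
      on1 G X Z (comp1 L g f) = comp1 K (on1 G Y Z g) (on1 G X Y f)"
    and G_id2: "\<lbrakk>X \<in> Obj L; Y \<in> Obj L; f \<in> Hom1 L X Y\<rbrakk> \<Longrightarrow> on2 G X Y f f (id2 L f) = id2 K (on1 G X Y f)"
    and G_vcomp: "\<lbrakk>X \<in> Obj L; Y \<in> Obj L; f \<in> Hom1 L X Y; g \<in> Hom1 L X Y; h \<in> Hom1 L X Y;
      \<alpha> \<in> Hom2 L X Y f g; \<beta> \<in> Hom2 L X Y g h\<rbrakk> \<Longrightarrow>
      on2 G X Y f h (vcomp L \<beta> \<alpha>) = vcomp K (on2 G X Y g h \<beta>) (on2 G X Y f g \<alpha>)"
    and G_hcomp: "\<lbrakk>X \<in> Obj L; Y \<in> Obj L; Z \<in> Obj L;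
      f \<in> Hom1 L X Y; f' \<in> Hom1 L X Y; g \<in> Hom1 L Y Z; g' \<in> Hom1 L Y Z;
      \<alpha> \<in> Hom2 L X Y f f'; \<beta> \<in> Hom2 L Y Z g g'\<rbrakk> \<Longrightarrow>
      on2 G X Z (comp1 L g f) (comp1 L g' f') (hcomp L \<beta> \<alpha>) =
        hcomp K (on2 G Y Z g g' \<beta>) (on2 G X Y f f' \<alpha>)"
    and inj1: "\<lbrakk>X \<in> Obj L; Y \<in> Obj L; f \<in> Hom1 L X Y; g \<in> Hom1 L X Y; on1 G X Y f = on1 G X Y g\<rbrakk> \<Longrightarrow> f = g"
    and inj2: "\<lbrakk>X \<in> Obj L; Y \<in> Obj L; f \<in> Hom1 L X Y; g \<in> Hom1 L X Y; \<alpha> \<in> Hom2 L X Y f g; \<beta> \<in> Hom2 L X Y f g;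
      on2 G X Y f g \<alpha> = on2 G X Y f g \<beta>\<rbrakk> \<Longrightarrow> \<alpha> = \<beta>"
    and f0: "A \<in> Obj K \<Longrightarrow> f0 A \<in> Obj L" and G_f0: "A \<in> Obj K \<Longrightarrow> on0 G (f0 A) = A"
    and lft1: "\<lbrakk>X \<in> Obj L; Y \<in> Obj L; m \<in> Hom1 K (on0 G X) (on0 G Y)\<rbrakk> \<Longrightarrow> lft1 X Y m \<in> Hom1 L X Y"
    and G_lft1: "\<lbrakk>X \<in> Obj L; Y \<in> Obj L; m \<in> Hom1 K (on0 G X) (on0 G Y)\<rbrakk> \<Longrightarrow> on1 G X Y (lft1 X Y m) = m"
    and lft2: "\<lbrakk>X \<in> Obj L; Y \<in> Obj L; f \<in> Hom1 L X Y; g \<in> Hom1 L X Y;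
      \<xi> \<in> Hom2 K (on0 G X) (on0 G Y) (on1 G X Y f) (on1 G X Y g)\<rbrakk> \<Longrightarrow> lft2 X Y f g \<xi> \<in> Hom2 L X Y f g"
    and G_lft2: "\<lbrakk>X \<in> Obj L; Y \<in> Obj L; f \<in> Hom1 L X Y; g \<in> Hom1 L X Y;
      \<xi> \<in> Hom2 K (on0 G X) (on0 G Y) (on1 G X Y f) (on1 G X Y g)\<rbrakk> \<Longrightarrow> on2 G X Y f g (lft2 X Y f g \<xi>) = \<xi>"
begin

definition f1 where "f1 X Y f = lft1 (f0 X) (f0 Y) f"
definition f2 where "f2 X Y f g \<alpha> = lft2 (f0 X) (f0 Y) (f1 X Y f) (f1 X Y g) \<alpha>"
definition inverse_2func where "inverse_2func = \<lparr>on0 = f0, on1 = f1, on2 = f2\<rparr>"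
text \<open>Well typed since \<open>f0 (on0 G Y)\<close> and \<open>Y\<close> have the same image
  under \<open>G\<close>; the counit is the 1-cell between them that lies over an identity.\<close>

definition counit where "counit Y = lft1 (f0 (on0 G Y)) Y (id1 K (on0 G Y))"

lemma f1: "\<lbrakk>X \<in> Obj K; Y \<in> Obj K; f \<in> Hom1 K X Y\<rbrakk> \<Longrightarrow> f1 X Y f \<in> Hom1 L (f0 X) (f0 Y)"
  and G_f1: "\<lbrakk>X \<in> Obj K; Y \<in> Obj K; f \<in> Hom1 K X Y\<rbrakk> \<Longrightarrow> on1 G (f0 X) (f0 Y) (f1 X Y f) = f"
  by (simp_all add: f1_def lft1 G_lft1 f0 G_f0)

lemma f2: "\<lbrakk>X \<in> Obj K; Y \<in> Obj K; f \<in> Hom1 K X Y; g \<in> Hom1 K X Y; \<alpha> \<in> Hom2 K X Y f g\<rbrakk> \<Longrightarrow>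
    f2 X Y f g \<alpha> \<in> Hom2 L (f0 X) (f0 Y) (f1 X Y f) (f1 X Y g)"
  and G_f2: "\<lbrakk>X \<in> Obj K; Y \<in> Obj K; f \<in> Hom1 K X Y; g \<in> Hom1 K X Y; \<alpha> \<in> Hom2 K X Y f g\<rbrakk> \<Longrightarrow>
    on2 G (f0 X) (f0 Y) (f1 X Y f) (f1 X Y g) (f2 X Y f g \<alpha>) = \<alpha>"
  by (simp_all add: f2_def lft2 G_lft2 f0 G_f0 f1 G_f1)

text \<open>The operations of \<open>K\<close> are not known to be closed at this point. Each cell
  of \<open>K\<close> is the image of its lift, so the result of an operation is the image of a cell
  of \<open>L\<close>.\<close>

lemma K_id1: "X \<in> Obj K \<Longrightarrow> id1 K X \<in> Hom1 K X X"
  using G1[OF f0 f0 L.id1[OF f0], of X] by (simp add: f0 G_id1 G_f0)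

text \<open>Both sides of the second claim have the same image under \<open>G\<close>, and
  \<open>G\<close> is injective on parallel 1-cells.\<close>

lemma
  assumes "X \<in> Obj K" "Y \<in> Obj K" "Z \<in> Obj K" "f \<in> Hom1 K X Y" "g \<in> Hom1 K Y Z"
  shows K_comp1: "comp1 K g f \<in> Hom1 K X Z" and f1_comp1: "f1 X Z (comp1 K g f) = comp1 L (f1 Y Z g) (f1 X Y f)"
proof -
  note a = f0[OF assms(1)] f0[OF assms(2)] f0[OF assms(3)] f1[OF assms(1,2,4)] f1[OF assms(2,3,5)]
  note i = L.comp1[OF a] and e = G_comp1[OF a, unfolded G_f1[OF assms(1,2,4)] G_f1[OF assms(2,3,5)]]
  show 1: "comp1 K g f \<in> Hom1 K X Z" using G1[OF a(1,3) i] assms by (simp add: e G_f0)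
  show "f1 X Z (comp1 K g f) = comp1 L (f1 Y Z g) (f1 X Y f)"
    by (rule inj1[OF a(1,3) f1[OF assms(1,3) 1] i]) (simp add: e G_f1 1 assms)
qed

lemma f1_id1:
  assumes "X \<in> Obj K"
  shows "f1 X X (id1 K X) = id1 L (f0 X)"
  using assms by (intro inj1[OF f0 f0 f1[OF _ _ K_id1] L.id1[OF f0]]) (simp_all add: G_f1 f0 G_id1 G_f0 K_id1)

lemma f1_inj: "\<lbrakk>X \<in> Obj K; Y \<in> Obj K; f \<in> Hom1 K X Y; g \<in> Hom1 K X Y; f1 X Y f = f1 X Y g\<rbrakk> \<Longrightarrow> f = g"
  using G_f1 by metis

lemma f2_inj: "\<lbrakk>X \<in> Obj K; Y \<in> Obj K; f \<in> Hom1 K X Y; g \<in> Hom1 K X Y; \<alpha> \<in> Hom2 K X Y f g; \<beta> \<in> Hom2 K X Y f g;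
    f2 X Y f g \<alpha> = f2 X Y f g \<beta>\<rbrakk> \<Longrightarrow> \<alpha> = \<beta>"
  using G_f2 by metis

lemma K_id2:
  assumes "X \<in> Obj K" "Y \<in> Obj K" "f \<in> Hom1 K X Y"
  shows "id2 K f \<in> Hom2 K X Y f f" and "f2 X Y f f (id2 K f) = id2 L (f1 X Y f)"
proof -
  have i: "id2 L (f1 X Y f) \<in> Hom2 L (f0 X) (f0 Y) (f1 X Y f) (f1 X Y f)" using assms by (intro L.id2 f0 f1)
  have e: "on2 G (f0 X) (f0 Y) (f1 X Y f) (f1 X Y f) (id2 L (f1 X Y f)) = id2 K f"
    using assms by (simp add: G_id2 f0 f1 G_f1)
  show 1: "id2 K f \<in> Hom2 K X Y f f" using G2[OF f0 f0 f1 f1 i] assms e by (simp add: G_f0 G_f1)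
  show "f2 X Y f f (id2 K f) = id2 L (f1 X Y f)"
    using assms by (intro inj2[OF f0[OF assms(1)] f0[OF assms(2)] f1[OF assms] f1[OF assms] f2[OF assms(1-3,3) 1] i])
      (simp add: e G_f2 1)
qed

lemma K_vcomp:
  assumes "X \<in> Obj K" "Y \<in> Obj K" "f \<in> Hom1 K X Y" "g \<in> Hom1 K X Y" "h \<in> Hom1 K X Y"
    "\<alpha> \<in> Hom2 K X Y f g" "\<beta> \<in> Hom2 K X Y g h"
  shows "vcomp K \<beta> \<alpha> \<in> Hom2 K X Y f h"
    and "f2 X Y f h (vcomp K \<beta> \<alpha>) = vcomp L (f2 X Y g h \<beta>) (f2 X Y f g \<alpha>)"
proof -
  note a = f0[OF assms(1)] f0[OF assms(2)] f1[OF assms(1-3)] f1[OF assms(1,2,4)] f1[OF assms(1,2,5)]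
    f2[OF assms(1-4,6)] f2[OF assms(1,2,4,5,7)]
  note i = L.vcomp[OF a] and e = G_vcomp[OF a, unfolded G_f2[OF assms(1-4,6)] G_f2[OF assms(1,2,4,5,7)]]
  show 1: "vcomp K \<beta> \<alpha> \<in> Hom2 K X Y f h" using G2[OF a(1-3,5) i] assms e by (simp add: G_f0 G_f1)
  show "f2 X Y f h (vcomp K \<beta> \<alpha>) = vcomp L (f2 X Y g h \<beta>) (f2 X Y f g \<alpha>)"
    by (rule inj2[OF a(1-3,5) f2[OF assms(1-3,5) 1] i]) (simp add: e G_f2 1 assms)
qed

lemma K_hcomp:
  assumes "X \<in> Obj K" "Y \<in> Obj K" "Z \<in> Obj K"
    "f \<in> Hom1 K X Y" "f' \<in> Hom1 K X Y" "g \<in> Hom1 K Y Z" "g' \<in> Hom1 K Y Z"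
    "\<alpha> \<in> Hom2 K X Y f f'" "\<beta> \<in> Hom2 K Y Z g g'"
  shows "hcomp K \<beta> \<alpha> \<in> Hom2 K X Z (comp1 K g f) (comp1 K g' f')"
    and "f2 X Z (comp1 K g f) (comp1 K g' f') (hcomp K \<beta> \<alpha>) = hcomp L (f2 Y Z g g' \<beta>) (f2 X Y f f' \<alpha>)"
proof -
  note a = f0[OF assms(1)] f0[OF assms(2)] f0[OF assms(3)] f1[OF assms(1,2,4)] f1[OF assms(1,2,5)]
    f1[OF assms(2,3,6)] f1[OF assms(2,3,7)] f2[OF assms(1,2,4,5,8)] f2[OF assms(2,3,6,7,9)]
  note c = K_comp1[OF assms(1-3,4,6)] K_comp1[OF assms(1-3,5,7)]
  note fc = f1_comp1[OF assms(1-3,4,6)] f1_comp1[OF assms(1-3,5,7)]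
  note i = L.hcomp[OF a, folded fc] and e = G_hcomp[OF a, folded fc, unfolded G_f2[OF assms(1,2,4,5,8)] G_f2[OF assms(2,3,6,7,9)]]
  show 1: "hcomp K \<beta> \<alpha> \<in> Hom2 K X Z (comp1 K g f) (comp1 K g' f')"
    using G2[OF a(1,3) f1[OF assms(1,3) c(1)] f1[OF assms(1,3) c(2)] i] assms e by (simp add: G_f0 G_f1 c)
  show "f2 X Z (comp1 K g f) (comp1 K g' f') (hcomp K \<beta> \<alpha>) = hcomp L (f2 Y Z g g' \<beta>) (f2 X Y f f' \<alpha>)"
    by (rule inj2[OF a(1,3) f1[OF assms(1,3) c(1)] f1[OF assms(1,3) c(2)] f2[OF assms(1,3) c 1] i]) (simp add: e G_f2 1 c assms)
qed

text \<open>The lifts \<open>f1\<close> and \<open>f2\<close> are injective and turn every operation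
  of \<open>K\<close> into that of \<open>L\<close>, so each equational axiom holds because its lift
  does.\<close>

lemma K_two_category: "two_category K"
proof (rule two_category.intro, goal_cases)
  case (1 X) then show ?case by (rule K_id1)
next
  case (2 X Y Z f g) then show ?case by (rule K_comp1)
next
  case (3 X Y f)
  note c = 3(1,2,2,3) K_id1[OF 3(2)]
  show ?case by (rule f1_inj[OF 3(1,2) K_comp1[OF c] 3(3)])
    (simp add: f1_comp1[OF c] f1_id1 3 L.comp1_id1_left[OF f0[OF 3(1)] f0[OF 3(2)] f1[OF 3]])
next
  case (4 X Y f)
  note c = 4(1,1,2) K_id1[OF 4(1)] 4(3)
  show ?case by (rule f1_inj[OF 4(1,2) K_comp1[OF c] 4(3)])
    (simp add: f1_comp1[OF c] f1_id1 4 L.comp1_id1_right[OF f0[OF 4(1)] f0[OF 4(2)] f1[OF 4]])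
next
  case (5 W X Y Z f g h)
  note gf = K_comp1[OF 5(1-3,5,6)] and hg = K_comp1[OF 5(2-4,6,7)]
  note l = K_comp1[OF 5(1,3,4) gf 5(7)] and r = K_comp1[OF 5(1,2,4) 5(5) hg]
  show ?case
    by (rule f1_inj[OF 5(1,4) l r])
      (simp add: f1_comp1[OF 5(1,3,4) gf 5(7)] f1_comp1[OF 5(1,2,4) 5(5) hg] f1_comp1[OF 5(1-3,5,6)] f1_comp1[OF 5(2-4,6,7)]
        L.comp1_assoc[OF f0[OF 5(1)] f0[OF 5(2)] f0[OF 5(3)] f0[OF 5(4)] f1[OF 5(1,2,5)] f1[OF 5(2,3,6)] f1[OF 5(3,4,7)]])
next
  case (6 X Y f) then show ?case by (rule K_id2(1))
next
  case (7 X Y f g h \<alpha> \<beta>) then show ?case by (rule K_vcomp(1))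
next
  case (8 X Y f g \<alpha>)
  note i = K_id2[OF 8(1,2,4)] note v = K_vcomp[OF 8(1-4,4) 8(5) i(1)]
  show ?case by (rule f2_inj[OF 8(1-4) v(1) 8(5)])
    (simp add: v i L.vcomp_id2_left[OF f0[OF 8(1)] f0[OF 8(2)] f1[OF 8(1-3)] f1[OF 8(1,2,4)] f2[OF 8]])
next
  case (9 X Y f g \<alpha>)
  note i = K_id2[OF 9(1,2,3)] note v = K_vcomp[OF 9(1-3,3,4) i(1) 9(5)]
  show ?case by (rule f2_inj[OF 9(1-4) v(1) 9(5)])
    (simp add: v i L.vcomp_id2_right[OF f0[OF 9(1)] f0[OF 9(2)] f1[OF 9(1-3)] f1[OF 9(1,2,4)] f2[OF 9]])
next
  case (10 X Y f g h k \<alpha> \<beta> \<gamma>)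
  note ba = K_vcomp[OF 10(1-5,7,8)] and cb = K_vcomp[OF 10(1,2,4-6,8,9)]
  note l = K_vcomp[OF 10(1-3,5,6) ba(1) 10(9)] and r = K_vcomp[OF 10(1-4,6,7) cb(1)]
  show ?case by (rule f2_inj[OF 10(1-3,6) l(1) r(1)])
    (simp add: l r ba cb L.vcomp_assoc[OF f0[OF 10(1)] f0[OF 10(2)] f1[OF 10(1-3)] f1[OF 10(1,2,4)] f1[OF 10(1,2,5)] f1[OF 10(1,2,6)]
      f2[OF 10(1-4,7)] f2[OF 10(1,2,4,5,8)] f2[OF 10(1,2,5,6,9)]])
next
  case (11 X Y Z f f' g g' \<alpha> \<beta>) then show ?case by (rule K_hcomp(1))
next
  case (12 X Y Z f g)
  note i = K_id2[OF 12(1,2,4)] K_id2[OF 12(2,3,5)]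
  note h = K_hcomp[OF 12(1-3,4,4,5,5) i(1,3)] and c = K_comp1[OF 12]
  note j = K_id2[OF 12(1,3) c]
  show ?case by (rule f2_inj[OF 12(1,3) c c h(1) j(1)])
    (simp add: h i j f1_comp1[OF 12] L.hcomp_id2[OF f0[OF 12(1)] f0[OF 12(2)] f0[OF 12(3)] f1[OF 12(1,2,4)] f1[OF 12(2,3,5)]])
next
  case (13 X Y Z f f' f'' g g' g'' \<alpha> \<alpha>' \<beta> \<beta>')
  note a = K_vcomp[OF 13(1,2,4-6,10,11)] and b = K_vcomp[OF 13(2,3,7-9,12,13)]
  note l = K_hcomp[OF 13(1-3,4,6,7,9) a(1) b(1)]
  note h = K_hcomp[OF 13(1-3,4,5,7,8,10,12)] and h' = K_hcomp[OF 13(1-3,5,6,8,9,11,13)]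
  note c = K_comp1[OF 13(1-3,4,7)] K_comp1[OF 13(1-3,5,8)] K_comp1[OF 13(1-3,6,9)]
  note r = K_vcomp[OF 13(1,3) c h(1) h'(1)]
  show ?case by (rule f2_inj[OF 13(1,3) c(1,3) l(1) r(1)])
    (simp add: l a b r h h' L.interchange[OF f0[OF 13(1)] f0[OF 13(2)] f0[OF 13(3)] f1[OF 13(1,2,4)] f1[OF 13(1,2,5)] f1[OF 13(1,2,6)]
     f1[OF 13(2,3,7)] f1[OF 13(2,3,8)] f1[OF 13(2,3,9)] f2[OF 13(1,2,4,5,10)] f2[OF 13(1,2,5,6,11)] f2[OF 13(2,3,7,8,12)] f2[OF 13(2,3,8,9,13)]])
next
  case (14 X Y f g \<alpha>)
  \<comment> \<open>\<open>hcomp\<close> yields a 2-cell between composites with an identity 1-cell;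
    its boundary has to be rewritten by the unit law before \<open>f2_inj\<close> can compare it
    with \<open>\<alpha>\<close>.\<close>
  have c: "comp1 K (id1 K Y) h = h" if "h \<in> Hom1 K X Y" for h
    using that by (intro f1_inj[OF 14(1,2)] K_comp1[OF 14(1,2,2)] K_id1[OF 14(2)])
      (simp_all add: f1_comp1[OF 14(1,2,2)] f1_id1 K_id1 14 L.comp1_id1_left[OF f0[OF 14(1)] f0[OF 14(2)] f1[OF 14(1,2)]])
  note d = K_id1[OF 14(2)] note i = K_id2[OF 14(2,2) d]
  note h = K_hcomp[OF 14(1,2,2) 14(3,4) d d 14(5) i(1), unfolded c[OF 14(3)] c[OF 14(4)]]
  show ?case by (rule f2_inj[OF 14(1-4) h(1) 14(5)])
    (simp add: h i f1_id1 14 L.hcomp_id1_left[OF f0[OF 14(1)] f0[OF 14(2)] f1[OF 14(1-3)] f1[OF 14(1,2,4)] f2[OF 14]])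
next
  case (15 X Y f g \<alpha>)
  have c: "comp1 K h (id1 K X) = h" if "h \<in> Hom1 K X Y" for h
    using that by (intro f1_inj[OF 15(1,2)] K_comp1[OF 15(1,1,2)] K_id1[OF 15(1)])
      (simp_all add: f1_comp1[OF 15(1,1,2)] f1_id1 K_id1 15 L.comp1_id1_right[OF f0[OF 15(1)] f0[OF 15(2)] f1[OF 15(1,2)]])
  note d = K_id1[OF 15(1)] note i = K_id2[OF 15(1,1) d]
  note h = K_hcomp[OF 15(1,1,2) d d 15(3,4) i(1) 15(5), unfolded c[OF 15(3)] c[OF 15(4)]]
  show ?case by (rule f2_inj[OF 15(1-4) h(1) 15(5)])
    (simp add: h i f1_id1 15 L.hcomp_id1_right[OF f0[OF 15(1)] f0[OF 15(2)] f1[OF 15(1-3)] f1[OF 15(1,2,4)] f2[OF 15]])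
next
  case (16 W X Y Z f f' g g' h h' \<alpha> \<beta> \<gamma>)
  note ba = K_hcomp[OF 16(1-3,5-8,11,12)] and cb = K_hcomp[OF 16(2-4,7-10,12,13)]
  note gf = K_comp1[OF 16(1-3,5,7)] K_comp1[OF 16(1-3,6,8)] and hg = K_comp1[OF 16(2-4,7,9)] K_comp1[OF 16(2-4,8,10)]
  \<comment> \<open>Associativity of 1-cells is derived again inside this case because the
    boundaries of the two horizontal composites differ by it.\<close>
  have as: "comp1 K h (comp1 K g f) = comp1 K (comp1 K h g) f" if "f \<in> Hom1 K W X" "g \<in> Hom1 K X Y" "h \<in> Hom1 K Y Z" for f g h
  proof -
    note gf = K_comp1[OF 16(1-3) that(1,2)] and hg = K_comp1[OF 16(2-4) that(2,3)]
    note l = K_comp1[OF 16(1,3,4) gf that(3)] and r = K_comp1[OF 16(1,2,4) that(1) hg]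
    show ?thesis
      by (rule f1_inj[OF 16(1,4) l r])
        (simp add: f1_comp1[OF 16(1,3,4) gf that(3)] f1_comp1[OF 16(1,2,4) that(1) hg] f1_comp1[OF 16(1-3) that(1,2)]
          f1_comp1[OF 16(2-4) that(2,3)]
          L.comp1_assoc[OF f0[OF 16(1)] f0[OF 16(2)] f0[OF 16(3)] f0[OF 16(4)] f1[OF 16(1,2) that(1)] f1[OF 16(2,3) that(2)] f1[OF 16(3,4) that(3)]])
  qed
  note l = K_hcomp[OF 16(1,3,4) gf 16(9,10) ba(1) 16(13)]
  note r = K_hcomp[OF 16(1,2,4) 16(5,6) hg 16(11) cb(1), folded as[OF 16(5,7,9)] as[OF 16(6,8,10)]]
  show ?case by (rule f2_inj[OF 16(1,4) K_comp1[OF 16(1,3,4) gf(1) 16(9)] K_comp1[OF 16(1,3,4) gf(2) 16(10)] l(1) r(1)])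
    (simp add: l r ba cb L.hcomp_assoc[OF f0[OF 16(1)] f0[OF 16(2)] f0[OF 16(3)] f0[OF 16(4)] f1[OF 16(1,2,5)] f1[OF 16(1,2,6)]
      f1[OF 16(2,3,7)] f1[OF 16(2,3,8)] f1[OF 16(3,4,9)] f1[OF 16(3,4,10)] f2[OF 16(1,2,5,6,11)] f2[OF 16(2,3,7,8,12)] f2[OF 16(3,4,9,10,13)]])
qed

sublocale K: two_category K by (rule K_two_category)

sublocale G: two_functor L K G
  by unfold_locales (fact G0 G1 G2 G_id1 G_comp1 G_id2 G_vcomp G_hcomp)+

sublocale F: two_functor K L inverse_2func
  by unfold_locales (auto simp: inverse_2func_def f0 f1 f2 f1_id1 f1_comp1 K_id2 K_vcomp K_hcomp)

lemma counit:
  assumes "Y \<in> Obj L"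
  shows "counit Y \<in> Hom1 L (f0 (on0 G Y)) Y" and "on1 G (f0 (on0 G Y)) Y (counit Y) = id1 K (on0 G Y)"
  using assms by (simp_all add: counit_def lft1 G_lft1 f0 G0 G_f0 K_id1)

text \<open>The inverse is the lift of the same identity in the opposite direction: both composites
  lie over an identity, so injectivity makes them identities.\<close>

lemma counit_iso:
  assumes Y: "Y \<in> Obj L"
  shows "iso1 L (f0 (on0 G Y)) Y (counit Y)"
proof -
  let ?X = "f0 (on0 G Y)" let ?i = "lft1 Y ?X (id1 K (on0 G Y))"
  have X: "?X \<in> Obj L" using Y by (simp add: f0 G0)
  have i: "?i \<in> Hom1 L Y ?X" and Gi: "on1 G Y ?X ?i = id1 K (on0 G Y)"
    using X Y by (simp_all add: lft1 G_lft1 G_f0 G0 K_id1)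
  note id = K.comp1_id1_left[OF G0[OF Y] G0[OF Y] K_id1[OF G0[OF Y]]]
  have "comp1 L ?i (counit Y) = id1 L ?X"
    by (rule inj1[OF X X L.comp1[OF X Y X counit(1)[OF Y] i] L.id1[OF X]])
      (simp add: G_comp1[OF X Y X counit(1)[OF Y] i] counit(2)[OF Y] Gi id G_id1[OF X] G_f0 G0[OF Y])
  moreover have "comp1 L (counit Y) ?i = id1 L Y"
    by (rule inj1[OF Y Y L.comp1[OF Y X Y i counit(1)[OF Y]] L.id1[OF Y]])
      (simp add: G_comp1[OF Y X Y i counit(1)[OF Y]] counit(2)[OF Y] Gi id G_id1[OF Y])
  ultimately show ?thesis unfolding iso1_def using counit(1)[OF Y] i by blast
qed

text \<open>\<open>G\<close> after the inverse is the identity on the cells of \<open>K\<close>, so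
  the conditions on the unit are unit laws of \<open>K\<close>. Those on the counit are compared
  after applying \<open>G\<close>, which sends the counit to identities.\<close>

lemma adjoint_2equivalence: "adjoint_2equivalence K L inverse_2func G (id1 K) counit"
proof -
  interpret GF: two_functor K K "comp_2func G inverse_2func" by (rule two_functor_comp) unfold_locales
  interpret FG: two_functor L L "comp_2func inverse_2func G" by (rule two_functor_comp) unfold_locales
  interpret IK: two_functor K K id_2func by (rule two_functor_id) unfold_locales
  interpret IL: two_functor L L id_2func by (rule two_functor_id) unfold_locales
  have [simp]: "on0 inverse_2func = f0" "on1 inverse_2func = f1" "on2 inverse_2func = f2"
    by (simp_all add: inverse_2func_def)
  show ?thesis
  proof (unfold_locales, goal_cases)
    case (1 X) then show ?case
      by (auto simp: iso1_def id_2func_def comp_2func_def G_f0 K_id1 K.comp1_id1_left[OF _ _ K_id1]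
        intro!: bexI[of _ "id1 K X"])
  next
    case (2 X Y f) then show ?case
      by (simp add: id_2func_def comp_2func_def G_f0 G_f1 K.comp1_id1_left K.comp1_id1_right)
  next
    case (3 X Y f g \<alpha>) then show ?case
      by (simp add: id_2func_def comp_2func_def G_f0 G_f1 G_f2 K.hcomp_id1_left K.hcomp_id1_right)
  next
    case (4 Y) then show ?case by (simp add: id_2func_def comp_2func_def counit_iso)
  next
    case (5 X Y f)
    let ?X = "f0 (on0 G X)" and ?Y = "f0 (on0 G Y)" and ?f = "f1 (on0 G X) (on0 G Y) (on1 G X Y f)"
    have o: "?X \<in> Obj L" "?Y \<in> Obj L" and f: "?f \<in> Hom1 L ?X ?Y" using 5 by (simp_all add: f0 G0 f1 G1)
    note e = counit[OF 5(1)] counit[OF 5(2)]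
    note l = L.comp1[OF o(1) 5(1,2) e(1) 5(3)] and r = L.comp1[OF o 5(2) f e(3)]
    have "comp1 L f (counit X) = comp1 L (counit Y) ?f"
      by (rule inj1[OF o(1) 5(2) l r])
        (simp add: G_comp1[OF o(1) 5(1,2) e(1) 5(3)] G_comp1[OF o 5(2) f e(3)] e
          K.comp1_id1_left[OF G0[OF 5(1)] G0[OF 5(2)] G1[OF 5]] K.comp1_id1_right[OF G0[OF 5(1)] G0[OF 5(2)] G1[OF 5]] G_f1 G0 G1 5)
    then show ?case by (simp add: id_2func_def comp_2func_def)
  next
    case (6 X Y f g \<alpha>)
    let ?X = "f0 (on0 G X)" and ?Y = "f0 (on0 G Y)" and ?F = "f1 (on0 G X) (on0 G Y)"
    let ?f = "?F (on1 G X Y f)" and ?g = "?F (on1 G X Y g)"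
    let ?a = "f2 (on0 G X) (on0 G Y) (on1 G X Y f) (on1 G X Y g) (on2 G X Y f g \<alpha>)"
    note G6 = G0[OF 6(1)] G0[OF 6(2)] G1[OF 6(1-3)] G1[OF 6(1,2,4)] G2[OF 6]
    have o: "?X \<in> Obj L" "?Y \<in> Obj L" and f: "?f \<in> Hom1 L ?X ?Y" and g: "?g \<in> Hom1 L ?X ?Y"
      and a: "?a \<in> Hom2 L ?X ?Y ?f ?g"
      using f0[OF G6(1)] f0[OF G6(2)] f1[OF G6(1-3)] f1[OF G6(1,2,4)] f2[OF G6] by auto
    note e = counit[OF 6(1)] counit[OF 6(2)]
    note i = L.id2[OF o(1) 6(1) e(1)] L.id2[OF o(2) 6(2) e(3)]
    note l = L.hcomp[OF o(1) 6(1,2) e(1) e(1) 6(3,4) i(1) 6(5)] and r = L.hcomp[OF o 6(2) f g e(3) e(3) a i(2)]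
    \<comment> \<open>The two 2-cells below have boundaries that agree only by naturality on
      1-cells, so that equation comes first.\<close>
    have eq: "comp1 L h (counit X) = comp1 L (counit Y) (?F (on1 G X Y h))" if "h \<in> Hom1 L X Y" for h
    proof -
      note f = f1[OF G6(1,2) G1[OF 6(1,2) that]]
      note l = L.comp1[OF o(1) 6(1,2) e(1) that] and r = L.comp1[OF o 6(2) f e(3)]
      show ?thesis
        by (rule inj1[OF o(1) 6(2) l r])
          (simp add: G_comp1[OF o(1) 6(1,2) e(1) that] G_comp1[OF o 6(2) f e(3)] e
            K.comp1_id1_left[OF G6(1,2) G1[OF 6(1,2) that]] K.comp1_id1_right[OF G6(1,2) G1[OF 6(1,2) that]] G_f1 G0 G1 6 that)
    qed
    have "hcomp L \<alpha> (id2 L (counit X)) = hcomp L (id2 L (counit Y)) ?a"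
    proof (rule inj2[OF o(1) 6(2) L.comp1[OF o(1) 6(1,2) e(1) 6(3)] L.comp1[OF o(1) 6(1,2) e(1) 6(4)] l])
      show "hcomp L (id2 L (counit Y)) ?a \<in> Hom2 L ?X Y (comp1 L f (counit X)) (comp1 L g (counit X))"
        using r by (simp add: eq 6)
      have "on2 G ?X Y (comp1 L f (counit X)) (comp1 L g (counit X)) (hcomp L \<alpha> (id2 L (counit X))) = on2 G X Y f g \<alpha>"
        using G_hcomp[OF o(1) 6(1,2) e(1) e(1) 6(3,4) i(1) 6(5)]
        by (simp add: G_id2[OF o(1) 6(1) e(1)] e K.hcomp_id1_right[OF G6])
      moreover have "on2 G ?X Y (comp1 L f (counit X)) (comp1 L g (counit X)) (hcomp L (id2 L (counit Y)) ?a) = on2 G X Y f g \<alpha>"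
        unfolding eq[OF 6(3)] eq[OF 6(4)]
        using G_hcomp[OF o 6(2) f g e(3) e(3) a i(2)]
        by (simp add: G_id2[OF o(2) 6(2) e(3)] e G_f2[OF G6] K.hcomp_id1_left[OF G6])
      ultimately show "on2 G ?X Y (comp1 L f (counit X)) (comp1 L g (counit X)) (hcomp L \<alpha> (id2 L (counit X))) =
        on2 G ?X Y (comp1 L f (counit X)) (comp1 L g (counit X)) (hcomp L (id2 L (counit Y)) ?a)" by simp
    qed
    then show ?case by (simp add: id_2func_def comp_2func_def)
  next
    case (7 X)
    then have X: "f0 X \<in> Obj L" by (rule f0)
    \<comment> \<open>The counit at a chosen preimage joins \<open>f0 X\<close> to itself over an
      identity and is therefore an identity.\<close>
    have "counit (f0 X) = id1 L (f0 X)"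
      by (rule inj1[OF X X]) (use counit[OF X] 7 X in \<open>simp_all add: G_f0 L.id1 G_id1\<close>)
    then show ?case using 7 X by (simp add: G_f0 f1_id1 L.comp1_id1_left[OF _ _ L.id1])
  next
    case (8 Y) then show ?case
      by (simp add: counit G_f0 G0 K.comp1_id1_left[OF _ _ K_id1])
  qed
qed

text \<open>Since \<open>P\<close> holds of an image exactly when \<open>Q\<close> holds of the
  1-cell, images and lifts stay within the two sub-2-categories, and the 2-cells are those of
  \<open>L\<close> and \<open>K\<close>. The same choices \<open>f0\<close>, \<open>lft1\<close>,
  \<open>lft2\<close> therefore remain valid.\<close>

lemma wide_2full_sub:
  assumes PQ: "\<And>X Y m. \<lbrakk>X \<in> Obj L; Y \<in> Obj L; m \<in> Hom1 L X Y\<rbrakk> \<Longrightarrow> P (on0 G X) (on0 G Y) (on1 G X Y m) \<longleftrightarrow> Q X Y m"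
    and Q_id: "\<And>X. X \<in> Obj L \<Longrightarrow> Q X X (id1 L X)"
    and Q_comp: "\<And>X Y Z f g. \<lbrakk>X \<in> Obj L; Y \<in> Obj L; Z \<in> Obj L; f \<in> Hom1 L X Y; g \<in> Hom1 L Y Z; Q X Y f; Q Y Z g\<rbrakk> \<Longrightarrow>
      Q X Z (comp1 L g f)"
  shows "strict_surjective_equivalence (wide_2full_sub L Q) (wide_2full_sub K P) G f0 lft1 lft2"
proof -
  interpret W: two_category "wide_2full_sub L Q"
    by (unfold_locales; simp add: wide_2full_sub_def)
      (auto intro: L.id1 L.comp1 L.comp1_id1_left L.comp1_id1_right L.comp1_assoc L.id2 L.vcomp L.vcomp_id2_left L.vcomp_id2_right
        L.vcomp_assoc L.hcomp L.hcomp_id2 L.interchange L.hcomp_id1_left L.hcomp_id1_right L.hcomp_assoc Q_id Q_comp)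
  show ?thesis
    by (unfold_locales; simp add: wide_2full_sub_def)
      (auto intro: G0 G1 G2 G_id1 G_comp1 G_id2 G_vcomp G_hcomp inj1 inj2 f0 G_f0 lft1 G_lft1 lft2 G_lft2
        simp: PQ PQ[symmetric] G_lft1 lft1)
qed

end

section \<open>The comprehension category of a discrete gcwf\<close>

lemma mem_squares: "(f, g, h, k) \<in> squares C \<longleftrightarrow> f \<in> Ar C \<and> g \<in> Ar C \<and> h \<in> Ar C \<and> Dom C h = Dom C f \<and> Cod C h = Dom C g \<and>
    k \<in> Ar C \<and> Dom C k = Cod C f \<and> Cod C k = Cod C g \<and> Cmp C g h = Cmp C k f"
  by (auto simp: squares_def hom_def)

lemma arr_cat_simps [simp]:
  "Ob (arr_cat C) = Ar C" "Ar (arr_cat C) = squares C"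
  "(f, g, h, k) \<in> squares C \<Longrightarrow> Dom (arr_cat C) (f, g, h, k) = f"
  "(f, g, h, k) \<in> squares C \<Longrightarrow> Cod (arr_cat C) (f, g, h, k) = g"
  "f \<in> Ar C \<Longrightarrow> Idn (arr_cat C) f = (f, f, Idn C (Dom C f), Idn C (Cod C f))"
  "\<lbrakk>(f, g, h, k) \<in> squares C; (g, g', h', k') \<in> squares C\<rbrakk> \<Longrightarrow>
    Cmp (arr_cat C) (g, g', h', k') (f, g, h, k) = (f, g', Cmp C h' h, Cmp C k' k)"
  by (auto simp: arr_cat_def)

lemma (in category) square_Cmp:
  assumes "(f, g, h, k) \<in> squares C" "(g, g', h', k') \<in> squares C"
  shows "(f, g', Cmp C h' h, Cmp C k' k) \<in> squares C"
proof -
  have "Cmp C g' (Cmp C h' h) = Cmp C (Cmp C k' g) h"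
    using assms by (simp add: mem_squares assoc[symmetric])
  also have "\<dots> = Cmp C (Cmp C k' k) f"
    using assms by (simp add: mem_squares assoc)
  finally show ?thesis using assms by (simp add: mem_squares)
qed

lemma (in category) category_arr_cat: "category (arr_cat C)"
proof (rule categoryI)
  show "Dom (arr_cat C) \<in> extensional (Ar (arr_cat C))" "Cod (arr_cat C) \<in> extensional (Ar (arr_cat C))"
    "Idn (arr_cat C) \<in> extensional (Ob (arr_cat C))"
    by (auto simp: arr_cat_def)
  show "Cmp (arr_cat C) g f = undefined" if "\<not> (f \<in> Ar (arr_cat C) \<and> g \<in> Ar (arr_cat C) \<and> Cod (arr_cat C) f = Dom (arr_cat C) g)" for f g
    using that by (cases f; cases g) (auto simp: arr_cat_def)
  show "Cmp (arr_cat C) g f \<in> Ar (arr_cat C) \<and> Dom (arr_cat C) (Cmp (arr_cat C) g f) = Dom (arr_cat C) f \<and>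
      Cod (arr_cat C) (Cmp (arr_cat C) g f) = Cod (arr_cat C) g"
    if "f \<in> Ar (arr_cat C)" "g \<in> Ar (arr_cat C)" "Cod (arr_cat C) f = Dom (arr_cat C) g" for f g
    using that by (cases f; cases g) (auto simp: square_Cmp)
  show "Cmp (arr_cat C) h (Cmp (arr_cat C) g f) = Cmp (arr_cat C) (Cmp (arr_cat C) h g) f"
    if "f \<in> Ar (arr_cat C)" "g \<in> Ar (arr_cat C)" "h \<in> Ar (arr_cat C)"
      "Cod (arr_cat C) f = Dom (arr_cat C) g" "Cod (arr_cat C) g = Dom (arr_cat C) h" for f g h
    using that
    by (cases f; cases g; cases h) (clarsimp simp: square_Cmp, simp add: mem_squares assoc)
qed (auto simp: mem_squares)

lemma (in category) cod_Fun: "cod_func C \<in> Fun (arr_cat C) C"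
proof (rule FunI)
  show "FA (cod_func C) (Cmp (arr_cat C) g f) = Cmp C (FA (cod_func C) g) (FA (cod_func C) f)"
    if "f \<in> Ar (arr_cat C)" "g \<in> Ar (arr_cat C)" "Cod (arr_cat C) f = Dom (arr_cat C) g" for f g
    using that by (cases f; cases g) (clarsimp simp: square_Cmp cod_func_def)
  show "FA (cod_func C) f \<in> Ar C \<and> Dom C (FA (cod_func C) f) = FO (cod_func C) (Dom (arr_cat C) f) \<and>
      Cod C (FA (cod_func C) f) = FO (cod_func C) (Cod (arr_cat C) f)" if "f \<in> Ar (arr_cat C)" for f
    using that by (cases f) (clarsimp simp: cod_func_def, simp add: mem_squares)
qed (simp_all add: category_arr_cat category_axioms, simp_all add: cod_func_def mem_squares)

lemma FO_cod [simp]: "f \<in> Ar C \<Longrightarrow> FO (cod_func C) f = Cod C f"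
  and FA_cod [simp]: "(f, g, h, k) \<in> squares C \<Longrightarrow> FA (cod_func C) (f, g, h, k) = k"
  and Src_cod [simp]: "Src (cod_func C) = arr_cat C" and Trg_cod [simp]: "Trg (cod_func C) = C"
  by (auto simp: cod_func_def)

lemma FO_arr_func [simp]: "f \<in> Ar (Src F) \<Longrightarrow> FO (arr_func F) f = FA F f"
  and FA_arr_func [simp]: "(f, g, h, k) \<in> squares (Src F) \<Longrightarrow> FA (arr_func F) (f, g, h, k) = (FA F f, FA F g, FA F h, FA F k)"
  and Src_arr_func [simp]: "Src (arr_func F) = arr_cat (Src F)" and Trg_arr_func [simp]: "Trg (arr_func F) = arr_cat (Trg F)"
  by (auto simp: arr_func_def)

lemma (in fctr) FA_square: "(f, g, h, k) \<in> squares C \<Longrightarrow> (FA F f, FA F g, FA F h, FA F k) \<in> squares D"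
  unfolding mem_squares using FA_Cmp[of h g] FA_Cmp[of f k] by auto

lemma (in fctr) arr_func: "arr_func F \<in> Fun (arr_cat C) (arr_cat D)"
proof (rule FunI)
  show "FA (arr_func F) (Cmp (arr_cat C) g f) = Cmp (arr_cat D) (FA (arr_func F) g) (FA (arr_func F) f)"
    if "f \<in> Ar (arr_cat C)" "g \<in> Ar (arr_cat C)" "Cod (arr_cat C) f = Dom (arr_cat C) g" for f g
    using that by (cases f; cases g) (clarsimp simp: C.square_Cmp FA_square, simp add: mem_squares)
  show "FA (arr_func F) f \<in> Ar (arr_cat D) \<and> Dom (arr_cat D) (FA (arr_func F) f) = FO (arr_func F) (Dom (arr_cat C) f) \<and>
      Cod (arr_cat D) (FA (arr_func F) f) = FO (arr_func F) (Cod (arr_cat C) f)" if "f \<in> Ar (arr_cat C)" for f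
    using that by (cases f) (clarsimp simp: FA_square, simp add: mem_squares)
qed (simp_all add: C.category_arr_cat D.category_arr_cat, simp_all add: arr_func_def mem_squares)

text \<open>
  The parameters \<open>U\<close>, \<open>V\<close>, \<open>B\<close> only name the three categories: were they written out, the rules
  \<open>fctr.Src\<close> and \<open>fctr.Trg\<close> would become looping rewrite rules.
\<close>

locale cwf =
  fixes X :: "'v gcwf_data" and U V B
  assumes obj: "X \<in> Obj CwF" and Ty: "Ty X = U" and Tm: "Tm X = V" and base: "base X = B"
begin

sublocale u: discrete_fib "ty X" U B
  using CwF_Fun(1)[OF obj] obj unfolding Ty Tm base CwF_Obj by unfold_locales blast+
sublocale v: discrete_fib "tm X" V B
  using CwF_Fun(2)[OF obj] obj unfolding Ty Tm base CwF_Obj by unfold_locales blast+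
sublocale S: fctr "Sgm X" V U
  using CwF_Fun(3)[OF obj] unfolding Ty Tm base by unfold_locales
sublocale D: fctr "Dlt X" U V
  using CwF_Fun(4)[OF obj] unfolding Ty Tm base by unfold_locales

lemma adj: "adjunction (Sgm X) (Dlt X) (unt X) (cnt X)"
  using obj[unfolded CwF_Obj] by blast

sublocale e: ntr "id_func V" "Dlt X \<odot> Sgm X" V V "unt X"
  using adj by unfold_locales (auto simp: id_Fun v.C.category_axioms comp_Fun[OF S.Fun D.Fun] adjunction_def)
sublocale c: ntr "Sgm X \<odot> Dlt X" "id_func U" U U "cnt X"
  using adj by unfold_locales (auto simp: id_Fun u.C.category_axioms comp_Fun[OF D.Fun S.Fun] adjunction_def)

lemma FO_ty_Sgm [simp]: "a \<in> Ob V \<Longrightarrow> FO (ty X) (FO (Sgm X) a) = FO (tm X) a"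
  and FA_ty_Sgm [simp]: "f \<in> Ar V \<Longrightarrow> FA (ty X) (FA (Sgm X) f) = FA (tm X) f"
proof -
  have e: "ty X \<odot> Sgm X = tm X" using obj[unfolded CwF_Obj] by blast
  show "FO (ty X) (FO (Sgm X) a) = FO (tm X) a" if "a \<in> Ob V"
    using arg_cong[OF e, of "\<lambda>F. FO F a"] that by simp
  show "FA (ty X) (FA (Sgm X) f) = FA (tm X) f" if "f \<in> Ar V"
    using arg_cong[OF e, of "\<lambda>F. FA F f"] that by simp
qed

lemma triangle_Sgm:
  assumes "a \<in> Ob V"
  shows "Cmp U (NT (cnt X) (FO (Sgm X) a)) (FA (Sgm X) (NT (unt X) a)) = Idn U (FO (Sgm X) a)"
proof -
  have "(cnt X \<rhd> Sgm X) \<bullet> (Sgm X \<lhd> unt X) = id_nt (Sgm X)" using adj by (simp add: adjunction_def)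
  from arg_cong[OF this, of "\<lambda>t. NT t a"] show ?thesis using assms by simp
qed

lemma triangle_Dlt:
  assumes "A \<in> Ob U"
  shows "Cmp V (FA (Dlt X) (NT (cnt X) A)) (NT (unt X) (FO (Dlt X) A)) = Idn V (FO (Dlt X) A)"
proof -
  have "(Dlt X \<lhd> cnt X) \<bullet> (unt X \<rhd> Dlt X) = id_nt (Dlt X)" using adj by (simp add: adjunction_def)
  from arg_cong[OF this, of "\<lambda>t. NT t A"] show ?thesis using assms by simp
qed

lemma unt_nat: "f \<in> Ar V \<Longrightarrow>
    Cmp V (FA (Dlt X) (FA (Sgm X) f)) (NT (unt X) (Dom V f)) = Cmp V (NT (unt X) (Cod V f)) f"
  using e.nat[of f] by simp

lemma cnt_nat: "f \<in> Ar U \<Longrightarrow>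
    Cmp U f (NT (cnt X) (Dom U f)) = Cmp U (NT (cnt X) (Cod U f)) (FA (Sgm X) (FA (Dlt X) f))"
  using c.nat[of f] by simp

text \<open>Composing with the counit undoes the transpose of \<open>g\<close>: naturality of the
  counit moves \<open>g\<close> outside, and a triangle identity removes the rest.\<close>

lemma transpose_down:
  assumes "a \<in> Ob V" "g \<in> Ar U" "Dom U g = FO (Sgm X) a"
  shows "Cmp U (NT (cnt X) (Cod U g)) (FA (Sgm X) (Cmp V (FA (Dlt X) g) (NT (unt X) a))) = g"
proof -
  have "?thesis \<longleftrightarrow> Cmp U (Cmp U (NT (cnt X) (Cod U g)) (FA (Sgm X) (FA (Dlt X) g))) (FA (Sgm X) (NT (unt X) a)) = g"
    using assms by (simp add: u.C.assoc)
  also have "\<dots>" unfolding cnt_nat[OF assms(2), symmetric]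
    using assms by (simp add: u.C.assoc triangle_Sgm)
  finally show ?thesis by simp
qed

lemma transpose_up:
  assumes "A \<in> Ob U" "f \<in> Ar V" "Cod V f = FO (Dlt X) A"
  shows "Cmp V (FA (Dlt X) (Cmp U (NT (cnt X) A) (FA (Sgm X) f))) (NT (unt X) (Dom V f)) = f"
proof -
  have "?thesis \<longleftrightarrow> Cmp V (FA (Dlt X) (NT (cnt X) A)) (Cmp V (FA (Dlt X) (FA (Sgm X) f)) (NT (unt X) (Dom V f))) = f"
    using assms by (simp add: v.C.assoc)
  also have "\<dots>" unfolding unt_nat[OF assms(2)]
    using assms by (simp add: v.C.assoc[symmetric] triangle_Dlt)
  finally show ?thesis by simp
qed

text \<open>The uniqueness half of the adjunction: transposing back recovers each arrow from its
  adjunct. It moves equations between mates from terms to types.\<close>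

lemma transpose_inj:
  assumes "A \<in> Ob U" "f \<in> Ar V" "Cod V f = FO (Dlt X) A" "g \<in> Ar V" "Cod V g = FO (Dlt X) A"
    and "Dom V f = Dom V g"
    and "Cmp U (NT (cnt X) A) (FA (Sgm X) f) = Cmp U (NT (cnt X) A) (FA (Sgm X) g)"
  shows "f = g"
  using transpose_up[OF assms(1-3)] unfolding assms(6,7) transpose_up[OF assms(1,4,5)] by (rule sym)

end

text \<open>In the usual language of families, \<open>ext\<close> is the context extended by a type,
  \<open>disp\<close> its display map, and \<open>sect\<close> the section of the display map that a
  term determines.\<close>

abbreviation "ext X A \<equiv> FO (tm X) (FO (Dlt X) A)"
abbreviation "disp X A \<equiv> FA (ty X) (NT (cnt X) A)"
abbreviation "sect X a \<equiv> FA (tm X) (NT (unt X) a)"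

text \<open>On arrows this is the image under \<open>ty X\<close> of the naturality square of the
  counit; the top side is written through \<open>tm X\<close> because \<open>ty X\<close> after
  \<open>Sgm X\<close> is \<open>tm X\<close>.\<close>

definition compr :: "'v gcwf_data \<Rightarrow> 'v to_arr_func" where
  "compr X = \<lparr>Src = Ty X, Trg = arr_cat (base X), FO = (\<lambda>A \<in> Ob (Ty X). disp X A),
     FA = (\<lambda>f \<in> Ar (Ty X). (disp X (Dom (Ty X) f), disp X (Cod (Ty X) f), FA (tm X) (FA (Dlt X) f), FA (ty X) f))\<rparr>"

lemma FO_compr [simp]: "A \<in> Ob (Ty X) \<Longrightarrow> FO (compr X) A = disp X A"
  and FA_compr [simp]: "f \<in> Ar (Ty X) \<Longrightarrow>
    FA (compr X) f = (disp X (Dom (Ty X) f), disp X (Cod (Ty X) f), FA (tm X) (FA (Dlt X) f), FA (ty X) f)"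
  and Src_compr [simp]: "Src (compr X) = Ty X" and Trg_compr [simp]: "Trg (compr X) = arr_cat (base X)"
  by (auto simp: compr_def)

context cwf begin

lemma sect_section: "a \<in> Ob V \<Longrightarrow> Cmp B (disp X (FO (Sgm X) a)) (sect X a) = Idn B (FO (tm X) a)"
  using arg_cong[OF triangle_Sgm, of a "FA (ty X)"] by simp

lemma sect_Dlt: "A \<in> Ob U \<Longrightarrow>
    Cmp B (FA (tm X) (FA (Dlt X) (NT (cnt X) A))) (sect X (FO (Dlt X) A)) = Idn B (ext X A)"
  using arg_cong[OF triangle_Dlt, of A "FA (tm X)"] by simp

lemma compr_square: "f \<in> Ar U \<Longrightarrow>
    (disp X (Dom U f), disp X (Cod U f), FA (tm X) (FA (Dlt X) f), FA (ty X) f) \<in> squares B"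
  using arg_cong[OF cnt_nat, of f "FA (ty X)"] by (simp add: mem_squares)

lemma compr_Fun: "compr X \<in> Fun U (arr_cat B)"
proof (rule FunI)
  show "FA (compr X) (Cmp U g f) = Cmp (arr_cat B) (FA (compr X) g) (FA (compr X) f)"
    if "f \<in> Ar U" "g \<in> Ar U" "Cod U f = Dom U g" for f g
    using that compr_square[of f] compr_square[of g] by simp
qed (auto simp: u.C.category_axioms u.D.category_arr_cat compr_square, auto simp: compr_def)

text \<open>A cone over the square lifts to an arrow of terms into \<open>Dlt\<close> of the
  codomain and an arrow of types into the domain of \<open>f\<close>. Since the cone commutes,
  \<open>f\<close> after the type arrow is the adjunct of the term arrow, and the transpose of the
  type arrow projects to the mediating arrow. Any other mediating arrow lifts as well and has the
  same adjunct.\<close>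

lemma compr_pullback:
  assumes f: "f \<in> Ar U"
  shows "pullback_square B (FA (compr X) f)"
proof -
  let ?A = "Dom U f" and ?A' = "Cod U f"
  let ?Df = "FA (Dlt X) f"
  have A: "?A \<in> Ob U" "?A' \<in> Ob U" using f by auto
  have "\<exists>!w. w \<in> hom B z (ext X ?A) \<and> Cmp B (FA (tm X) ?Df) w = a \<and> Cmp B (disp X ?A) w = b"
    if a: "a \<in> hom B z (ext X ?A')" and b: "b \<in> hom B z (FO (ty X) ?A)"
      and eq: "Cmp B (disp X ?A') a = Cmp B (FA (ty X) f) b" for z a b
  proof -
    have a: "a \<in> Ar B" "Dom B a = z" "Cod B a = ext X ?A'" using a by (auto simp: hom_def)
    have b: "b \<in> Ar B" "Dom B b = z" "Cod B b = FO (ty X) ?A" using b by (auto simp: hom_def)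
    define a' where "a' = v.lift (FO (Dlt X) ?A') a"
    define b' where "b' = u.lift ?A b"
    have a': "a' \<in> Ar V" "Cod V a' = FO (Dlt X) ?A'" "FA (tm X) a' = a"
      using a A unfolding a'_def by simp_all
    have b': "b' \<in> Ar U" "Cod U b' = ?A" "FA (ty X) b' = b"
      using b A unfolding b'_def by simp_all
    \<comment> \<open>Both sides end at the codomain of \<open>f\<close> and have equal images by
      the cone equation. Comparing their domains then shows that \<open>b'\<close> starts at a value
      of \<open>Sgm X\<close>, so it has a transpose.\<close>
    have sq: "Cmp U f b' = Cmp U (NT (cnt X) ?A') (FA (Sgm X) a')"
      by (rule u.arr_eqI) (use A f a' b' eq in simp_all)
    then have d: "Dom U b' = FO (Sgm X) (Dom V a')"
      using u.C.Dom_Cmp[OF b'(1) f b'(2)] u.C.Dom_Cmp[of "FA (Sgm X) a'" "NT (cnt X) ?A'"] a' A by simp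
    define w' where "w' = Cmp V (FA (Dlt X) b') (NT (unt X) (Dom V a'))"
    have w': "w' \<in> Ar V" "Cod V w' = FO (Dlt X) ?A" "Dom V w' = Dom V a'"
      using a' b' d unfolding w'_def by simp_all
    have cw: "Cmp U (NT (cnt X) ?A) (FA (Sgm X) w') = b'"
      using transpose_down[of "Dom V a'" b'] a' b' d unfolding w'_def by simp
    have Dw: "Cmp V ?Df w' = a'"
    proof (rule transpose_inj[OF A(2)])
      have "Cmp U (NT (cnt X) ?A') (FA (Sgm X) (Cmp V ?Df w')) =
          Cmp U (Cmp U (NT (cnt X) ?A') (FA (Sgm X) ?Df)) (FA (Sgm X) w')"
        using f w' A by (simp add: u.C.assoc)
      also have "\<dots> = Cmp U f b'"
        unfolding cnt_nat[OF f, symmetric] using f w' A by (simp add: u.C.assoc cw)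
      finally show "Cmp U (NT (cnt X) ?A') (FA (Sgm X) (Cmp V ?Df w')) = Cmp U (NT (cnt X) ?A') (FA (Sgm X) a')"
        by (simp add: sq)
    qed (use f w' a' A in simp_all)
    show ?thesis
    proof (rule ex1I[of _ "FA (tm X) w'"])
      have "FO (tm X) (Dom V a') = z" using a a' v.Dom_FA[of a'] by simp
      moreover have "Cmp B (FA (tm X) ?Df) (FA (tm X) w') = a"
        using arg_cong[OF Dw, of "FA (tm X)"] f w' a' by simp
      moreover have "Cmp B (disp X ?A) (FA (tm X) w') = b"
        using arg_cong[OF cw, of "FA (ty X)"] A w' b' by simp
      ultimately show "FA (tm X) w' \<in> hom B z (ext X ?A) \<and> Cmp B (FA (tm X) ?Df) (FA (tm X) w') = a \<and>
          Cmp B (disp X ?A) (FA (tm X) w') = b"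
        using w' by (simp add: hom_def)
    next
      fix w assume "w \<in> hom B z (ext X ?A) \<and> Cmp B (FA (tm X) ?Df) w = a \<and> Cmp B (disp X ?A) w = b"
      then have w: "w \<in> Ar B" "Dom B w = z" "Cod B w = ext X ?A"
        and wa: "Cmp B (FA (tm X) ?Df) w = a" and wb: "Cmp B (disp X ?A) w = b" by (auto simp: hom_def)
      define w2 where "w2 = v.lift (FO (Dlt X) ?A) w"
      have w2: "w2 \<in> Ar V" "Cod V w2 = FO (Dlt X) ?A" "FA (tm X) w2 = w"
        using w A unfolding w2_def by simp_all
      have e1: "Cmp V ?Df w2 = a'"
        by (rule v.arr_eqI) (use f w2 a' A wa in simp_all)
      have e2: "Cmp U (NT (cnt X) ?A) (FA (Sgm X) w2) = b'"
        by (rule u.arr_eqI) (use f w2 b' A wb in simp_all)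
      have d2: "Dom V w2 = Dom V w'" using e1 v.C.Dom_Cmp[of w2 ?Df] w2 w' f by simp
      have "w2 = w'" by (rule transpose_inj[OF A(1) w2(1,2) w'(1,2) d2]) (simp only: e2 cw)
      then show "w = FA (tm X) w'" using w2 by simp
    qed
  qed
  then show ?thesis using f A compr_square[OF f] by (simp add: pullback_square_def)
qed

end

lemma DscCompCat_Obj: "(p, \<chi>) \<in> Obj DscCompCat \<longleftrightarrow> discrete_fibration p \<and> \<chi> \<in> Fun (Src p) (arr_cat (Trg p)) \<and>
    cod_func (Trg p) \<odot> \<chi> = p \<and> (\<forall>f \<in> Ar (Src p). pullback_square (Trg p) (FA \<chi> f))"
  unfolding DscCompCat_def full_sub_def CompCat_def comprehension_category_def two_cat.simps mem_Collect_eq prod.case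
  using discrete_fibration_fibration[of p] discrete_cartesian[of p] by blast

lemma (in cwf) compr_Obj: "(ty X, compr X) \<in> Obj DscCompCat"
  unfolding DscCompCat_Obj u.Src u.Trg
proof (intro conjI ballI)
  show "cod_func B \<odot> compr X = ty X"
    by (rule Fun_eqI[OF comp_Fun[OF compr_Fun u.D.cod_Fun] u.Fun]) (auto simp: compr_square)
qed (auto simp: u.disc compr_Fun compr_pullback simp del: FA_compr)

section \<open>Morphisms of comprehension categories by components\<close>

definition iso_arr :: "('o, 'a) cat \<Rightarrow> 'a \<Rightarrow> bool" where
  "iso_arr C f \<longleftrightarrow> (\<exists>g \<in> Ar C. Dom C g = Cod C f \<and> Cod C g = Dom C f \<and>
     Cmp C g f = Idn C (Dom C f) \<and> Cmp C f g = Idn C (Cod C f))"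

lemma (in category) iso_Idn: "x \<in> Ob C \<Longrightarrow> iso_arr C (Idn C x)"
  unfolding iso_arr_def by (intro bexI[of _ "Idn C x"]) auto

lemma (in category) iso_Cmp:
  assumes "f \<in> Ar C" "g \<in> Ar C" "Cod C f = Dom C g" "iso_arr C f" "iso_arr C g"
  shows "iso_arr C (Cmp C g f)"
proof -
  obtain f' where f': "f' \<in> Ar C" "Dom C f' = Cod C f" "Cod C f' = Dom C f"
    "Cmp C f' f = Idn C (Dom C f)" "Cmp C f f' = Idn C (Cod C f)" using assms(4) by (auto simp: iso_arr_def)
  obtain g' where g': "g' \<in> Ar C" "Dom C g' = Cod C g" "Cod C g' = Dom C g"
    "Cmp C g' g = Idn C (Dom C g)" "Cmp C g g' = Idn C (Cod C g)" using assms(5) by (auto simp: iso_arr_def)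
  have "Cmp C (Cmp C f' g') (Cmp C g f) = Cmp C f' (Cmp C (Cmp C g' g) f)"
    using assms(1-3) f'(1-3) g'(1-3) by (simp add: assoc)
  also have "\<dots> = Idn C (Dom C f)" using assms(1-3) f' g' by simp
  finally have 1: "Cmp C (Cmp C f' g') (Cmp C g f) = Idn C (Dom C f)" .
  have "Cmp C (Cmp C g f) (Cmp C f' g') = Cmp C g (Cmp C (Cmp C f f') g')"
    using assms(1-3) f'(1-3) g'(1-3) by (simp add: assoc)
  also have "\<dots> = Idn C (Cod C g)" using assms(1-3) f' g' by simp
  finally show ?thesis
    unfolding iso_arr_def using 1 assms(1-3) f'(1-3) g'(1-3) by (intro bexI[of _ "Cmp C f' g'"]) simp_all
qed

lemma (in fctr) iso_FA: "\<lbrakk>f \<in> Ar C; iso_arr C f\<rbrakk> \<Longrightarrow> iso_arr D (FA F f)"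
  unfolding iso_arr_def
proof (elim bexE conjE)
  fix g assume f: "f \<in> Ar C" and g: "g \<in> Ar C" "Dom C g = Cod C f" "Cod C g = Dom C f"
    and gf: "Cmp C g f = Idn C (Dom C f)" and fg: "Cmp C f g = Idn C (Cod C f)"
  show "\<exists>g\<in>Ar D. Dom D g = Cod D (FA F f) \<and> Cod D g = Dom D (FA F f) \<and>
      Cmp D g (FA F f) = Idn D (Dom D (FA F f)) \<and> Cmp D (FA F f) g = Idn D (Cod D (FA F f))"
    using f g arg_cong[OF gf, of "FA F"] arg_cong[OF fg, of "FA F"] by (intro bexI[of _ "FA F g"]) simp_all
qed

text \<open>Lift the inverse to the domain of \<open>f\<close>. It is a right inverse because the
  composite with \<open>f\<close> lies over an identity; this fixes its domain, and only then does
  the other composite make sense.\<close>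

lemma (in discrete_fib) iso_iff:
  assumes f: "f \<in> Ar E"
  shows "iso_arr E f \<longleftrightarrow> iso_arr B (FA p f)"
proof
  assume "iso_arr B (FA p f)"
  then obtain k where k: "k \<in> Ar B" "Dom B k = FO p (Cod E f)" "Cod B k = FO p (Dom E f)"
    "Cmp B k (FA p f) = Idn B (FO p (Dom E f))" "Cmp B (FA p f) k = Idn B (FO p (Cod E f))"
    using f by (auto simp: iso_arr_def)
  let ?g = "lift (Dom E f) k"
  have fg: "Cmp E f ?g = Idn E (Cod E f)" by (rule arr_eqI) (use f k in simp_all)
  then have d: "Dom E ?g = Cod E f" using C.Dom_Cmp[of ?g f] f k by simp
  have "Cmp E ?g f = Idn E (Dom E f)" by (rule arr_eqI) (use f k d in simp_all)
  then show "iso_arr E f" unfolding iso_arr_def using f k fg d by (intro bexI[of _ ?g]) simp_all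
qed (rule iso_FA[OF f])

lemma (in ntr) invertible_iff: "invertible_nt \<alpha> \<longleftrightarrow> (\<forall>x \<in> Ob C. iso_arr D (NT \<alpha> x))"
proof
  assume "invertible_nt \<alpha>"
  then obtain \<beta> where b: "\<beta> \<in> Ntr G F" and ba: "\<beta> \<bullet> \<alpha> = id_nt F" and ab: "\<alpha> \<bullet> \<beta> = id_nt G"
    by (auto simp: invertible_nt_def)
  interpret b: ntr G F C D \<beta> by (rule ntrI') (fact G.Fun b)+
  show "\<forall>x \<in> Ob C. iso_arr D (NT \<alpha> x)"
  proof
    fix x assume x: "x \<in> Ob C"
    show "iso_arr D (NT \<alpha> x)" unfolding iso_arr_def
      using x arg_cong[OF ba, of "\<lambda>t. NT t x"] arg_cong[OF ab, of "\<lambda>t. NT t x"]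
      by (intro bexI[of _ "NT \<beta> x"]) simp_all
  qed
next
  assume "\<forall>x \<in> Ob C. iso_arr D (NT \<alpha> x)"
  then have "\<forall>x \<in> Ob C. \<exists>g. g \<in> Ar D \<and> Dom D g = FO G x \<and> Cod D g = FO F x \<and>
     Cmp D g (NT \<alpha> x) = Idn D (FO F x) \<and> Cmp D (NT \<alpha> x) g = Idn D (FO G x)"
    unfolding iso_arr_def by fastforce
  then obtain b where b: "\<And>x. x \<in> Ob C \<Longrightarrow> b x \<in> Ar D" "\<And>x. x \<in> Ob C \<Longrightarrow> Dom D (b x) = FO G x" "\<And>x. x \<in> Ob C \<Longrightarrow> Cod D (b x) = FO F x"
     and ba: "\<And>x. x \<in> Ob C \<Longrightarrow> Cmp D (b x) (NT \<alpha> x) = Idn D (FO F x)"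
     and ab: "\<And>x. x \<in> Ob C \<Longrightarrow> Cmp D (NT \<alpha> x) (b x) = Idn D (FO G x)"
    by metis
  define \<beta> where "\<beta> = \<lparr>NSrc = G, NTrg = F, NT = restrict b (Ob C)\<rparr>"
  have \<beta>: "NT \<beta> x = b x" if "x \<in> Ob C" for x using that by (simp add: \<beta>_def)
  have bn: "\<beta> \<in> Ntr G F"
  proof (rule NtrI[OF G.Fun F.Fun])
    fix f assume f: "f \<in> Ar C"
    have "Cmp D (FA F f) (b (Dom C f)) = Cmp D (Cmp D (Cmp D (b (Cod C f)) (NT \<alpha> (Cod C f))) (FA F f)) (b (Dom C f))"
      using f b by (simp add: ba)
    also have "\<dots> = Cmp D (b (Cod C f)) (Cmp D (Cmp D (NT \<alpha> (Cod C f)) (FA F f)) (b (Dom C f)))"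
      using f b by (simp add: F.D.assoc)
    also have "\<dots> = Cmp D (b (Cod C f)) (FA G f)"
      unfolding nat[OF f, symmetric] using f b by (simp add: F.D.assoc ab)
    finally show "Cmp D (FA F f) (NT \<beta> (Dom C f)) = Cmp D (NT \<beta> (Cod C f)) (FA G f)" using f by (simp add: \<beta>)
  qed (auto simp: \<beta> b, auto simp: \<beta>_def)
  then interpret b: ntr G F C D \<beta> by (rule ntrI'[OF G.Fun])
  have "\<beta> \<bullet> \<alpha> = id_nt F"
    by (rule Ntr_eqI[OF vcomp_Ntr[OF F.Fun Ntr bn] id_Ntr[OF F.Fun] F.Fun]) (simp add: \<beta> ba)
  moreover have "\<alpha> \<bullet> \<beta> = id_nt G"
    by (rule Ntr_eqI[OF vcomp_Ntr[OF G.Fun bn Ntr] id_Ntr[OF G.Fun] G.Fun]) (simp add: \<beta> ab)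
  ultimately show "invertible_nt \<alpha>" unfolding invertible_nt_def using bn by auto
qed

text \<open>Identity components make the two functors agree on objects, and naturality then makes
  them agree on arrows. Equality with \<open>id_nt F\<close> thus includes that of the targets, as
  the strict notions demand.\<close>

lemma (in ntr) identity_iff: "\<alpha> = id_nt F \<longleftrightarrow> (\<forall>x \<in> Ob C. NT \<alpha> x = Idn D (FO F x))"
proof (intro iffI)
  assume e: "\<forall>x \<in> Ob C. NT \<alpha> x = Idn D (FO F x)"
  then have o: "FO F x = FO G x" if "x \<in> Ob C" for x using Cod_NT[OF that] that by simp
  have "F = G"
    by (rule Fun_eqI[OF F.Fun G.Fun]) (use e o nat in auto)
  then show "\<alpha> = id_nt F" using e Ntr by (intro Ntr_eqI[OF _ id_Ntr[OF F.Fun] F.Fun]) auto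
qed simp

lemma DscCompCat_Hom1:
  assumes "discrete_fibration p" "discrete_fibration p'"
  shows "(C, H, \<zeta>) \<in> Hom1 DscCompCat (p, \<chi>) (p', \<chi>') \<longleftrightarrow> C \<in> Fun (Trg p) (Trg p') \<and> H \<in> Fun (Src p) (Src p') \<and> p' \<odot> H = C \<odot> p \<and>
    \<zeta> \<in> Ntr (arr_func C \<odot> \<chi>) (\<chi>' \<odot> H) \<and> cod_func (Trg p') \<lhd> \<zeta> = id_nt (C \<odot> p)"
  by (auto simp: DscCompCat_def full_sub_def CompCat_def Fib_def discrete_cartesian[OF assms(1)] discrete_cartesian[OF assms(2)]
      intro: fctr.FA_in[OF fctr.intro])

lemma DscCompCat_Hom2:
  "(\<psi>, \<phi>) \<in> Hom2 DscCompCat (p, \<chi>) (p', \<chi>') (C1, H1, \<zeta>1) (C2, H2, \<zeta>2) \<longleftrightarrow>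
    \<psi> \<in> Ntr C1 C2 \<and> \<phi> \<in> Ntr H1 H2 \<and> p' \<lhd> \<phi> = \<psi> \<rhd> p \<and> (\<chi>' \<lhd> \<phi>) \<bullet> \<zeta>1 = \<zeta>2 \<bullet> (arr_nt \<psi> \<rhd> \<chi>)"
  by (auto simp: DscCompCat_def full_sub_def CompCat_def Fib_def)

lemma DscCompCat_ops:
  "id1 DscCompCat (p, \<chi>) = (id_func (Trg p), id_func (Src p), id_nt \<chi>)"
  "comp1 DscCompCat (C2, H2, \<zeta>2) (C1, H1, \<zeta>1) = (C2 \<odot> C1, H2 \<odot> H1, (\<zeta>2 \<rhd> H1) \<bullet> (arr_func C2 \<lhd> \<zeta>1))"
  "id2 DscCompCat (C, H, \<zeta>) = (id_nt C, id_nt H)"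
  "vcomp DscCompCat (\<psi>2, \<phi>2) (\<psi>1, \<phi>1) = (\<psi>2 \<bullet> \<psi>1, \<phi>2 \<bullet> \<phi>1)"
  "hcomp DscCompCat (\<psi>2, \<phi>2) (\<psi>1, \<phi>1) = (\<psi>2 \<star> \<psi>1, \<phi>2 \<star> \<phi>1)"
  by (simp_all add: DscCompCat_def full_sub_def CompCat_def Fib_def)

text \<open>Since \<open>cod \<zeta>\<close> is an identity, \<open>\<zeta>\<close> is determined by the top sides \<open>z\<close> of its components.\<close>

definition zeta :: "'v gcwf_data \<Rightarrow> 'v gcwf_data \<Rightarrow> 'v sfunc \<Rightarrow> 'v sfunc \<Rightarrow> ('v \<Rightarrow> 'v) \<Rightarrow> 'v to_arr_nt" where
  "zeta X Y C H z = \<lparr>NSrc = arr_func C \<odot> compr X, NTrg = compr Y \<odot> H,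
     NT = (\<lambda>A \<in> Ob (Ty X). (FA C (disp X A), disp Y (FO H A), z A, Idn (base Y) (FO C (FO (ty X) A))))\<rparr>"

lemma zeta_simps [simp]: "NSrc (zeta X Y C H z) = arr_func C \<odot> compr X" "NTrg (zeta X Y C H z) = compr Y \<odot> H"
  "A \<in> Ob (Ty X) \<Longrightarrow> NT (zeta X Y C H z) A = (FA C (disp X A), disp Y (FO H A), z A, Idn (base Y) (FO C (FO (ty X) A)))"
  by (simp_all add: zeta_def)

lemma zeta_cong: "(\<And>A. A \<in> Ob (Ty X) \<Longrightarrow> z A = z' A) \<Longrightarrow> zeta X Y C H z = zeta X Y C H z'"
  unfolding zeta_def by (auto cong: restrict_cong)

locale cwf_base_mor = X: cwf X U V B + Y: cwf Y U' V' B' + C: fctr C B B' + H: fctr H U U'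
  for X Y :: "'v gcwf_data" and U V B U' V' B' C H +
  assumes square: "ty Y \<odot> H = C \<odot> ty X"
begin

lemma FO_ty_H [simp]: "A \<in> Ob U \<Longrightarrow> FO (ty Y) (FO H A) = FO C (FO (ty X) A)"
  using arg_cong[OF square, of "\<lambda>F. FO F A"] by simp
lemma FA_ty_H [simp]: "f \<in> Ar U \<Longrightarrow> FA (ty Y) (FA H f) = FA C (FA (ty X) f)"
  using arg_cong[OF square, of "\<lambda>F. FA F f"] by simp

text \<open>Naturality and commutation with the display maps are what remains of a transformation
  between the comprehension functors once its bottom sides are identities.\<close>

definition coherent :: "('v \<Rightarrow> 'v) \<Rightarrow> bool" where
  "coherent z \<longleftrightarrow> (\<forall>A \<in> Ob U. z A \<in> Ar B' \<and> Dom B' (z A) = FO C (ext X A) \<and> Cod B' (z A) = ext Y (FO H A) \<and>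
      Cmp B' (disp Y (FO H A)) (z A) = FA C (disp X A)) \<and>
    (\<forall>f \<in> Ar U. Cmp B' (FA (tm Y) (FA (Dlt Y) (FA H f))) (z (Dom U f)) = Cmp B' (z (Cod U f)) (FA C (FA (tm X) (FA (Dlt X) f))))"

lemma src_Fun: "arr_func C \<odot> compr X \<in> Fun U (arr_cat B')"
  by (rule comp_Fun[OF X.compr_Fun C.arr_func])

lemma trg_Fun: "compr Y \<odot> H \<in> Fun U (arr_cat B')"
  by (rule comp_Fun[OF H.Fun Y.compr_Fun])

lemma zeta_square:
  assumes "coherent z" "A \<in> Ob U"
  shows "(FA C (disp X A), disp Y (FO H A), z A, Idn B' (FO C (FO (ty X) A))) \<in> squares B'"
  using assms unfolding coherent_def mem_squares by simp

lemma zeta_Ntr: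
  assumes z: "coherent z"
  shows "zeta X Y C H z \<in> Ntr (arr_func C \<odot> compr X) (compr Y \<odot> H)"
proof (rule NtrI[OF src_Fun trg_Fun])
  fix f assume f: "f \<in> Ar U"
  note sq = zeta_square[OF z, of "Dom U f"] zeta_square[OF z, of "Cod U f"]
    Y.compr_square[of "FA H f"] X.compr_square[OF f] C.FA_square[OF X.compr_square[OF f]]
  show "Cmp (arr_cat B') (FA (compr Y \<odot> H) f) (NT (zeta X Y C H z) (Dom U f)) =
      Cmp (arr_cat B') (NT (zeta X Y C H z) (Cod U f)) (FA (arr_func C \<odot> compr X) f)"
    using f sq z by (simp add: X.base Y.base X.Ty Y.Ty coherent_def)
qed (use zeta_square[OF z] z in \<open>simp_all add: X.Ty Y.base coherent_def, simp add: zeta_def X.Ty\<close>)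

lemma zeta_cod:
  assumes z: "coherent z"
  shows "cod_func B' \<lhd> zeta X Y C H z = id_nt (C \<odot> ty X)"
proof -
  have e: "cod_func B' \<odot> (arr_func C \<odot> compr X) = C \<odot> ty X"
  proof (rule Fun_eqI[OF comp_Fun[OF src_Fun Y.u.D.cod_Fun] comp_Fun[OF X.u.Fun C.Fun]])
    show "FA (cod_func B' \<odot> (arr_func C \<odot> compr X)) f = FA (C \<odot> ty X) f" if "f \<in> Ar U" for f
      using that X.compr_square[OF that] C.FA_square[OF X.compr_square[OF that]] by (simp add: X.Ty)
  qed simp
  have e': "cod_func B' \<odot> (compr Y \<odot> H) = C \<odot> ty X"
  proof (rule Fun_eqI[OF comp_Fun[OF trg_Fun Y.u.D.cod_Fun] comp_Fun[OF X.u.Fun C.Fun]])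
    show "FA (cod_func B' \<odot> (compr Y \<odot> H)) f = FA (C \<odot> ty X) f" if "f \<in> Ar U" for f
      using that Y.compr_square[of "FA H f"] by (simp add: Y.Ty)
  qed simp
  have "cod_func B' \<lhd> zeta X Y C H z \<in> Ntr (cod_func B' \<odot> (arr_func C \<odot> compr X)) (cod_func B' \<odot> (compr Y \<odot> H))"
    by (rule whisker_left_Ntr[OF src_Fun zeta_Ntr[OF z] Y.u.D.cod_Fun])
  then have n: "cod_func B' \<lhd> zeta X Y C H z \<in> Ntr (C \<odot> ty X) (C \<odot> ty X)" by (simp add: e e')
  show ?thesis
    by (rule Ntr_eqI[OF n id_Ntr[OF comp_Fun[OF X.u.Fun C.Fun]] comp_Fun[OF X.u.Fun C.Fun]])
      (use zeta_square[OF z] in \<open>simp add: X.Ty Y.base\<close>)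
qed

text \<open>The first two entries of a component are dictated by source and target, the last by the
  condition on \<open>cod_func\<close>; the third is free and is taken as \<open>z\<close>.\<close>

lemma zeta_surj:
  assumes n: "\<zeta> \<in> Ntr (arr_func C \<odot> compr X) (compr Y \<odot> H)" and cod: "cod_func B' \<lhd> \<zeta> = id_nt (C \<odot> ty X)"
  obtains z where "coherent z" "\<zeta> = zeta X Y C H z"
proof -
  interpret n: ntr "arr_func C \<odot> compr X" "compr Y \<odot> H" U "arr_cat B'" \<zeta> by (rule ntrI[OF src_Fun trg_Fun n])
  define z where "z A = fst (snd (snd (NT \<zeta> A)))" for A
  have z: "NT \<zeta> A = (FA C (disp X A), disp Y (FO H A), z A, Idn B' (FO C (FO (ty X) A)))"
    and sq: "(FA C (disp X A), disp Y (FO H A), z A, Idn B' (FO C (FO (ty X) A))) \<in> squares B'" if A: "A \<in> Ob U" for A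
  proof -
    obtain f g h k where e: "NT \<zeta> A = (f, g, h, k)" by (cases "NT \<zeta> A")
    have s: "(f, g, h, k) \<in> squares B'" using n.NT_in[OF A] e by simp
    have "f = FA C (disp X A)" "g = disp Y (FO H A)" using n.Dom_NT[OF A] n.Cod_NT[OF A] e s A by simp_all
    moreover have "k = Idn B' (FO C (FO (ty X) A))"
      using arg_cong[OF cod, of "\<lambda>t. NT t A"] A e s by simp
    moreover have "h = z A" by (simp add: z_def e)
    ultimately show "NT \<zeta> A = (FA C (disp X A), disp Y (FO H A), z A, Idn B' (FO C (FO (ty X) A)))"
      "(FA C (disp X A), disp Y (FO H A), z A, Idn B' (FO C (FO (ty X) A))) \<in> squares B'" using e s by simp_all
  qed
  have c: "coherent z" unfolding coherent_def
  proof (intro conjI ballI)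
    fix f assume f: "f \<in> Ar U"
    note s = sq[of "Dom U f"] sq[of "Cod U f"] Y.compr_square[of "FA H f"] C.FA_square[OF X.compr_square[OF f]] X.compr_square[OF f]
    show "Cmp B' (FA (tm Y) (FA (Dlt Y) (FA H f))) (z (Dom U f)) = Cmp B' (z (Cod U f)) (FA C (FA (tm X) (FA (Dlt X) f)))"
      using n.nat[OF f] s f by (simp add: z X.Ty Y.Ty)
  next
    fix A assume A: "A \<in> Ob U"
    show "z A \<in> Ar B'" "Dom B' (z A) = FO C (ext X A)" "Cod B' (z A) = ext Y (FO H A)"
      "Cmp B' (disp Y (FO H A)) (z A) = FA C (disp X A)"
      using sq[OF A] A by (simp_all add: mem_squares)
  qed
  have "\<zeta> = zeta X Y C H z"
    by (rule Ntr_eqI[OF n zeta_Ntr[OF c] src_Fun]) (simp add: z X.Ty Y.base)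
  with c show thesis by (rule that)
qed

lemma zeta_inj:
  assumes "zeta X Y C H z = zeta X Y C H z'" "A \<in> Ob U"
  shows "z A = z' A"
  using arg_cong[OF assms(1), of "\<lambda>t. NT t A"] assms(2) by (simp add: X.Ty)

text \<open>An inverse square must have an inverse of \<open>z A\<close> as its top side. Conversely
  that inverse, placed over an identity, is again a commuting square because \<open>z A\<close>
  cancels.\<close>

lemma invertible_zeta:
  assumes z: "coherent z"
  shows "invertible_nt (zeta X Y C H z) \<longleftrightarrow> (\<forall>A \<in> Ob U. iso_arr B' (z A))"
proof -
  interpret n: ntr "arr_func C \<odot> compr X" "compr Y \<odot> H" U "arr_cat B'" "zeta X Y C H z"
    by (rule ntrI[OF src_Fun trg_Fun zeta_Ntr[OF z]])
  have "iso_arr (arr_cat B') (NT (zeta X Y C H z) A) \<longleftrightarrow> iso_arr B' (z A)" if A: "A \<in> Ob U" for A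
  proof -
    let ?f = "FA C (disp X A)" and ?g = "disp Y (FO H A)" and ?i = "Idn B' (FO C (FO (ty X) A))"
    note sq = zeta_square[OF z A]
    have zA: "z A \<in> Ar B'" "Dom B' (z A) = FO C (ext X A)" "Cod B' (z A) = ext Y (FO H A)" and zs: "Cmp B' ?g (z A) = ?f"
      using z A by (simp_all add: coherent_def)
    have N: "NT (zeta X Y C H z) A = (?f, ?g, z A, ?i)" using A by (simp add: X.Ty Y.base)
    show ?thesis
    proof
      assume "iso_arr (arr_cat B') (NT (zeta X Y C H z) A)"
      then obtain t where t: "t \<in> squares B'" "Dom (arr_cat B') t = ?g" "Cod (arr_cat B') t = ?f"
        and tt: "Cmp (arr_cat B') t (?f, ?g, z A, ?i) = Idn (arr_cat B') ?f" "Cmp (arr_cat B') (?f, ?g, z A, ?i) t = Idn (arr_cat B') ?g"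
        unfolding N iso_arr_def using sq by auto
      obtain h k where t': "t = (?g, ?f, h, k)" using t by (cases t) simp
      with t have "(?g, ?f, h, k) \<in> squares B'" by simp
      with tt t' sq A zA show "iso_arr B' (z A)" unfolding iso_arr_def by (intro bexI[of _ h]) (auto simp: mem_squares)
    next
      assume "iso_arr B' (z A)"
      then obtain h where h: "h \<in> Ar B'" "Dom B' h = ext Y (FO H A)" "Cod B' h = FO C (ext X A)"
        "Cmp B' h (z A) = Idn B' (FO C (ext X A))" "Cmp B' (z A) h = Idn B' (ext Y (FO H A))"
        using zA by (auto simp: iso_arr_def)
      have "Cmp B' ?f h = ?g"
        unfolding zs[symmetric] using zA h A by (simp add: Y.u.D.assoc)
      then have sq': "(?g, ?f, h, ?i) \<in> squares B'" using zA h A by (simp add: mem_squares)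
      show "iso_arr (arr_cat B') (NT (zeta X Y C H z) A)"
        unfolding N iso_arr_def using sq sq' h zA A by (intro bexI[of _ "(?g, ?f, h, ?i)"]) simp_all
    qed
  qed
  then show ?thesis unfolding n.invertible_iff by simp
qed

lemma identity_zeta:
  assumes z: "coherent z"
  shows "zeta X Y C H z = id_nt (NSrc (zeta X Y C H z)) \<longleftrightarrow> (\<forall>A \<in> Ob U. z A = Idn B' (FO C (ext X A)))"
proof -
  interpret n: ntr "arr_func C \<odot> compr X" "compr Y \<odot> H" U "arr_cat B'" "zeta X Y C H z"
    by (rule ntrI[OF src_Fun trg_Fun zeta_Ntr[OF z]])
  have "NT (zeta X Y C H z) A = Idn (arr_cat B') (FO (arr_func C \<odot> compr X) A) \<longleftrightarrow> z A = Idn B' (FO C (ext X A))"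
    if A: "A \<in> Ob U" for A
  proof -
    have zA: "Cod B' (z A) = ext Y (FO H A)" and zs: "Cmp B' (disp Y (FO H A)) (z A) = FA C (disp X A)"
      using z A by (simp_all add: coherent_def)
    \<comment> \<open>If \<open>z A\<close> is an identity, commutation with the display maps forces
      these to be equal, so all four entries agree with those of the identity square.\<close>
    have "disp Y (FO H A) = FA C (disp X A)" if "z A = Idn B' (FO C (ext X A))"
      using zA zs A unfolding that by simp
    then show ?thesis using A by (auto simp: X.Ty Y.base)
  qed
  then show ?thesis using n.identity_iff by simp
qed

end

section \<open>Mates and the reconstruction of gcwf morphisms and 2-cells\<close>

locale cwf_mor = cwf_base_mor X Y U V B U' V' B' C H + H': fctr H' V V'
  for X Y :: "'v gcwf_data" and U V B U' V' B' C H H' +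
  assumes tm_square: "tm Y \<odot> H' = C \<odot> tm X" and Sgm_square: "Sgm Y \<odot> H' = H \<odot> Sgm X"
begin

lemma FO_tm_H' [simp]: "a \<in> Ob V \<Longrightarrow> FO (tm Y) (FO H' a) = FO C (FO (tm X) a)"
  using arg_cong[OF tm_square, of "\<lambda>F. FO F a"] by simp
lemma FA_tm_H' [simp]: "f \<in> Ar V \<Longrightarrow> FA (tm Y) (FA H' f) = FA C (FA (tm X) f)"
  using arg_cong[OF tm_square, of "\<lambda>F. FA F f"] by simp
lemma FO_Sgm_H' [simp]: "a \<in> Ob V \<Longrightarrow> FO (Sgm Y) (FO H' a) = FO H (FO (Sgm X) a)"
  using arg_cong[OF Sgm_square, of "\<lambda>F. FO F a"] by simp
lemma FA_Sgm_H' [simp]: "f \<in> Ar V \<Longrightarrow> FA (Sgm Y) (FA H' f) = FA H (FA (Sgm X) f)"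
  using arg_cong[OF Sgm_square, of "\<lambda>F. FA F f"] by simp

abbreviation mt where "mt \<equiv> mate X Y (C, H, H')"

lemma NSrc_mt [simp]: "NSrc mt = H' \<odot> Dlt X"
  using comp_id_left[OF comp_Fun[OF X.D.Fun H'.Fun]] by (simp add: mate_def)
lemma NTrg_mt [simp]: "NTrg mt = Dlt Y \<odot> H"
  using comp_id_right[OF comp_Fun[OF H.Fun Y.D.Fun]] by (simp add: mate_def)

lemma NT_mt: "A \<in> Ob U \<Longrightarrow>
    NT mt A = Cmp V' (FA (Dlt Y) (FA H (NT (cnt X) A))) (NT (unt Y) (FO H' (FO (Dlt X) A)))"
  by (simp add: mate_def)

lemma mt_in [simp]: "A \<in> Ob U \<Longrightarrow> NT mt A \<in> Ar V'"
  and Dom_mt [simp]: "A \<in> Ob U \<Longrightarrow> Dom V' (NT mt A) = FO H' (FO (Dlt X) A)"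
  and Cod_mt [simp]: "A \<in> Ob U \<Longrightarrow> Cod V' (NT mt A) = FO (Dlt Y) (FO H A)"
  by (simp_all add: NT_mt)

text \<open>With \<open>mt_eqI\<close> this characterises the mate at \<open>A\<close> as the
  transpose of \<open>FA H\<close> of the counit, the form in which mates are compared
  below.\<close>

lemma mt_transpose: "A \<in> Ob U \<Longrightarrow> Cmp U' (NT (cnt Y) (FO H A)) (FA (Sgm Y) (NT mt A)) = FA H (NT (cnt X) A)"
  using Y.transpose_down[of "FO H' (FO (Dlt X) A)" "FA H (NT (cnt X) A)"] by (simp add: NT_mt)

lemma mt_eqI:
  assumes "A \<in> Ob U" "t \<in> Ar V'" "Dom V' t = FO H' (FO (Dlt X) A)" "Cod V' t = FO (Dlt Y) (FO H A)"
    and "Cmp U' (NT (cnt Y) (FO H A)) (FA (Sgm Y) t) = FA H (NT (cnt X) A)"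
  shows "NT mt A = t"
  by (rule Y.transpose_inj[of "FO H A"]) (simp_all add: assms mt_transpose)

text \<open>Both sides have the same adjunct, namely \<open>FA H\<close> of \<open>f\<close> after
  the counit.\<close>

lemma mt_nat:
  assumes f: "f \<in> Ar U"
  shows "Cmp V' (FA (Dlt Y) (FA H f)) (NT mt (Dom U f)) = Cmp V' (NT mt (Cod U f)) (FA H' (FA (Dlt X) f))"
proof (rule Y.transpose_inj[of "FO H (Cod U f)"])
  have "Cmp U' (NT (cnt Y) (FO H (Cod U f))) (FA (Sgm Y) (Cmp V' (FA (Dlt Y) (FA H f)) (NT mt (Dom U f)))) =
    Cmp U' (Cmp U' (NT (cnt Y) (Cod U' (FA H f))) (FA (Sgm Y) (FA (Dlt Y) (FA H f)))) (FA (Sgm Y) (NT mt (Dom U f)))"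
    using f by (simp add: Y.u.C.assoc)
  also have "\<dots> = FA H (Cmp U f (NT (cnt X) (Dom U f)))"
    by (subst Y.cnt_nat[symmetric]) (use f in \<open>simp_all add: Y.u.C.assoc mt_transpose\<close>)
  also have "\<dots> = Cmp U' (Cmp U' (NT (cnt Y) (FO H (Cod U f))) (FA (Sgm Y) (NT mt (Cod U f)))) (FA H (FA (Sgm X) (FA (Dlt X) f)))"
    using f by (simp add: X.cnt_nat mt_transpose)
  also have "\<dots> = Cmp U' (NT (cnt Y) (FO H (Cod U f))) (FA (Sgm Y) (Cmp V' (NT mt (Cod U f)) (FA H' (FA (Dlt X) f))))"
    using f by (simp add: Y.u.C.assoc)
  finally show "Cmp U' (NT (cnt Y) (FO H (Cod U f))) (FA (Sgm Y) (Cmp V' (FA (Dlt Y) (FA H f)) (NT mt (Dom U f)))) = \<dots>" .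
qed (use f in simp_all)

lemma mt_Ntr: "mt \<in> Ntr (H' \<odot> Dlt X) (Dlt Y \<odot> H)"
proof (rule NtrI[OF comp_Fun[OF X.D.Fun H'.Fun] comp_Fun[OF H.Fun Y.D.Fun]])
  show "NT mt \<in> extensional (Ob U)" by (simp add: mate_def vcomp_nt_def)
qed (simp_all add: mt_nat)

definition z where "z A = FA (tm Y) (NT mt A)"

lemma z_coherent: "coherent z"
  unfolding coherent_def
proof (intro conjI ballI)
  show "Cmp B' (disp Y (FO H A)) (z A) = FA C (disp X A)" if "A \<in> Ob U" for A
    using arg_cong[OF mt_transpose, of A "FA (ty Y)"] that by (simp add: z_def)
  show "Cmp B' (FA (tm Y) (FA (Dlt Y) (FA H f))) (z (Dom U f)) = Cmp B' (z (Cod U f)) (FA C (FA (tm X) (FA (Dlt X) f)))"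
    if "f \<in> Ar U" for f using arg_cong[OF mt_nat, of f "FA (tm Y)"] that by (simp add: z_def)
qed (simp_all add: z_def)

text \<open>The left side starts at \<open>FO H' a\<close>, while the right side depends on
  \<open>H'\<close> only through \<open>z\<close>. Taking domains therefore shows that
  \<open>z\<close> determines \<open>H'\<close> on objects.\<close>

lemma mt_unt:
  assumes a: "a \<in> Ob V"
  shows "Cmp V' (NT mt (FO (Sgm X) a)) (FA H' (NT (unt X) a)) =
    Y.v.lift (FO (Dlt Y) (FO H (FO (Sgm X) a))) (Cmp B' (z (FO (Sgm X) a)) (FA C (sect X a)))"
  by (rule Y.v.arr_eqI) (use a in \<open>simp_all add: z_def\<close>)

lemma FO_H'_eq: "a \<in> Ob V \<Longrightarrow>
  FO H' a = Dom V' (Y.v.lift (FO (Dlt Y) (FO H (FO (Sgm X) a))) (Cmp B' (z (FO (Sgm X) a)) (FA C (sect X a))))"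
  by (simp add: mt_unt[symmetric])

lemma invertible_mt: "invertible_nt mt \<longleftrightarrow> (\<forall>A \<in> Ob U. iso_arr B' (z A))"
proof -
  interpret n: ntr "H' \<odot> Dlt X" "Dlt Y \<odot> H" U V' mt
    by (rule ntrI'[OF comp_Fun[OF X.D.Fun H'.Fun] mt_Ntr])
  show ?thesis unfolding n.invertible_iff z_def by (simp add: Y.v.iso_iff)
qed

lemma identity_mt: "mt = id_nt (NSrc mt) \<longleftrightarrow> (\<forall>A \<in> Ob U. z A = Idn B' (FO C (ext X A)))"
proof -
  interpret n: ntr "H' \<odot> Dlt X" "Dlt Y \<odot> H" U V' mt
    by (rule ntrI'[OF comp_Fun[OF X.D.Fun H'.Fun] mt_Ntr])
  have "NT mt A = Idn V' (FO H' (FO (Dlt X) A))" if A: "A \<in> Ob U" and e: "z A = Idn B' (FO C (ext X A))" for A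
  proof -
    \<comment> \<open>The codomain of \<open>z A\<close> supplies the object equation under which
      the mate at \<open>A\<close> lies over the image of an identity with the same codomain; so it
      is that identity.\<close>
    have "ext Y (FO H A) = FO C (ext X A)" using arg_cong[OF e, of "Cod B'"] A by (simp add: z_def)
    with A e have "FA (tm Y) (NT mt A) = FA (tm Y) (Idn V' (FO (Dlt Y) (FO H A)))" by (simp add: z_def)
    then have "NT mt A = Idn V' (FO (Dlt Y) (FO H A))" using A by (simp add: Y.v.arr_eqI)
    then show ?thesis using Dom_mt[OF A] A by simp
  qed
  moreover have "z A = Idn B' (FO C (ext X A))" if "A \<in> Ob U" "NT mt A = Idn V' (FO H' (FO (Dlt X) A))" for A
    using that by (simp add: z_def)
  ultimately show ?thesis using n.identity_iff by auto
qed

end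

text \<open>On objects this is \<open>FO_H'_eq\<close>; on arrows, both functors then give arrows
  with the same codomain and the same image under \<open>tm Y\<close>.\<close>

lemma cwf_mor_unique:
  assumes m: "cwf_mor X Y U V B U' V' B' C H H1" and n: "cwf_mor X Y U V B U' V' B' C H H2"
    and z: "\<And>A. A \<in> Ob U \<Longrightarrow> cwf_mor.z X Y C H H1 A = cwf_mor.z X Y C H H2 A"
  shows "H1 = H2"
proof -
  interpret m: cwf_mor X Y U V B U' V' B' C H H1 by fact
  interpret n: cwf_mor X Y U V B U' V' B' C H H2 by fact
  have o: "FO H1 a = FO H2 a" if "a \<in> Ob V" for a
    using that by (simp add: m.FO_H'_eq n.FO_H'_eq z)
  show ?thesis
    by (rule Fun_eqI[OF m.H'.Fun n.H'.Fun o]) (assumption, rule m.Y.v.arr_eqI, simp_all add: o)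
qed

section \<open>Reconstruction of the functor on terms from a coherent family\<close>

context cwf_base_mor begin

context
  fixes z assumes coh: "coherent z"
begin

lemma z_in [simp]: "A \<in> Ob U \<Longrightarrow> z A \<in> Ar B'"
  and Dom_z [simp]: "A \<in> Ob U \<Longrightarrow> Dom B' (z A) = FO C (ext X A)"
  and Cod_z [simp]: "A \<in> Ob U \<Longrightarrow> Cod B' (z A) = ext Y (FO H A)"
  and disp_z: "A \<in> Ob U \<Longrightarrow> Cmp B' (disp Y (FO H A)) (z A) = FA C (disp X A)"
  and z_nat: "f \<in> Ar U \<Longrightarrow>
    Cmp B' (FA (tm Y) (FA (Dlt Y) (FA H f))) (z (Dom U f)) = Cmp B' (z (Cod U f)) (FA C (FA (tm X) (FA (Dlt X) f)))"
  using coh by (simp_all add: coherent_def)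

text \<open>By \<open>mt_unt\<close> this is what the mate after \<open>FA H'\<close> of the unit
  has to be for any \<open>H'\<close> with this \<open>z\<close>; its domain is the only possible
  value of \<open>H'\<close> at \<open>a\<close>.\<close>

definition k where "k a = Y.v.lift (FO (Dlt Y) (FO H (FO (Sgm X) a))) (Cmp B' (z (FO (Sgm X) a)) (FA C (sect X a)))"

lemma k_in [simp]: "a \<in> Ob V \<Longrightarrow> k a \<in> Ar V'"
  and Cod_k [simp]: "a \<in> Ob V \<Longrightarrow> Cod V' (k a) = FO (Dlt Y) (FO H (FO (Sgm X) a))"
  and FA_tm_k: "a \<in> Ob V \<Longrightarrow> FA (tm Y) (k a) = Cmp B' (z (FO (Sgm X) a)) (FA C (sect X a))"
  and FO_tm_Dom_k [simp]: "a \<in> Ob V \<Longrightarrow> FO (tm Y) (Dom V' (k a)) = FO C (FO (tm X) a)"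
  by (simp_all add: k_def)

text \<open>Projected to the base, this holds because \<open>z\<close> commutes with the display
  maps and \<open>sect X a\<close> is a section. The equation makes \<open>k a\<close> a component
  of the unit of \<open>Y\<close>, and its domains show that \<open>Dom V' (k a)\<close> is a term
  of type \<open>FO H (FO (Sgm X) a)\<close>.\<close>

lemma k_transpose:
  assumes a: "a \<in> Ob V"
  shows "Cmp U' (NT (cnt Y) (FO H (FO (Sgm X) a))) (FA (Sgm Y) (k a)) = Idn U' (FO H (FO (Sgm X) a))"
proof (rule Y.u.arr_eqI)
  have "FA (ty Y) (Cmp U' (NT (cnt Y) (FO H (FO (Sgm X) a))) (FA (Sgm Y) (k a))) =
      Cmp B' (Cmp B' (disp Y (FO H (FO (Sgm X) a))) (z (FO (Sgm X) a))) (FA C (sect X a))"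
    using a by (simp add: FA_tm_k Y.u.D.assoc)
  also have "\<dots> = FA C (Cmp B (disp X (FO (Sgm X) a)) (sect X a))" using a by (simp add: disp_z)
  also have "\<dots> = Idn B' (FO C (FO (tm X) a))" using a by (simp add: X.sect_section)
  finally show "FA (ty Y) (Cmp U' (NT (cnt Y) (FO H (FO (Sgm X) a))) (FA (Sgm Y) (k a))) = FA (ty Y) (Idn U' (FO H (FO (Sgm X) a)))"
    using a by simp
qed (use a in simp_all)

lemma Sgm_Dom_k [simp]: "a \<in> Ob V \<Longrightarrow> FO (Sgm Y) (Dom V' (k a)) = FO H (FO (Sgm X) a)"
  using arg_cong[OF k_transpose, of a "Dom U'"] by simp

definition dotted where
  "dotted = \<lparr>Src = V, Trg = V', FO = (\<lambda>a \<in> Ob V. Dom V' (k a)),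
     FA = (\<lambda>f \<in> Ar V. Y.v.lift (Dom V' (k (Cod V f))) (FA C (FA (tm X) f)))\<rparr>"

lemma FO_dotted [simp]: "a \<in> Ob V \<Longrightarrow> FO dotted a = Dom V' (k a)"
  and FA_dotted: "f \<in> Ar V \<Longrightarrow> FA dotted f = Y.v.lift (Dom V' (k (Cod V f))) (FA C (FA (tm X) f))"
  by (simp_all add: dotted_def)

text \<open>Compared in the base, this combines naturality of the unit of \<open>X\<close> with that
  of \<open>z\<close>. The left side has the domain of \<open>FA dotted f\<close>, which is how
  \<open>dotted\<close> is seen to preserve domains.\<close>

lemma k_nat:
  assumes f: "f \<in> Ar V"
  shows "Cmp V' (k (Cod V f)) (FA dotted f) = Cmp V' (FA (Dlt Y) (FA H (FA (Sgm X) f))) (k (Dom V f))"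
proof (rule Y.v.arr_eqI)
  have "FA (tm Y) (Cmp V' (k (Cod V f)) (FA dotted f)) =
    Cmp B' (z (FO (Sgm X) (Cod V f))) (FA C (FA (tm X) (Cmp V (NT (unt X) (Cod V f)) f)))"
    using f by (simp add: FA_dotted FA_tm_k Y.u.D.assoc)
  also have "\<dots> = Cmp B' (Cmp B' (z (Cod U (FA (Sgm X) f))) (FA C (FA (tm X) (FA (Dlt X) (FA (Sgm X) f))))) (FA C (sect X (Dom V f)))"
    unfolding X.unt_nat[OF f, symmetric] using f by (simp add: Y.u.D.assoc)
  also have "\<dots> = FA (tm Y) (Cmp V' (FA (Dlt Y) (FA H (FA (Sgm X) f))) (k (Dom V f)))"
    by (subst z_nat[symmetric]) (use f in \<open>simp_all add: FA_tm_k Y.u.D.assoc\<close>)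
  finally show "FA (tm Y) (Cmp V' (k (Cod V f)) (FA dotted f)) = \<dots>" .
qed (use f in \<open>simp_all add: FA_dotted\<close>)

lemma dotted_in [simp]: "f \<in> Ar V \<Longrightarrow> FA dotted f \<in> Ar V'"
  and Cod_dotted [simp]: "f \<in> Ar V \<Longrightarrow> Cod V' (FA dotted f) = Dom V' (k (Cod V f))"
  and FA_tm_dotted [simp]: "f \<in> Ar V \<Longrightarrow> FA (tm Y) (FA dotted f) = FA C (FA (tm X) f)"
  by (simp_all add: FA_dotted)

lemma Dom_dotted [simp]: "f \<in> Ar V \<Longrightarrow> Dom V' (FA dotted f) = Dom V' (k (Dom V f))"
  using arg_cong[OF k_nat, of f "Dom V'"] by simp

lemma dotted_Fun: "dotted \<in> Fun V V'"
proof (rule FunI)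
  show "FA dotted (Idn V a) = Idn V' (FO dotted a)" if "a \<in> Ob V" for a
    by (rule Y.v.arr_eqI) (use that in simp_all)
  show "FA dotted (Cmp V g f) = Cmp V' (FA dotted g) (FA dotted f)" if "f \<in> Ar V" "g \<in> Ar V" "Cod V f = Dom V g" for f g
    by (rule Y.v.arr_eqI) (use that in simp_all)
qed (simp_all add: X.v.C.category_axioms Y.v.C.category_axioms, simp_all add: dotted_def)

lemma dotted_mor: "cwf_mor X Y U V B U' V' B' C H dotted"
proof -
  interpret d: fctr dotted V V' by unfold_locales (rule dotted_Fun)
  show ?thesis
  proof unfold_locales
    show "tm Y \<odot> dotted = C \<odot> tm X"
      by (rule Fun_eqI[OF comp_Fun[OF d.Fun Y.v.Fun] comp_Fun[OF X.v.Fun C.Fun]]) simp_all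
    show "Sgm Y \<odot> dotted = H \<odot> Sgm X"
    proof (rule Fun_eqI[OF comp_Fun[OF d.Fun Y.S.Fun] comp_Fun[OF X.S.Fun H.Fun]])
      show "FA (Sgm Y \<odot> dotted) f = FA (H \<odot> Sgm X) f" if "f \<in> Ar V" for f
        by (rule Y.u.arr_eqI) (use that in simp_all)
    qed simp
  qed
qed

lemma dotted_z:
  assumes A: "A \<in> Ob U"
  shows "cwf_mor.z X Y C H dotted A = z A"
proof -
  interpret d: cwf_mor X Y U V B U' V' B' C H dotted by (rule dotted_mor)
  \<comment> \<open>\<open>k\<close> takes the place of the unit of \<open>Y\<close> in the formula
    \<open>NT_mt\<close>. After projection, naturality of \<open>z\<close> at the counit leaves
    \<open>z A\<close> after \<open>FA C\<close> of a triangle identity.\<close>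
  let ?t = "Cmp V' (FA (Dlt Y) (FA H (NT (cnt X) A))) (k (FO (Dlt X) A))"
  have "NT d.mt A = ?t"
  proof (rule d.mt_eqI[OF A])
    have "Cmp U' (NT (cnt Y) (FO H A)) (FA (Sgm Y) ?t) =
      Cmp U' (Cmp U' (NT (cnt Y) (Cod U' (FA H (NT (cnt X) A)))) (FA (Sgm Y) (FA (Dlt Y) (FA H (NT (cnt X) A))))) (FA (Sgm Y) (k (FO (Dlt X) A)))"
      using A by (simp add: Y.u.C.assoc)
    also have "\<dots> = FA H (NT (cnt X) A)"
      by (subst Y.cnt_nat[symmetric]) (use A in \<open>simp_all add: Y.u.C.assoc k_transpose\<close>)
    finally show "Cmp U' (NT (cnt Y) (FO H A)) (FA (Sgm Y) ?t) = FA H (NT (cnt X) A)" .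
  qed (use A in simp_all)
  then have "d.z A = Cmp B' (Cmp B' (FA (tm Y) (FA (Dlt Y) (FA H (NT (cnt X) A)))) (z (Dom U (NT (cnt X) A)))) (FA C (sect X (FO (Dlt X) A)))"
    using A by (simp add: d.z_def FA_tm_k Y.u.D.assoc)
  also have "\<dots> = Cmp B' (z A) (FA C (Cmp B (FA (tm X) (FA (Dlt X) (NT (cnt X) A))) (sect X (FO (Dlt X) A))))"
    by (subst z_nat) (use A in \<open>simp_all add: Y.u.D.assoc\<close>)
  also have "\<dots> = z A" using A by (simp add: X.sect_Dlt)
  finally show ?thesis .
qed

end

end

section \<open>Existence and uniqueness of the component of a 2-cell on terms\<close>

locale cwf_pre_cell = m1: cwf_mor X Y U V B U' V' B' C1 H1 H1' + m2: cwf_mor X Y U V B U' V' B' C2 H2 H2' +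
    f: ntr H1 H2 U U' \<phi> + g: ntr C1 C2 B B' \<psi>
  for X Y :: "'v gcwf_data" and U V B U' V' B' C1 H1 H1' C2 H2 H2' \<phi> \<psi> +
  assumes cell_square: "ty Y \<lhd> \<phi> = \<psi> \<rhd> ty X"
begin

lemma ty_phi [simp]: "A \<in> Ob U \<Longrightarrow> FA (ty Y) (NT \<phi> A) = NT \<psi> (FO (ty X) A)"
  using arg_cong[OF cell_square, of "\<lambda>t. NT t A"] by simp

lemma arr_nt: "arr_nt \<psi> \<in> Ntr (arr_func C1) (arr_func C2)"
proof (rule NtrI[OF m1.C.arr_func m2.C.arr_func])
  have sq: "(FA C1 f, FA C2 f, NT \<psi> (Dom B f), NT \<psi> (Cod B f)) \<in> squares B'" if "f \<in> Ar B" for f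
    using that g.nat[OF that] by (simp add: mem_squares)
  have N: "NT (arr_nt \<psi>) f = (FA C1 f, FA C2 f, NT \<psi> (Dom B f), NT \<psi> (Cod B f))" if "f \<in> Ar B" for f
    using that by (simp add: arr_nt_def)
  show "NT (arr_nt \<psi>) f \<in> Ar (arr_cat B') \<and> Dom (arr_cat B') (NT (arr_nt \<psi>) f) = FO (arr_func C1) f \<and>
      Cod (arr_cat B') (NT (arr_nt \<psi>) f) = FO (arr_func C2) f" if "f \<in> Ob (arr_cat B)" for f
    using that sq by (simp add: N)
  fix t assume "t \<in> Ar (arr_cat B)"
  moreover obtain f h i j where t: "t = (f, h, i, j)" by (cases t)
  ultimately have s: "(f, h, i, j) \<in> squares B" by simp
  have fh: "f \<in> Ar B" "h \<in> Ar B" "i \<in> Ar B" "j \<in> Ar B" "Dom B i = Dom B f" "Cod B i = Dom B h" "Dom B j = Cod B f" "Cod B j = Cod B h"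
    using s by (simp_all add: mem_squares)
  show "Cmp (arr_cat B') (FA (arr_func C2) t) (NT (arr_nt \<psi>) (Dom (arr_cat B) t)) =
      Cmp (arr_cat B') (NT (arr_nt \<psi>) (Cod (arr_cat B) t)) (FA (arr_func C1) t)"
    unfolding t using s fh sq[of f] sq[of h] m1.C.FA_square[OF s] m2.C.FA_square[OF s] g.nat[of i] g.nat[of j] by (simp add: N)
qed (simp_all add: arr_nt_def)

text \<open>At each type the two composites are squares with the same vertical sides and the same
  bottom side, so only the top sides carry information.\<close>

lemma coherence_iff:
  "(compr Y \<lhd> \<phi>) \<bullet> zeta X Y C1 H1 m1.z = zeta X Y C2 H2 m2.z \<bullet> (arr_nt \<psi> \<rhd> compr X) \<longleftrightarrow>
    (\<forall>A \<in> Ob U. Cmp B' (FA (tm Y) (FA (Dlt Y) (NT \<phi> A))) (m1.z A) = Cmp B' (m2.z A) (NT \<psi> (ext X A)))"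
    (is "?l = ?r \<longleftrightarrow> _")
proof -
  have l: "?l \<in> Ntr (arr_func C1 \<odot> compr X) (compr Y \<odot> H2)"
    by (rule vcomp_Ntr[OF m1.src_Fun m1.zeta_Ntr[OF m1.z_coherent] whisker_left_Ntr[OF m1.H.Fun f.Ntr m1.Y.compr_Fun]])
  have r: "?r \<in> Ntr (arr_func C1 \<odot> compr X) (compr Y \<odot> H2)"
    by (rule vcomp_Ntr[OF m1.src_Fun whisker_right_Ntr[OF m1.X.compr_Fun m1.C.arr_func arr_nt] m2.zeta_Ntr[OF m2.z_coherent]])
  have L: "NT ?l A = (FA C1 (disp X A), disp Y (FO H2 A), Cmp B' (FA (tm Y) (FA (Dlt Y) (NT \<phi> A))) (m1.z A), NT \<psi> (FO (ty X) A))"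
    and R: "NT ?r A = (FA C1 (disp X A), disp Y (FO H2 A), Cmp B' (m2.z A) (NT \<psi> (ext X A)), NT \<psi> (FO (ty X) A))" if A: "A \<in> Ob U" for A
  proof -
    note s1 = m1.zeta_square[OF m1.z_coherent A] and s2 = m2.zeta_square[OF m2.z_coherent A]
    show "NT ?l A = (FA C1 (disp X A), disp Y (FO H2 A), Cmp B' (FA (tm Y) (FA (Dlt Y) (NT \<phi> A))) (m1.z A), NT \<psi> (FO (ty X) A))"
      using A s1 m1.Y.compr_square[of "NT \<phi> A"] by (simp add: m1.X.Ty m1.Y.Ty m1.Y.base)
    have "(FA C1 (disp X A), FA C2 (disp X A), NT \<psi> (ext X A), NT \<psi> (FO (ty X) A)) \<in> squares B'"
      using A g.nat[of "disp X A"] by (simp add: mem_squares)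
    then show "NT ?r A = (FA C1 (disp X A), disp Y (FO H2 A), Cmp B' (m2.z A) (NT \<psi> (ext X A)), NT \<psi> (FO (ty X) A))"
      using A s2 by (simp add: m1.X.Ty m1.Y.base arr_nt_def)
  qed
  show ?thesis
  proof
    assume "?l = ?r"
    then have "NT ?l A = NT ?r A" for A by simp
    then show "\<forall>A \<in> Ob U. Cmp B' (FA (tm Y) (FA (Dlt Y) (NT \<phi> A))) (m1.z A) = Cmp B' (m2.z A) (NT \<psi> (ext X A))"
      unfolding L R using L R by (metis Pair_inject)
  next
    assume e: "\<forall>A \<in> Ob U. Cmp B' (FA (tm Y) (FA (Dlt Y) (NT \<phi> A))) (m1.z A) = Cmp B' (m2.z A) (NT \<psi> (ext X A))"
    show "?l = ?r"
    proof (rule Ntr_eqI[OF l r m1.src_Fun])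
      show "NT ?l A = NT ?r A" if "A \<in> Ob U" for A
        unfolding L[OF that] R[OF that] using e that by simp
    qed
  qed
qed

text \<open>Before projection this is compatibility of the two mates with the cell. Both sides have
  as adjunct \<open>NT \<phi> A\<close> after \<open>FA H1\<close> of the counit, which naturality
  of \<open>\<phi>\<close> turns into the form involving \<open>H2\<close>.\<close>

lemma coherent_of_cell:
  assumes n: "\<phi>' \<in> Ntr H1' H2'" and t: "tm Y \<lhd> \<phi>' = \<psi> \<rhd> tm X" and s: "Sgm Y \<lhd> \<phi>' = \<phi> \<rhd> Sgm X" and A: "A \<in> Ob U"
  shows "Cmp B' (FA (tm Y) (FA (Dlt Y) (NT \<phi> A))) (m1.z A) = Cmp B' (m2.z A) (NT \<psi> (ext X A))"
proof -
  interpret n: ntr H1' H2' V V' \<phi>' by (rule ntrI'[OF m1.H'.Fun n])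
  have t: "FA (tm Y) (NT \<phi>' a) = NT \<psi> (FO (tm X) a)" if "a \<in> Ob V" for a
    using arg_cong[OF t, of "\<lambda>t. NT t a"] that by simp
  have s: "FA (Sgm Y) (NT \<phi>' a) = NT \<phi> (FO (Sgm X) a)" if "a \<in> Ob V" for a
    using arg_cong[OF s, of "\<lambda>t. NT t a"] that by simp
  have "Cmp V' (FA (Dlt Y) (NT \<phi> A)) (NT m1.mt A) = Cmp V' (NT m2.mt A) (NT \<phi>' (FO (Dlt X) A))"
  proof (rule m1.Y.transpose_inj[of "FO H2 A"])
    have "Cmp U' (NT (cnt Y) (FO H2 A)) (FA (Sgm Y) (Cmp V' (FA (Dlt Y) (NT \<phi> A)) (NT m1.mt A))) =
      Cmp U' (Cmp U' (NT (cnt Y) (Cod U' (NT \<phi> A))) (FA (Sgm Y) (FA (Dlt Y) (NT \<phi> A)))) (FA (Sgm Y) (NT m1.mt A))"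
      using A by (simp add: m1.Y.u.C.assoc)
    also have "\<dots> = Cmp U' (NT \<phi> A) (FA H1 (NT (cnt X) A))"
      by (subst m1.Y.cnt_nat[symmetric]) (use A in \<open>simp_all add: m1.Y.u.C.assoc m1.mt_transpose\<close>)
    also have "\<dots> = Cmp U' (FA H2 (NT (cnt X) A)) (NT \<phi> (FO (Sgm X) (FO (Dlt X) A)))"
      using A f.nat[of "NT (cnt X) A"] by simp
    also have "\<dots> = Cmp U' (NT (cnt Y) (FO H2 A)) (FA (Sgm Y) (Cmp V' (NT m2.mt A) (NT \<phi>' (FO (Dlt X) A))))"
      using A by (simp add: m2.mt_transpose[symmetric] s m1.Y.u.C.assoc)
    finally show "Cmp U' (NT (cnt Y) (FO H2 A)) (FA (Sgm Y) (Cmp V' (FA (Dlt Y) (NT \<phi> A)) (NT m1.mt A))) = \<dots>" .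
  qed (use A in simp_all)
  from arg_cong[OF this, of "FA (tm Y)"] show ?thesis using A by (simp add: m1.z_def m2.z_def t)
qed

lemma cell_unique:
  assumes n: "\<phi>1 \<in> Ntr H1' H2'" "\<phi>2 \<in> Ntr H1' H2'" and t: "tm Y \<lhd> \<phi>1 = \<psi> \<rhd> tm X" "tm Y \<lhd> \<phi>2 = \<psi> \<rhd> tm X"
  shows "\<phi>1 = \<phi>2"
proof (rule Ntr_eqI[OF n m1.H'.Fun])
  interpret n1: ntr H1' H2' V V' \<phi>1 by (rule ntrI'[OF m1.H'.Fun n(1)])
  interpret n2: ntr H1' H2' V V' \<phi>2 by (rule ntrI'[OF m1.H'.Fun n(2)])
  fix a assume a: "a \<in> Ob V"
  show "NT \<phi>1 a = NT \<phi>2 a"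
    by (rule m1.Y.v.arr_eqI) (use a arg_cong[OF t(1), of "\<lambda>t. NT t a"] arg_cong[OF t(2), of "\<lambda>t. NT t a"] in simp_all)
qed

text \<open>The component at \<open>a\<close> can only be the lift of
  \<open>NT \<psi> (FO (tm X) a)\<close> to \<open>FO H2' a\<close>; the question is whether it
  starts at \<open>FO H1' a\<close>. Extended to \<open>Dlt Y\<close> of
  \<open>FO H2 (FO (Sgm X) a)\<close>, it is compared with an arrow that does start there: codomains
  agree, and images agree by the hypothesis and naturality of \<open>\<psi>\<close> at the
  section.\<close>

lemma cell_exists:
  assumes coh: "\<And>A. A \<in> Ob U \<Longrightarrow> Cmp B' (FA (tm Y) (FA (Dlt Y) (NT \<phi> A))) (m1.z A) = Cmp B' (m2.z A) (NT \<psi> (ext X A))"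
  shows "\<exists>\<phi>'. \<phi>' \<in> Ntr H1' H2' \<and> tm Y \<lhd> \<phi>' = \<psi> \<rhd> tm X \<and> Sgm Y \<lhd> \<phi>' = \<phi> \<rhd> Sgm X"
proof -
  define l where "l a = m1.Y.v.lift (FO H2' a) (NT \<psi> (FO (tm X) a))" for a
  have l: "l a \<in> Ar V'" "Cod V' (l a) = FO H2' a" "FA (tm Y) (l a) = NT \<psi> (FO (tm X) a)" if "a \<in> Ob V" for a
    using that by (simp_all add: l_def)
  have d: "Dom V' (l a) = FO H1' a" if a: "a \<in> Ob V" for a
  proof -
    let ?A = "FO (Sgm X) a"
    have "Cmp V' (NT m2.mt ?A) (Cmp V' (FA H2' (NT (unt X) a)) (l a)) =
        Cmp V' (FA (Dlt Y) (NT \<phi> ?A)) (Cmp V' (NT m1.mt ?A) (FA H1' (NT (unt X) a)))"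
    proof (rule m1.Y.v.arr_eqI)
      have "FA (tm Y) (Cmp V' (NT m2.mt ?A) (Cmp V' (FA H2' (NT (unt X) a)) (l a))) =
          Cmp B' (m2.z ?A) (Cmp B' (FA C2 (sect X a)) (NT \<psi> (FO (tm X) a)))"
        using a l by (simp add: m2.z_def)
      also have "\<dots> = Cmp B' (Cmp B' (m2.z ?A) (NT \<psi> (ext X ?A))) (FA C1 (sect X a))"
        using a g.nat[of "sect X a"] by (simp add: m1.Y.u.D.assoc m2.z_def)
      also have "\<dots> = FA (tm Y) (Cmp V' (FA (Dlt Y) (NT \<phi> ?A)) (Cmp V' (NT m1.mt ?A) (FA H1' (NT (unt X) a))))"
        using a by (simp add: coh[symmetric] m1.Y.u.D.assoc m1.z_def)
      finally show "FA (tm Y) (Cmp V' (NT m2.mt ?A) (Cmp V' (FA H2' (NT (unt X) a)) (l a))) = \<dots>" .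
    qed (use a l in simp_all)
    from arg_cong[OF this, of "Dom V'"] show ?thesis using a l by simp
  qed
  define \<phi>' where "\<phi>' = \<lparr>NSrc = H1', NTrg = H2', NT = restrict l (Ob V)\<rparr>"
  have N: "NT \<phi>' a = l a" if "a \<in> Ob V" for a using that by (simp add: \<phi>'_def)
  have n: "\<phi>' \<in> Ntr H1' H2'"
  proof (rule NtrI[OF m1.H'.Fun m2.H'.Fun])
    fix f assume f: "f \<in> Ar V"
    have "Cmp V' (FA H2' f) (l (Dom V f)) = Cmp V' (l (Cod V f)) (FA H1' f)"
      by (rule m1.Y.v.arr_eqI) (use f l d g.nat[of "FA (tm X) f"] in simp_all)
    then show "Cmp V' (FA H2' f) (NT \<phi>' (Dom V f)) = Cmp V' (NT \<phi>' (Cod V f)) (FA H1' f)" using f by (simp add: N)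
  qed (simp_all add: N l d, simp_all add: \<phi>'_def)
  interpret n: ntr H1' H2' V V' \<phi>' by (rule ntrI'[OF m1.H'.Fun n])
  have "tm Y \<lhd> \<phi>' = \<psi> \<rhd> tm X"
    by (subst square_iff[OF m1.X.v.Fun m1.Y.v.Fun m1.H'.Fun m1.C.Fun m1.tm_square m2.tm_square n g.Ntr]) (simp add: N l)
  moreover have "Sgm Y \<lhd> \<phi>' = \<phi> \<rhd> Sgm X"
  proof (subst square_iff[OF m1.X.S.Fun m1.Y.S.Fun m1.H'.Fun m1.H.Fun m1.Sgm_square m2.Sgm_square n f.Ntr], intro ballI)
    show "FA (Sgm Y) (NT \<phi>' a) = NT \<phi> (FO (Sgm X) a)" if "a \<in> Ob V" for a
      by (rule m1.Y.u.arr_eqI) (use that in \<open>simp_all add: N l d\<close>)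
  qed
  ultimately show ?thesis using n by blast
qed

end

section \<open>The discrete gcwf of sections\<close>

text \<open>A right adjoint described by a couniversal arrow for each object, so that for the gcwf
  of sections a single factorisation property has to be proved.\<close>

locale universal_arrows = S: fctr S V U for S :: "('o, 'a, 'p, 'b) func" and V U +
  fixes D0 :: "'p \<Rightarrow> 'o" and \<epsilon> :: "'p \<Rightarrow> 'b"
  assumes D0 [simp]: "A \<in> Ob U \<Longrightarrow> D0 A \<in> Ob V"
    and eps [simp]: "A \<in> Ob U \<Longrightarrow> \<epsilon> A \<in> Ar U" "A \<in> Ob U \<Longrightarrow> Dom U (\<epsilon> A) = FO S (D0 A)" "A \<in> Ob U \<Longrightarrow> Cod U (\<epsilon> A) = A"
    and univ: "\<lbrakk>a \<in> Ob V; f \<in> Ar U; Dom U f = FO S a\<rbrakk> \<Longrightarrow>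
      \<exists>!h. h \<in> Ar V \<and> Dom V h = a \<and> Cod V h = D0 (Cod U f) \<and> Cmp U (\<epsilon> (Cod U f)) (FA S h) = f"
begin

definition transp where
  "transp a f = (THE h. h \<in> Ar V \<and> Dom V h = a \<and> Cod V h = D0 (Cod U f) \<and> Cmp U (\<epsilon> (Cod U f)) (FA S h) = f)"

lemma
  assumes "a \<in> Ob V" "f \<in> Ar U" "Dom U f = FO S a"
  shows transp_in [simp]: "transp a f \<in> Ar V" and Dom_transp [simp]: "Dom V (transp a f) = a"
    and Cod_transp [simp]: "Cod V (transp a f) = D0 (Cod U f)"
    and eps_transp: "Cmp U (\<epsilon> (Cod U f)) (FA S (transp a f)) = f"
  using theI'[OF univ[OF assms]] by (simp_all add: transp_def)

lemma eqI:
  assumes "A \<in> Ob U" "h \<in> Ar V" "h' \<in> Ar V" "Dom V h = Dom V h'" "Cod V h = D0 A" "Cod V h' = D0 A"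
    and "Cmp U (\<epsilon> A) (FA S h) = Cmp U (\<epsilon> A) (FA S h')"
  shows "h = h'"
proof -
  have "\<exists>!k. k \<in> Ar V \<and> Dom V k = Dom V h' \<and> Cod V k = D0 A \<and> Cmp U (\<epsilon> A) (FA S k) = Cmp U (\<epsilon> A) (FA S h')"
    using univ[of "Dom V h'" "Cmp U (\<epsilon> A) (FA S h')"] assms(1-6) by simp
  with assms show ?thesis by auto
qed

definition R where
  "R = \<lparr>Src = U, Trg = V, FO = (\<lambda>A \<in> Ob U. D0 A), FA = (\<lambda>f \<in> Ar U. transp (D0 (Dom U f)) (Cmp U f (\<epsilon> (Dom U f))))\<rparr>"

definition unit where "unit = \<lparr>NSrc = id_func V, NTrg = R \<odot> S, NT = (\<lambda>a \<in> Ob V. transp a (Idn U (FO S a)))\<rparr>"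
definition counit where "counit = \<lparr>NSrc = S \<odot> R, NTrg = id_func U, NT = (\<lambda>A \<in> Ob U. \<epsilon> A)\<rparr>"

lemma FO_R [simp]: "A \<in> Ob U \<Longrightarrow> FO R A = D0 A"
  and FA_R: "f \<in> Ar U \<Longrightarrow> FA R f = transp (D0 (Dom U f)) (Cmp U f (\<epsilon> (Dom U f)))"
  and SrcTrg_R [simp]: "Src R = U" "Trg R = V"
  and NT_unit: "a \<in> Ob V \<Longrightarrow> NT unit a = transp a (Idn U (FO S a))"
  and NT_counit [simp]: "A \<in> Ob U \<Longrightarrow> NT counit A = \<epsilon> A"
  and bounds [simp]: "NSrc unit = id_func V" "NTrg unit = R \<odot> S" "NSrc counit = S \<odot> R" "NTrg counit = id_func U"
  by (simp_all add: R_def unit_def counit_def)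

lemma R_in [simp]: "f \<in> Ar U \<Longrightarrow> FA R f \<in> Ar V" "f \<in> Ar U \<Longrightarrow> Dom V (FA R f) = D0 (Dom U f)"
    "f \<in> Ar U \<Longrightarrow> Cod V (FA R f) = D0 (Cod U f)"
  and unit_in [simp]: "a \<in> Ob V \<Longrightarrow> NT unit a \<in> Ar V" "a \<in> Ob V \<Longrightarrow> Dom V (NT unit a) = a"
    "a \<in> Ob V \<Longrightarrow> Cod V (NT unit a) = D0 (FO S a)"
  and eps_R: "f \<in> Ar U \<Longrightarrow> Cmp U (\<epsilon> (Cod U f)) (FA S (FA R f)) = Cmp U f (\<epsilon> (Dom U f))"
  and eps_unit: "a \<in> Ob V \<Longrightarrow> Cmp U (\<epsilon> (FO S a)) (FA S (NT unit a)) = Idn U (FO S a)"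
  using eps_transp[of "D0 (Dom U f)" "Cmp U f (\<epsilon> (Dom U f))"] eps_transp[of a "Idn U (FO S a)"]
  by (simp_all add: FA_R NT_unit)

lemma R_Fun: "R \<in> Fun U V"
proof (rule FunI)
  show "FA R (Idn U A) = Idn V (FO R A)" if A: "A \<in> Ob U" for A
    by (rule eqI[OF A]) (use A eps_R[of "Idn U A"] in simp_all)
  fix f g assume fg: "f \<in> Ar U" "g \<in> Ar U" "Cod U f = Dom U g"
  show "FA R (Cmp U g f) = Cmp V (FA R g) (FA R f)"
  proof (rule eqI[of "Cod U g"])
    have "Cmp U (\<epsilon> (Cod U g)) (FA S (FA R (Cmp U g f))) = Cmp U g (Cmp U f (\<epsilon> (Dom U f)))"
      using fg eps_R[of "Cmp U g f"] by (simp add: S.D.assoc)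
    also have "\<dots> = Cmp U (Cmp U g (\<epsilon> (Dom U g))) (FA S (FA R f))"
      using fg eps_R[of f] by (simp add: S.D.assoc)
    also have "\<dots> = Cmp U (\<epsilon> (Cod U g)) (FA S (Cmp V (FA R g) (FA R f)))"
      unfolding eps_R[OF fg(2), symmetric] using fg by (simp add: S.D.assoc)
    finally show "Cmp U (\<epsilon> (Cod U g)) (FA S (FA R (Cmp U g f))) = \<dots>" .
  qed (use fg in simp_all)
qed (simp_all add: S.C.category_axioms S.D.category_axioms, simp_all add: R_def)

text \<open>Equations between arrows into \<open>D0 A\<close> are checked after composing with
  \<open>\<epsilon> A\<close>; the remaining laws come from the defining equation of
  \<open>transp\<close>.\<close>

lemma adjunction: "adjunction S R unit counit"
proof -
  interpret R: fctr R U V by unfold_locales (rule R_Fun)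
  have unit: "unit \<in> Ntr (id_func V) (R \<odot> S)"
  proof (rule NtrI[OF id_Fun[OF S.C.category_axioms] comp_Fun[OF S.Fun R.Fun]])
    fix f assume f: "f \<in> Ar V"
    have "Cmp V (FA R (FA S f)) (NT unit (Dom V f)) = Cmp V (NT unit (Cod V f)) f"
    proof (rule eqI[of "FO S (Cod V f)"])
      have "Cmp U (\<epsilon> (FO S (Cod V f))) (FA S (Cmp V (FA R (FA S f)) (NT unit (Dom V f)))) =
        Cmp U (Cmp U (\<epsilon> (Cod U (FA S f))) (FA S (FA R (FA S f)))) (FA S (NT unit (Dom V f)))"
        using f by (simp add: S.D.assoc)
      also have "\<dots> = FA S f" using f by (subst eps_R) (simp_all add: S.D.assoc eps_unit)
      also have "\<dots> = Cmp U (Cmp U (\<epsilon> (FO S (Cod V f))) (FA S (NT unit (Cod V f)))) (FA S f)"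
        using f by (simp add: eps_unit)
      also have "\<dots> = Cmp U (\<epsilon> (FO S (Cod V f))) (FA S (Cmp V (NT unit (Cod V f)) f))"
        using f by (simp add: S.D.assoc)
      finally show "Cmp U (\<epsilon> (FO S (Cod V f))) (FA S (Cmp V (FA R (FA S f)) (NT unit (Dom V f)))) = \<dots>" .
    qed (use f in simp_all)
    then show "Cmp V (FA (R \<odot> S) f) (NT unit (Dom V f)) = Cmp V (NT unit (Cod V f)) (FA (id_func V) f)" using f by simp
  qed (simp_all, simp add: unit_def)
  have counit: "counit \<in> Ntr (S \<odot> R) (id_func U)"
    by (rule NtrI[OF comp_Fun[OF R.Fun S.Fun] id_Fun[OF S.D.category_axioms]]) (simp_all add: eps_R, simp add: counit_def)
  have "(counit \<rhd> S) \<bullet> (S \<lhd> unit) = id_nt S"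
  proof -
    have 1: "S \<lhd> unit \<in> Ntr S (S \<odot> (R \<odot> S))"
      using whisker_left_Ntr[OF id_Fun[OF S.C.category_axioms] unit S.Fun] by (simp add: comp_id_right[OF S.Fun])
    have 2: "counit \<rhd> S \<in> Ntr (S \<odot> (R \<odot> S)) S"
      using whisker_right_Ntr[OF S.Fun comp_Fun[OF R.Fun S.Fun] counit]
      by (simp add: comp_id_left[OF S.Fun] comp_assoc[OF S.Fun R.Fun S.Fun])
    show ?thesis
      by (rule Ntr_eqI[OF vcomp_Ntr[OF S.Fun 1 2] id_Ntr[OF S.Fun] S.Fun]) (simp add: eps_unit)
  qed
  moreover have "(R \<lhd> counit) \<bullet> (unit \<rhd> R) = id_nt R"
  proof -
    have 1: "unit \<rhd> R \<in> Ntr R (R \<odot> (S \<odot> R))"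
      using whisker_right_Ntr[OF R.Fun id_Fun[OF S.C.category_axioms] unit]
      by (simp add: comp_id_left[OF R.Fun] comp_assoc[OF R.Fun S.Fun R.Fun])
    have 2: "R \<lhd> counit \<in> Ntr (R \<odot> (S \<odot> R)) R"
      using whisker_left_Ntr[OF comp_Fun[OF R.Fun S.Fun] counit R.Fun] by (simp add: comp_id_right[OF R.Fun])
    show ?thesis
    proof (rule Ntr_eqI[OF vcomp_Ntr[OF R.Fun 1 2] id_Ntr[OF R.Fun] R.Fun])
      fix A assume A: "A \<in> Ob U"
      have "Cmp V (FA R (\<epsilon> A)) (NT unit (D0 A)) = Idn V (D0 A)"
      proof (rule eqI[OF A])
        have "Cmp U (\<epsilon> A) (FA S (Cmp V (FA R (\<epsilon> A)) (NT unit (D0 A)))) =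
          Cmp U (Cmp U (\<epsilon> (Cod U (\<epsilon> A))) (FA S (FA R (\<epsilon> A)))) (FA S (NT unit (D0 A)))"
          using A by (simp add: S.D.assoc)
        also have "\<dots> = \<epsilon> A" using A by (subst eps_R) (simp_all add: S.D.assoc eps_unit)
        finally show "Cmp U (\<epsilon> A) (FA S (Cmp V (FA R (\<epsilon> A)) (NT unit (D0 A)))) = Cmp U (\<epsilon> A) (FA S (Idn V (D0 A)))"
          using A by simp
      qed (use A in simp_all)
      then show "NT ((R \<lhd> counit) \<bullet> (unit \<rhd> R)) A = NT (id_nt R) A" using A by simp
    qed
  qed
  ultimately show ?thesis using unit counit S.Fun R.Fun by (simp add: adjunction_def)
qed

end

text \<open>Cardinal arithmetic gives a bijection between the universe and its square. The last
  equation makes every element a code, so equations between coded terms split into components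
  without side conditions.\<close>

lemma infinite_pairing:
  assumes "infinite (UNIV :: 'v set)"
  shows "\<exists>(c :: 'v \<Rightarrow> 'v \<Rightarrow> 'v) fs sn. (\<forall>x y. fs (c x y) = x) \<and> (\<forall>x y. sn (c x y) = y) \<and> (\<forall>v. c (fs v) (sn v) = v)"
proof -
  obtain f :: "'v \<times> 'v \<Rightarrow> 'v" where "bij_betw f (UNIV \<times> UNIV) UNIV"
    using card_of_Times_same_infinite[OF assms] card_of_ordIso by blast
  then have f: "bij f" by simp
  show ?thesis
    by (rule exI[of _ "\<lambda>x y. f (x, y)"], rule exI[of _ "\<lambda>v. fst (inv f v)"], rule exI[of _ "\<lambda>v. snd (inv f v)"])
      (simp add: bij_is_inj[OF f] bij_is_surj[OF f] surj_f_inv_f)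
qed

text \<open>
  The terms of a type \<open>A\<close> are the sections of its display map \<open>d A\<close>; a pair of a type and a term is coded as
  one element of \<open>'v\<close>.  An arrow is coded by an arrow of types and the term over its codomain.
\<close>

locale discrete_comprehension = p: discrete_fib p E B
  for p :: "'v sfunc" and E B +
  fixes \<chi> :: "'v to_arr_func" and c :: "'v \<Rightarrow> 'v \<Rightarrow> 'v" and fs sn
  assumes chi: "\<chi> \<in> Fun E (arr_cat B)" and cod_chi: "cod_func B \<odot> \<chi> = p"
    and pb: "f \<in> Ar E \<Longrightarrow> pullback_square B (FA \<chi> f)"
    and code [simp]: "fs (c x y) = x" "sn (c x y) = y" "c (fs v) (sn v) = v"
begin

sublocale x: fctr \<chi> E "arr_cat B" by unfold_locales (rule chi)

abbreviation "d \<equiv> FO \<chi>"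
abbreviation "e A \<equiv> Dom B (d A)"
definition "t f = fst (snd (snd (FA \<chi> f)))"

lemma d_in [simp]: "A \<in> Ob E \<Longrightarrow> d A \<in> Ar B"
  using x.FO_in[of A] by simp

lemma Cod_d [simp]: "A \<in> Ob E \<Longrightarrow> Cod B (d A) = FO p A"
  using arg_cong[OF cod_chi, of "\<lambda>F. FO F A"] by simp

lemma FA_chi:
  assumes "f \<in> Ar E"
  shows "FA \<chi> f = (d (Dom E f), d (Cod E f), t f, FA p f)"
    and chi_square: "(d (Dom E f), d (Cod E f), t f, FA p f) \<in> squares B"
proof -
  obtain g h i j where ghij: "FA \<chi> f = (g, h, i, j)" by (cases "FA \<chi> f")
  have s: "(g, h, i, j) \<in> squares B" using x.FA_in[OF assms] by (simp add: ghij)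
  moreover have "g = d (Dom E f)" "h = d (Cod E f)" using x.Dom_FA[OF assms] x.Cod_FA[OF assms] s by (simp_all add: ghij)
  moreover have "j = FA p f" using arg_cong[OF cod_chi, of "\<lambda>F. FA F f"] assms s by (simp add: ghij)
  moreover have "i = t f" by (simp add: t_def ghij)
  ultimately show "FA \<chi> f = (d (Dom E f), d (Cod E f), t f, FA p f)"
    "(d (Dom E f), d (Cod E f), t f, FA p f) \<in> squares B" using ghij by simp_all
qed

lemma t_in [simp]: "f \<in> Ar E \<Longrightarrow> t f \<in> Ar B" "f \<in> Ar E \<Longrightarrow> Dom B (t f) = e (Dom E f)" "f \<in> Ar E \<Longrightarrow> Cod B (t f) = e (Cod E f)"
  and d_t: "f \<in> Ar E \<Longrightarrow> Cmp B (d (Cod E f)) (t f) = Cmp B (FA p f) (d (Dom E f))"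
  using chi_square[of f] by (simp_all add: mem_squares)

lemma t_Idn [simp]: "A \<in> Ob E \<Longrightarrow> t (Idn E A) = Idn B (e A)"
  using x.FA_Idn[of A] by (simp add: FA_chi)

lemma t_Cmp [simp]: "\<lbrakk>f \<in> Ar E; g \<in> Ar E; Cod E f = Dom E g\<rbrakk> \<Longrightarrow> t (Cmp E g f) = Cmp B (t g) (t f)"
  using x.FA_Cmp[of f g] chi_square[of f] chi_square[of g] by (simp add: FA_chi)

lemma pullback:
  assumes "f \<in> Ar E" "a \<in> Ar B" "b \<in> Ar B" "Dom B a = Dom B b" "Cod B a = e (Cod E f)" "Cod B b = FO p (Dom E f)"
    and "Cmp B (d (Cod E f)) a = Cmp B (FA p f) b"
  shows "\<exists>!w. w \<in> Ar B \<and> Dom B w = Dom B b \<and> Cod B w = e (Dom E f) \<and> Cmp B (t f) w = a \<and> Cmp B (d (Dom E f)) w = b"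
proof -
  have "\<forall>z. \<forall>a\<in>hom B z (e (Cod E f)). \<forall>b\<in>hom B z (FO p (Dom E f)).
      Cmp B (d (Cod E f)) a = Cmp B (FA p f) b \<longrightarrow>
      (\<exists>!w. w \<in> hom B z (e (Dom E f)) \<and> Cmp B (t f) w = a \<and> Cmp B (d (Dom E f)) w = b)"
    using pb[OF assms(1)] assms(1) unfolding FA_chi[OF assms(1)] pullback_square_def by simp
  from this[rule_format, of a "Dom B b" b] show ?thesis using assms by (simp add: hom_def conj_assoc)
qed

lemma pullback_eqI:
  assumes "f \<in> Ar E" "w \<in> Ar B" "w' \<in> Ar B" "Dom B w = Dom B w'" "Cod B w = e (Dom E f)" "Cod B w' = e (Dom E f)"
    and "Cmp B (t f) w = Cmp B (t f) w'" "Cmp B (d (Dom E f)) w = Cmp B (d (Dom E f)) w'"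
  shows "w = w'"
proof -
  have "Cmp B (d (Cod E f)) (Cmp B (t f) w') = Cmp B (Cmp B (d (Cod E f)) (t f)) w'"
    using assms(1-6) by (simp add: p.D.assoc)
  also have "\<dots> = Cmp B (FA p f) (Cmp B (d (Dom E f)) w')"
    unfolding d_t[OF assms(1)] using assms(1-6) by (simp add: p.D.assoc)
  finally have "\<exists>!v. v \<in> Ar B \<and> Dom B v = Dom B (Cmp B (d (Dom E f)) w') \<and> Cod B v = e (Dom E f) \<and>
      Cmp B (t f) v = Cmp B (t f) w' \<and> Cmp B (d (Dom E f)) v = Cmp B (d (Dom E f)) w'"
    by (intro pullback) (use assms in simp_all)
  with assms show ?thesis by auto
qed

definition sec where
  "sec A = {s \<in> Ar B. Dom B s = FO p A \<and> Cod B s = e A \<and> Cmp B (d A) s = Idn B (FO p A)}"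

lemma sec_in [simp]: "s \<in> sec A \<Longrightarrow> s \<in> Ar B" "s \<in> sec A \<Longrightarrow> Dom B s = FO p A" "s \<in> sec A \<Longrightarrow> Cod B s = e A"
  and d_sec: "s \<in> sec A \<Longrightarrow> Cmp B (d A) s = Idn B (FO p A)"
  by (simp_all add: sec_def)

lemma secI: "\<lbrakk>s \<in> Ar B; Dom B s = FO p A; Cod B s = e A; Cmp B (d A) s = Idn B (FO p A)\<rbrakk> \<Longrightarrow> s \<in> sec A"
  unfolding sec_def by blast

text \<open>Substitution in a term: the section over the domain of \<open>f\<close> that the
  pullback square induces from \<open>s\<close>.\<close>

definition pull where "pull f s = (THE w. w \<in> sec (Dom E f) \<and> Cmp B (t f) w = Cmp B s (FA p f))"

lemma pull_eqI:
  assumes "f \<in> Ar E" "s \<in> sec (Cod E f)" "w \<in> sec (Dom E f)" "Cmp B (t f) w = Cmp B s (FA p f)"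
  shows "pull f s = w"
  unfolding pull_def
proof (rule the_equality)
  show "v = w" if v: "v \<in> sec (Dom E f) \<and> Cmp B (t f) v = Cmp B s (FA p f)" for v
    by (rule pullback_eqI[OF assms(1)])
      (use v[THEN conjunct1] v[THEN conjunct2] assms in \<open>simp_all add: d_sec\<close>)
qed (use assms in simp)

lemma
  assumes f: "f \<in> Ar E" and s: "s \<in> sec (Cod E f)"
  shows pull_sec [simp]: "pull f s \<in> sec (Dom E f)" and t_pull: "Cmp B (t f) (pull f s) = Cmp B s (FA p f)"
proof -
  \<comment> \<open>The cone consists of \<open>s\<close> after \<open>FA p f\<close> and an
    identity; its second leg makes the mediating arrow a section.\<close>
  have "Cmp B (d (Cod E f)) (Cmp B s (FA p f)) = Cmp B (Cmp B (d (Cod E f)) s) (FA p f)"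
    using f s by (simp add: p.D.assoc)
  also have "\<dots> = Cmp B (FA p f) (Idn B (FO p (Dom E f)))" using f by (simp add: d_sec[OF s])
  finally have "\<exists>!w. w \<in> Ar B \<and> Dom B w = Dom B (Idn B (FO p (Dom E f))) \<and> Cod B w = e (Dom E f) \<and>
      Cmp B (t f) w = Cmp B s (FA p f) \<and> Cmp B (d (Dom E f)) w = Idn B (FO p (Dom E f))"
    by (intro pullback) (use f s in simp_all)
  from ex1_implies_ex[OF this] obtain w where "w \<in> Ar B \<and> Dom B w = Dom B (Idn B (FO p (Dom E f))) \<and> Cod B w = e (Dom E f) \<and>
      Cmp B (t f) w = Cmp B s (FA p f) \<and> Cmp B (d (Dom E f)) w = Idn B (FO p (Dom E f))" by blast
  then have w: "w \<in> sec (Dom E f)" "Cmp B (t f) w = Cmp B s (FA p f)" using f by (auto intro!: secI)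
  with pull_eqI[OF f s w] show "pull f s \<in> sec (Dom E f)" "Cmp B (t f) (pull f s) = Cmp B s (FA p f)" by simp_all
qed

lemma pull_in [simp]:
  assumes "f \<in> Ar E" "s \<in> sec (Cod E f)"
  shows "pull f s \<in> Ar B" "Dom B (pull f s) = FO p (Dom E f)" "Cod B (pull f s) = e (Dom E f)"
  using pull_sec[OF assms] by (simp_all del: pull_sec)

lemma pull_Idn [simp]: "\<lbrakk>A \<in> Ob E; s \<in> sec A\<rbrakk> \<Longrightarrow> pull (Idn E A) s = s"
  by (rule pull_eqI) simp_all

lemma pull_Cmp [simp]:
  assumes "f \<in> Ar E" "g \<in> Ar E" "Cod E f = Dom E g" "s \<in> sec (Cod E g)"
  shows "pull (Cmp E g f) s = pull f (pull g s)"
proof (rule pull_eqI)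
  have "Cmp B (t (Cmp E g f)) (pull f (pull g s)) = Cmp B (t g) (Cmp B (pull g s) (FA p f))"
    using assms by (simp add: p.D.assoc t_pull)
  also have "\<dots> = Cmp B (Cmp B (t g) (pull g s)) (FA p f)"
    using assms by (simp add: p.D.assoc)
  also have "\<dots> = Cmp B s (FA p (Cmp E g f))"
    using assms by (simp add: p.D.assoc t_pull)
  finally show "Cmp B (t (Cmp E g f)) (pull f (pull g s)) = Cmp B s (FA p (Cmp E g f))" .
qed (use assms in simp_all)

text \<open>This is the category of elements of the presheaf of sections on \<open>E\<close>, with
  \<open>pull\<close> as restriction. The domain of an arrow carries the restricted term, which is
  why the code records the term over the codomain.\<close>

definition terms :: "'v scat" where
  "terms = \<lparr>Ob = {v. fs v \<in> Ob E \<and> sn v \<in> sec (fs v)}, Ar = {v. fs v \<in> Ar E \<and> sn v \<in> sec (Cod E (fs v))},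
     Dom = (\<lambda>v \<in> {v. fs v \<in> Ar E \<and> sn v \<in> sec (Cod E (fs v))}. c (Dom E (fs v)) (pull (fs v) (sn v))),
     Cod = (\<lambda>v \<in> {v. fs v \<in> Ar E \<and> sn v \<in> sec (Cod E (fs v))}. c (Cod E (fs v)) (sn v)),
     Idn = (\<lambda>v \<in> {v. fs v \<in> Ob E \<and> sn v \<in> sec (fs v)}. c (Idn E (fs v)) (sn v)),
     Cmp = (\<lambda>w v. if fs v \<in> Ar E \<and> sn v \<in> sec (Cod E (fs v)) \<and> fs w \<in> Ar E \<and> sn w \<in> sec (Cod E (fs w)) \<and>
         c (Cod E (fs v)) (sn v) = c (Dom E (fs w)) (pull (fs w) (sn w))
       then c (Cmp E (fs w) (fs v)) (sn w) else undefined)\<rparr>"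

lemma c_eq [simp]: "c x y = v \<longleftrightarrow> fs v = x \<and> sn v = y" "v = c x y \<longleftrightarrow> fs v = x \<and> sn v = y"
  using code by metis+

lemma terms_simps:
  "v \<in> Ob terms \<longleftrightarrow> fs v \<in> Ob E \<and> sn v \<in> sec (fs v)" "v \<in> Ar terms \<longleftrightarrow> fs v \<in> Ar E \<and> sn v \<in> sec (Cod E (fs v))"
  "\<lbrakk>fs v \<in> Ar E; sn v \<in> sec (Cod E (fs v))\<rbrakk> \<Longrightarrow> Dom terms v = c (Dom E (fs v)) (pull (fs v) (sn v))"
  "\<lbrakk>fs v \<in> Ar E; sn v \<in> sec (Cod E (fs v))\<rbrakk> \<Longrightarrow> Cod terms v = c (Cod E (fs v)) (sn v)"
  "\<lbrakk>fs v \<in> Ob E; sn v \<in> sec (fs v)\<rbrakk> \<Longrightarrow> Idn terms v = c (Idn E (fs v)) (sn v)"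
  "\<lbrakk>fs v \<in> Ar E; sn v \<in> sec (Cod E (fs v)); fs w \<in> Ar E; sn w \<in> sec (Cod E (fs w));
    Cod E (fs v) = Dom E (fs w); sn v = pull (fs w) (sn w)\<rbrakk> \<Longrightarrow> Cmp terms w v = c (Cmp E (fs w) (fs v)) (sn w)"
  by (auto simp: terms_def)

lemma category_terms: "category terms"
proof (rule categoryI)
  show "Dom terms \<in> extensional (Ar terms)" "Cod terms \<in> extensional (Ar terms)" "Idn terms \<in> extensional (Ob terms)"
    by (auto simp: terms_def)
  show "Cmp terms g f = undefined" if "\<not> (f \<in> Ar terms \<and> g \<in> Ar terms \<and> Cod terms f = Dom terms g)" for f g
    using that by (auto simp: terms_def)
qed (auto simp: terms_simps p.C.assoc)

definition tsgm :: "'v sfunc" where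
  "tsgm = \<lparr>Src = terms, Trg = E, FO = restrict fs (Ob terms), FA = restrict fs (Ar terms)\<rparr>"

lemma tsgm_simps [simp]: "Src tsgm = terms" "Trg tsgm = E" "v \<in> Ob terms \<Longrightarrow> FO tsgm v = fs v" "v \<in> Ar terms \<Longrightarrow> FA tsgm v = fs v"
  by (simp_all add: tsgm_def)

lemma tsgm_Fun: "tsgm \<in> Fun terms E"
  by (rule FunI) (auto simp: terms_simps category_terms p.C.category_axioms, auto simp: tsgm_def)

lemma discrete_terms: "discrete_fibration (p \<odot> tsgm)"
proof -
  interpret S: fctr tsgm terms E by unfold_locales (rule tsgm_Fun)
  interpret q: fctr "p \<odot> tsgm" terms B by unfold_locales (rule comp_Fun[OF S.Fun p.Fun])
  have "\<exists>!f. f \<in> Ar terms \<and> Cod terms f = a \<and> FA (p \<odot> tsgm) f = s"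
    if a: "a \<in> Ob terms" and s: "s \<in> Ar B" "Cod B s = FO p (fs a)" for a s
  proof (rule ex1I[of _ "c (p.lift (fs a) s) (sn a)"])
    show "c (p.lift (fs a) s) (sn a) \<in> Ar terms \<and> Cod terms (c (p.lift (fs a) s) (sn a)) = a \<and>
        FA (p \<odot> tsgm) (c (p.lift (fs a) s) (sn a)) = s"
      using a s by (simp add: terms_simps)
    fix f assume f: "f \<in> Ar terms \<and> Cod terms f = a \<and> FA (p \<odot> tsgm) f = s"
    then have "fs f \<in> Ar E" "sn f = sn a" "Cod E (fs f) = fs a" "FA p (fs f) = s"
      by (auto simp: terms_simps)
    moreover have "fs f = p.lift (fs a) s"
      by (rule p.arr_eqI) (use \<open>fs f \<in> Ar E\<close> \<open>Cod E (fs f) = fs a\<close> \<open>FA p (fs f) = s\<close> a s in \<open>simp_all add: terms_simps\<close>)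
    ultimately show "f = c (p.lift (fs a) s) (sn a)" by simp
  qed
  then show ?thesis by (simp add: discrete_fibration_def)
qed

text \<open>\<open>star A\<close> is \<open>A\<close> weakened along its own display map, and
  \<open>diag A\<close> is the generic term of type \<open>A\<close>: the diagonal section induced
  by two identities. The pair is the value of \<open>Dlt\<close> at \<open>A\<close>.\<close>

definition star where "star A = Dom E (p.lift A (d A))"
definition diag where "diag A = (THE w. w \<in> sec (star A) \<and> Cmp B (t (p.lift A (d A))) w = Idn B (e A))"

lemma FO_p_star [simp]: "A \<in> Ob E \<Longrightarrow> FO p (star A) = e A" and star_in [simp]: "A \<in> Ob E \<Longrightarrow> star A \<in> Ob E"
  by (simp_all add: star_def)

lemma diag:
  assumes A: "A \<in> Ob E"
  shows "diag A \<in> sec (star A)" "Cmp B (t (p.lift A (d A))) (diag A) = Idn B (e A)"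
proof -
  let ?l = "p.lift A (d A)"
  have "\<exists>!w. w \<in> Ar B \<and> Dom B w = Dom B (Idn B (e A)) \<and> Cod B w = e (Dom E ?l) \<and>
      Cmp B (t ?l) w = Idn B (e A) \<and> Cmp B (d (Dom E ?l)) w = Idn B (e A)"
    by (rule pullback) (use A in simp_all)
  then have "\<exists>!w. w \<in> sec (star A) \<and> Cmp B (t ?l) w = Idn B (e A)"
    using A by (simp add: sec_def star_def[symmetric] conj_ac del: sec_in)
  from theI'[OF this] show "diag A \<in> sec (star A)" "Cmp B (t (p.lift A (d A))) (diag A) = Idn B (e A)"
    by (simp_all add: diag_def)
qed

lemma star_diag_in [simp]: "A \<in> Ob E \<Longrightarrow> c (star A) (diag A) \<in> Ob terms"
  by (simp add: terms_simps diag)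

text \<open>An arrow of terms into the generic term restricts it to \<open>sn a\<close>, and its
  type component is determined by its image in the base. Solving for that image with the defining
  property of \<open>diag A\<close> leaves \<open>Cmp B (t f) (sn a)\<close> as the only
  choice.\<close>

lemma universal_factor:
  assumes A: "A \<in> Ob E" and a: "a \<in> Ob terms" and f: "f \<in> Ar E" "Dom E f = fs a" "Cod E f = A"
  shows "h \<in> Ar terms \<and> Dom terms h = a \<and> Cod terms h = c (star A) (diag A) \<and> Cmp E (p.lift A (d A)) (fs h) = f \<longleftrightarrow>
    h = c (p.lift (star A) (Cmp B (t f) (sn a))) (diag A)"
proof -
  let ?l = "p.lift A (d A)" and ?w = "Cmp B (t f) (sn a)" let ?g = "p.lift (star A) ?w"
  have a': "fs a \<in> Ob E" "sn a \<in> sec (fs a)" using a by (simp_all add: terms_simps)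
  have w: "?w \<in> Ar B" "Dom B ?w = FO p (fs a)" "Cod B ?w = e A" using a' f by simp_all
  have l: "?l \<in> Ar E" "Dom E ?l = star A" "Cod E ?l = A" using A by (simp_all add: star_def)
  have g: "?g \<in> Ar E" "Cod E ?g = star A" "FA p ?g = ?w" using w A by simp_all
  have lg: "Cmp E ?l ?g = f"
  proof (rule p.arr_eqI)
    have "FA p (Cmp E ?l ?g) = Cmp B (Cmp B (d (Cod E f)) (t f)) (sn a)"
      using A f a' l g by (simp add: p.D.assoc)
    also have "\<dots> = FA p f"
      unfolding d_t[OF f(1)] using f a' d_sec[OF a'(2)] by (simp add: p.D.assoc)
    finally show "FA p (Cmp E ?l ?g) = FA p f" .
  qed (use A f a' l g in simp_all)
  have dg: "Dom E ?g = fs a" using arg_cong[OF lg, of "Dom E"] f l g by simp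
  \<comment> \<open>Restricting the generic term along \<open>?g\<close> gives back the term of
    \<open>a\<close>. The required equation is tested on the two projections of the pullback square
    of \<open>?l\<close>; along either one, both sides become \<open>?w\<close>.\<close>
  have pg: "pull ?g (diag A) = sn a"
  proof (rule pull_eqI)
    show "Cmp B (t ?g) (sn a) = Cmp B (diag A) (FA p ?g)"
    proof (rule pullback_eqI[OF l(1)])
      have "Cmp B (t ?l) (Cmp B (t ?g) (sn a)) = Cmp B (t (Cmp E ?l ?g)) (sn a)"
        using l g dg a' by (simp add: p.D.assoc)
      also have "\<dots> = Cmp B (Cmp B (t ?l) (diag A)) ?w" unfolding lg diag(2)[OF A] using w by simp
      also have "\<dots> = Cmp B (t ?l) (Cmp B (diag A) (FA p ?g))"
        using l g A w diag(1)[OF A] by (simp add: p.D.assoc)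
      finally show "Cmp B (t ?l) (Cmp B (t ?g) (sn a)) = Cmp B (t ?l) (Cmp B (diag A) (FA p ?g))" .
      have "Cmp B (d (star A)) (Cmp B (t ?g) (sn a)) = Cmp B (Cmp B (d (Cod E ?g)) (t ?g)) (sn a)"
        using l g A w dg a' by (simp add: p.D.assoc)
      also have "\<dots> = FA p ?g"
        unfolding d_t[OF g(1)] using l g A w dg a' d_sec[OF a'(2)] by (simp add: p.D.assoc)
      also have "\<dots> = Cmp B (Cmp B (d (star A)) (diag A)) (FA p ?g)"
        using g w A by (simp add: d_sec[OF diag(1)])
      also have "\<dots> = Cmp B (d (star A)) (Cmp B (diag A) (FA p ?g))"
        using g w A diag[OF A] by (simp add: p.D.assoc)
      finally show "Cmp B (d (Dom E ?l)) (Cmp B (t ?g) (sn a)) = Cmp B (d (Dom E ?l)) (Cmp B (diag A) (FA p ?g))"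
        by (simp add: l)
    qed (use l g A w dg a' diag[OF A] in simp_all)
  qed (use g dg a' diag[OF A] in simp_all)
  show ?thesis
  proof
    assume "h = c ?g (diag A)"
    then show "h \<in> Ar terms \<and> Dom terms h = a \<and> Cod terms h = c (star A) (diag A) \<and> Cmp E ?l (fs h) = f"
      using g dg pg lg diag[OF A] by (simp add: terms_simps)
  next
    assume "h \<in> Ar terms \<and> Dom terms h = a \<and> Cod terms h = c (star A) (diag A) \<and> Cmp E ?l (fs h) = f"
    then have h: "fs h \<in> Ar E" "Cod E (fs h) = star A" "sn h = diag A" "Dom E (fs h) = fs a" "pull (fs h) (diag A) = sn a"
      and lh: "Cmp E ?l (fs h) = f" by (auto simp: terms_simps)
    \<comment> \<open>Conversely, such an \<open>h\<close> restricts \<open>diag A\<close> to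
      \<open>sn a\<close>, and this equation recovers the image of \<open>fs h\<close> as
      \<open>?w\<close>.\<close>
    have "?w = Cmp B (t ?l) (Cmp B (t (fs h)) (pull (fs h) (diag A)))"
      unfolding lh[symmetric] using l h a' by (simp add: p.D.assoc)
    also have "\<dots> = Cmp B (Cmp B (t ?l) (diag A)) (FA p (fs h))"
      using l h A diag(1)[OF A] t_pull[OF h(1), of "diag A"] by (simp add: p.D.assoc)
    also have "\<dots> = FA p (fs h)" unfolding diag(2)[OF A] using h A by simp
    finally have "FA p (fs h) = ?w" by simp
    then have "fs h = ?g" using h g by (simp add: p.arr_eqI)
    then show "h = c ?g (diag A)" using h by simp
  qed
qed

sublocale un: universal_arrows tsgm terms E "\<lambda>A. c (star A) (diag A)" "\<lambda>A. p.lift A (d A)"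
proof unfold_locales
  show "tsgm \<in> Fun terms E" by (rule tsgm_Fun)
  fix a f assume a: "a \<in> Ob terms" and f: "f \<in> Ar E" "Dom E f = FO tsgm a"
  have "h \<in> Ar terms \<and> Dom terms h = a \<and> Cod terms h = c (star (Cod E f)) (diag (Cod E f)) \<and>
      Cmp E (p.lift (Cod E f) (d (Cod E f))) (FA tsgm h) = f \<longleftrightarrow>
      h = c (p.lift (star (Cod E f)) (Cmp B (t f) (sn a))) (diag (Cod E f))" for h
    using universal_factor[of "Cod E f" a f h] a f tsgm_simps(4)[of h] tsgm_simps(3)[OF a] p.C.Cod_in[OF f(1)] by metis
  then show "\<exists>!h. h \<in> Ar terms \<and> Dom terms h = a \<and> Cod terms h = c (star (Cod E f)) (diag (Cod E f)) \<and>
      Cmp E (p.lift (Cod E f) (d (Cod E f))) (FA tsgm h) = f"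
    by (simp only: ex1_eq)
qed (simp_all, simp add: star_def)

lemma fs_transp: "\<lbrakk>a \<in> Ob terms; f \<in> Ar E; Dom E f = fs a\<rbrakk> \<Longrightarrow>
    fs (un.transp a f) = p.lift (star (Cod E f)) (Cmp B (t f) (sn a))"
  using universal_factor[of "Cod E f" a f "un.transp a f"] un.eps_transp[of a f] by simp

definition cwf_of :: "'v gcwf_data" where
  "cwf_of = \<lparr>ty = p, tm = p \<odot> tsgm, Sgm = tsgm, Dlt = un.R, unt = un.unit, cnt = un.counit\<rparr>"

lemma cwf_of_Obj: "cwf_of \<in> Obj CwF"
  by (simp add: CwF_Obj cwf_of_def p.disc discrete_terms tsgm_Fun un.adjunction)

text \<open>The counit at \<open>A\<close> is the lift of \<open>d A\<close>, so its image is
  \<open>d A\<close> itself. On arrows the top side is \<open>t\<close> of \<open>f\<close> after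
  the lifted display map, composed with the generic term, and the defining equation of
  \<open>diag\<close> reduces it to \<open>t f\<close>. That \<open>p\<close> and the comprehension
  functor come back by equality makes the surjectivity strict.\<close>

lemma compr_cwf_of: "compr cwf_of = \<chi>"
proof -
  interpret w: cwf cwf_of E terms B by unfold_locales (rule cwf_of_Obj, simp_all add: cwf_of_def)
  show ?thesis
  proof (rule Fun_eqI[OF w.compr_Fun chi])
    show "FO (compr cwf_of) A = FO \<chi> A" if "A \<in> Ob E" for A
      using that by (simp add: w.Ty) (simp add: cwf_of_def)
    fix f assume f: "f \<in> Ar E"
    let ?A = "Dom E f"
    let ?f = "Cmp E f (p.lift ?A (d ?A))"
    have "Cmp B (t ?f) (diag ?A) = Cmp B (t f) (Cmp B (t (p.lift ?A (d ?A))) (diag ?A))"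
      using f diag(1)[of ?A] by (simp add: p.D.assoc)
    also have "\<dots> = t f" using f by (simp add: diag)
    finally have t: "Cmp B (t ?f) (diag ?A) = t f" .
    have "FA (p \<odot> tsgm) (FA un.R f) = t f"
      using f fs_transp[of "c (star ?A) (diag ?A)" ?f] diag(1)[of ?A] t by (simp add: un.FA_R)
    then have "FA (tm cwf_of) (FA (Dlt cwf_of) f) = t f" by (simp add: cwf_of_def)
    then show "FA (compr cwf_of) f = FA \<chi> f"
      using f by (simp add: w.Ty FA_chi) (simp add: cwf_of_def)
  qed
qed

end

lemma DscCompCat_surj:
  assumes "infinite (UNIV :: 'v set)" and "P \<in> Obj (DscCompCat :: ('v cc, _, _) two_cat)"
  shows "\<exists>X. X \<in> Obj CwF \<and> (ty X, compr X) = P"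
proof -
  obtain p \<chi> where P: "P = (p, \<chi>)" by (cases P)
  note o = assms(2)[unfolded P DscCompCat_Obj]
  obtain E B where EB: "Src p = E" "Trg p = B" by simp
  obtain c :: "'v \<Rightarrow> 'v \<Rightarrow> 'v" and fs sn where c: "\<And>x y. fs (c x y) = x" "\<And>x y. sn (c x y) = y" "\<And>v. c (fs v) (sn v) = v"
    using infinite_pairing[OF assms(1)] by auto
  interpret discrete_fib p E B using discrete_fibI[of p] o unfolding EB by blast
  interpret discrete_comprehension p E B \<chi> c fs sn
    using o c unfolding EB by unfold_locales blast+
  have "ty cwf_of = p" by (simp add: cwf_of_def)
  then show ?thesis using cwf_of_Obj compr_cwf_of P by blast
qed

section \<open>The 2-equivalence\<close>

definition to_compr :: "('v gcwf_data, 'v gcwf_mor, 'v gcwf_cell, 'v cc, 'v cc_mor, 'v snt \<times> 'v snt) two_func" where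
  "to_compr = \<lparr>on0 = (\<lambda>X. (ty X, compr X)),
     on1 = (\<lambda>X Y m. (fst m, fst (snd m), zeta X Y (fst m) (fst (snd m)) (\<lambda>A. FA (tm Y) (NT (mate X Y m) A)))),
     on2 = (\<lambda>X Y m n c. (fst c, fst (snd c)))\<rparr>"

lemma to_compr_simps [simp]:
  "on0 to_compr X = (ty X, compr X)"
  "on1 to_compr X Y (C, H, H') = (C, H, zeta X Y C H (\<lambda>A. FA (tm Y) (NT (mate X Y (C, H, H')) A)))"
  "on2 to_compr X Y m n (\<psi>, \<phi>, \<phi>') = (\<psi>, \<phi>)"
  by (simp_all add: to_compr_def)

lemma cwf_exists: "X \<in> Obj CwF \<Longrightarrow> \<exists>U V B. cwf X U V B"
  using cwf.intro by blast

lemma Hom1_iff: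
  assumes X: "cwf X U V B" and Y: "cwf Y U' V' B'"
  shows "(C, H, H') \<in> Hom1 CwF X Y \<longleftrightarrow> cwf_mor X Y U V B U' V' B' C H H'"
  unfolding CwF_Hom1[OF cwf.obj[OF X] cwf.obj[OF Y]] cwf.Ty[OF X] cwf.Ty[OF Y] cwf.Tm[OF X] cwf.Tm[OF Y] cwf.base[OF X] cwf.base[OF Y]
    cwf_mor_def cwf_base_mor_def cwf_mor_axioms_def cwf_base_mor_axioms_def fctr_def using X Y by blast

lemma (in cwf_mor) on1_eq: "on1 to_compr X Y (C, H, H') = (C, H, zeta X Y C H z)"
  by (simp add: z_def cong: zeta_cong)

lemma (in cwf_base_mor) Hom1_DscCompCat:
  "(C, H, \<zeta>) \<in> Hom1 DscCompCat (ty X, compr X) (ty Y, compr Y) \<longleftrightarrow>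
    \<zeta> \<in> Ntr (arr_func C \<odot> compr X) (compr Y \<odot> H) \<and> cod_func B' \<lhd> \<zeta> = id_nt (C \<odot> ty X)"
  unfolding DscCompCat_Hom1[OF X.u.disc Y.u.disc] X.u.Src X.u.Trg Y.u.Src Y.u.Trg using C.Fun H.Fun square by blast

lemma (in cwf_mor) on1_Hom1: "on1 to_compr X Y (C, H, H') \<in> Hom1 DscCompCat (ty X, compr X) (ty Y, compr Y)"
  unfolding on1_eq Hom1_DscCompCat using zeta_Ntr[OF z_coherent] zeta_cod[OF z_coherent] by blast

section \<open>The comprehension 2-functor on identities and composites\<close>

lemma arr_func_id: "category B \<Longrightarrow> arr_func (id_func B) = id_func (arr_cat B)"
proof -
  assume "category B"
  then interpret category B .
  interpret i: fctr "id_func B" B B by unfold_locales (rule id_Fun[OF category_axioms])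
  show ?thesis
    by (rule Fun_eqI[OF i.arr_func id_Fun[OF category_arr_cat]]) (auto simp: mem_squares)
qed

lemma arr_func_comp:
  assumes F: "F \<in> Fun C D" and G: "G \<in> Fun D E" shows "arr_func (G \<odot> F) = arr_func G \<odot> arr_func F"
proof -
  interpret F: fctr F C D by unfold_locales fact
  interpret G: fctr G D E by unfold_locales fact
  interpret GF: fctr "G \<odot> F" C E by unfold_locales (rule comp_Fun[OF F G])
  show ?thesis
  proof (rule Fun_eqI[OF GF.arr_func comp_Fun[OF F.arr_func G.arr_func]])
    fix t assume "t \<in> Ar (arr_cat C)"
    then show "FA (arr_func (G \<odot> F)) t = FA (arr_func G \<odot> arr_func F) t"
      by (cases t) (auto simp: F.FA_square, auto simp: mem_squares)
  qed simp
qed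

lemma (in cwf) id_mor: "cwf_mor X X U V B U V B (id_func B) (id_func U) (id_func V)"
proof -
  have "two_category CwF" by (rule two_category_CwF)
  then show ?thesis
    using two_category.id1[OF _ obj] Hom1_iff[OF cwf_axioms cwf_axioms] by (simp add: CwF_ops Ty Tm base)
qed

lemma (in cwf) z_id:
  assumes A: "A \<in> Ob U"
  shows "cwf_mor.z X X (id_func B) (id_func U) (id_func V) A = Idn B (ext X A)"
proof -
  interpret i: cwf_mor X X U V B U V B "id_func B" "id_func U" "id_func V" by (rule id_mor)
  show ?thesis using A by (simp add: i.z_def i.NT_mt triangle_Dlt)
qed

lemma (in cwf) zeta_id: "zeta X X (id_func B) (id_func U) (cwf_mor.z X X (id_func B) (id_func U) (id_func V)) = id_nt (compr X)"
proof -
  interpret i: cwf_mor X X U V B U V B "id_func B" "id_func U" "id_func V" by (rule id_mor)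
  show ?thesis using i.identity_zeta[OF i.z_coherent]
    by (simp add: z_id arr_func_id[OF u.D.category_axioms] comp_id_left[OF compr_Fun])
qed

locale cwf_mor_comp = m: cwf_mor X Y U V B U' V' B' C1 H1 H1' + n: cwf_mor Y Z U' V' B' U'' V'' B'' C2 H2 H2'
  for X Y Z :: "'v gcwf_data" and U V B U' V' B' U'' V'' B'' C1 H1 H1' C2 H2 H2'
begin

sublocale nm: cwf_mor X Z U V B U'' V'' B'' "C2 \<odot> C1" "H2 \<odot> H1" "H2' \<odot> H1'"
proof unfold_locales
  show "C2 \<odot> C1 \<in> Fun B B''" "H2 \<odot> H1 \<in> Fun U U''" "H2' \<odot> H1' \<in> Fun V V''"
    by (rule comp_Fun[OF m.C.Fun n.C.Fun] comp_Fun[OF m.H.Fun n.H.Fun] comp_Fun[OF m.H'.Fun n.H'.Fun])+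
  show "ty Z \<odot> (H2 \<odot> H1) = C2 \<odot> C1 \<odot> ty X"
    by (rule square_comp[OF m.X.u.Fun m.Y.u.Fun n.Y.u.Fun m.H.Fun m.C.Fun n.H.Fun n.C.Fun m.square n.square])
  show "tm Z \<odot> (H2' \<odot> H1') = C2 \<odot> C1 \<odot> tm X"
    by (rule square_comp[OF m.X.v.Fun m.Y.v.Fun n.Y.v.Fun m.H'.Fun m.C.Fun n.H'.Fun n.C.Fun m.tm_square n.tm_square])
  show "Sgm Z \<odot> (H2' \<odot> H1') = H2 \<odot> H1 \<odot> Sgm X"
    by (rule square_comp[OF m.X.S.Fun m.Y.S.Fun n.Y.S.Fun m.H'.Fun m.H.Fun n.H'.Fun n.H.Fun m.Sgm_square n.Sgm_square])
qed

text \<open>Mates paste: the right side has the adjunct that characterises the mate of the composed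
  morphism. Its projection is the top side of the composition formula of
  \<open>CompCat\<close>.\<close>

lemma mt_comp:
  assumes A: "A \<in> Ob U"
  shows "NT nm.mt A = Cmp V'' (NT n.mt (FO H1 A)) (FA H2' (NT m.mt A))"
proof (rule nm.mt_eqI[OF A])
  have "Cmp U'' (NT (cnt Z) (FO (H2 \<odot> H1) A)) (FA (Sgm Z) (Cmp V'' (NT n.mt (FO H1 A)) (FA H2' (NT m.mt A)))) =
    Cmp U'' (Cmp U'' (NT (cnt Z) (FO H2 (FO H1 A))) (FA (Sgm Z) (NT n.mt (FO H1 A)))) (FA H2 (FA (Sgm Y) (NT m.mt A)))"
    using A by (simp add: n.Y.u.C.assoc)
  also have "\<dots> = FA H2 (Cmp U' (NT (cnt Y) (FO H1 A)) (FA (Sgm Y) (NT m.mt A)))"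
    using A by (simp add: n.mt_transpose)
  also have "\<dots> = FA (H2 \<odot> H1) (NT (cnt X) A)" using A by (simp add: m.mt_transpose)
  finally show "Cmp U'' (NT (cnt Z) (FO (H2 \<odot> H1) A)) (FA (Sgm Z) (Cmp V'' (NT n.mt (FO H1 A)) (FA H2' (NT m.mt A)))) =
      FA (H2 \<odot> H1) (NT (cnt X) A)" .
qed (use A in simp_all)

lemma z_comp: "A \<in> Ob U \<Longrightarrow> nm.z A = Cmp B'' (n.z (FO H1 A)) (FA C2 (m.z A))"
  by (simp add: nm.z_def mt_comp n.z_def m.z_def)

lemma zeta_comp: "zeta X Z (C2 \<odot> C1) (H2 \<odot> H1) nm.z = (zeta Y Z C2 H2 n.z \<rhd> H1) \<bullet> (arr_func C2 \<lhd> zeta X Y C1 H1 m.z)"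
proof -
  have e: "arr_func (C2 \<odot> C1) \<odot> compr X = arr_func C2 \<odot> (arr_func C1 \<odot> compr X)"
    "(compr Z \<odot> H2) \<odot> H1 = compr Z \<odot> (H2 \<odot> H1)"
    "arr_func C2 \<odot> (compr Y \<odot> H1) = (arr_func C2 \<odot> compr Y) \<odot> H1"
    using comp_assoc[OF m.X.compr_Fun m.C.arr_func n.C.arr_func] comp_assoc[OF m.H.Fun n.H.Fun n.Y.compr_Fun]
      comp_assoc[OF m.H.Fun m.Y.compr_Fun n.C.arr_func]
    by (simp_all add: arr_func_comp[OF m.C.Fun n.C.Fun])
  have 1: "arr_func C2 \<lhd> zeta X Y C1 H1 m.z \<in> Ntr (arr_func (C2 \<odot> C1) \<odot> compr X) ((arr_func C2 \<odot> compr Y) \<odot> H1)"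
    using whisker_left_Ntr[OF m.src_Fun m.zeta_Ntr[OF m.z_coherent] n.C.arr_func] unfolding e .
  have 2: "zeta Y Z C2 H2 n.z \<rhd> H1 \<in> Ntr ((arr_func C2 \<odot> compr Y) \<odot> H1) (compr Z \<odot> (H2 \<odot> H1))"
    using whisker_right_Ntr[OF m.H.Fun n.src_Fun n.zeta_Ntr[OF n.z_coherent]] unfolding e .
  show ?thesis
  proof (rule Ntr_eqI[OF nm.zeta_Ntr[OF nm.z_coherent] vcomp_Ntr[OF nm.src_Fun 1 2] nm.src_Fun])
    fix A assume A: "A \<in> Ob U"
    show "NT (zeta X Z (C2 \<odot> C1) (H2 \<odot> H1) nm.z) A = NT ((zeta Y Z C2 H2 n.z \<rhd> H1) \<bullet> (arr_func C2 \<lhd> zeta X Y C1 H1 m.z)) A"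
      using A m.zeta_square[OF m.z_coherent A] n.C.FA_square[OF m.zeta_square[OF m.z_coherent A]]
        n.zeta_square[OF n.z_coherent m.H.FO_in[OF A]]
      by (simp add: m.X.Ty m.Y.Ty m.Y.base n.Y.base z_comp)
  qed
qed

end

text \<open>A 2-cell on either side is determined by its parts on base and types; for such a pair,
  the equation between the \<open>zeta\<close> transformations is the condition for a part on terms
  to exist.\<close>

lemma to_compr_bij2:
  assumes X: "X \<in> Obj CwF" and Y: "Y \<in> Obj CwF" and m: "m \<in> Hom1 CwF X Y" and n: "n \<in> Hom1 CwF X Y"
  shows "bij_betw (on2 to_compr X Y m n) (Hom2 CwF X Y m n)
    (Hom2 DscCompCat (on0 to_compr X) (on0 to_compr Y) (on1 to_compr X Y m) (on1 to_compr X Y n))"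
    (is "bij_betw _ _ ?H2")
proof -
  obtain U V B U' V' B' where XY: "cwf X U V B" "cwf Y U' V' B'" using X Y cwf_exists by blast
  obtain C1 H1 H1' C2 H2 H2' where mn: "m = (C1, H1, H1')" "n = (C2, H2, H2')" by (metis prod_cases3)
  interpret m: cwf_mor X Y U V B U' V' B' C1 H1 H1' using m Hom1_iff[OF XY] mn by blast
  interpret n: cwf_mor X Y U V B U' V' B' C2 H2 H2' using n Hom1_iff[OF XY] mn by blast
  have pre: "cwf_pre_cell X Y U V B U' V' B' C1 H1 H1' C2 H2 H2' \<phi> \<psi>"
    if "\<psi> \<in> Ntr C1 C2" "\<phi> \<in> Ntr H1 H2" "ty Y \<lhd> \<phi> = \<psi> \<rhd> ty X" for \<phi> \<psi>
    using that by unfold_locales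
  have on2: "on2 to_compr X Y m n = (\<lambda>(\<psi>, \<phi>, \<phi>'). (\<psi>, \<phi>))" by auto
  have H2: "(\<psi>, \<phi>) \<in> ?H2 \<longleftrightarrow> \<psi> \<in> Ntr C1 C2 \<and> \<phi> \<in> Ntr H1 H2 \<and> ty Y \<lhd> \<phi> = \<psi> \<rhd> ty X \<and>
      (compr Y \<lhd> \<phi>) \<bullet> zeta X Y C1 H1 m.z = zeta X Y C2 H2 n.z \<bullet> (arr_nt \<psi> \<rhd> compr X)" for \<psi> \<phi>
    unfolding mn m.on1_eq n.on1_eq to_compr_simps(1) DscCompCat_Hom2 ..
  show ?thesis
  proof (rule bij_betwI')
    fix c c' assume c: "c \<in> Hom2 CwF X Y m n" "c' \<in> Hom2 CwF X Y m n"
    obtain \<psi> \<phi> \<phi>1 \<psi>' \<phi>' \<phi>2 where cc: "c = (\<psi>, \<phi>, \<phi>1)" "c' = (\<psi>', \<phi>', \<phi>2)" by (metis prod_cases3)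
    note c = c[unfolded mn cc CwF_Hom2]
    interpret cwf_pre_cell X Y U V B U' V' B' C1 H1 H1' C2 H2 H2' \<phi> \<psi> using c by (intro pre) blast+
    show "on2 to_compr X Y m n c = on2 to_compr X Y m n c' \<longleftrightarrow> c = c'"
      using c cell_unique[of \<phi>1 \<phi>2] unfolding cc to_compr_simps by blast
  next
    fix c assume c: "c \<in> Hom2 CwF X Y m n"
    obtain \<psi> \<phi> \<phi>1 where cc: "c = (\<psi>, \<phi>, \<phi>1)" by (metis prod_cases3)
    note c = c[unfolded mn cc CwF_Hom2]
    interpret cwf_pre_cell X Y U V B U' V' B' C1 H1 H1' C2 H2 H2' \<phi> \<psi> using c by (intro pre) blast+
    show "on2 to_compr X Y m n c \<in> ?H2"
      unfolding cc to_compr_simps(3) H2 using c coherent_of_cell[of \<phi>1] coherence_iff by blast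
  next
    fix d assume d: "d \<in> ?H2"
    obtain \<psi> \<phi> where dd: "d = (\<psi>, \<phi>)" by (cases d)
    note d = d[unfolded dd H2]
    interpret cwf_pre_cell X Y U V B U' V' B' C1 H1 H1' C2 H2 H2' \<phi> \<psi> using d by (intro pre) blast+
    obtain \<phi>' where "\<phi>' \<in> Ntr H1' H2'" "tm Y \<lhd> \<phi>' = \<psi> \<rhd> tm X" "Sgm Y \<lhd> \<phi>' = \<phi> \<rhd> Sgm X"
      using d coherence_iff cell_exists by blast
    then have "(\<psi>, \<phi>, \<phi>') \<in> Hom2 CwF X Y m n" unfolding mn CwF_Hom2 using d by blast
    then show "\<exists>c \<in> Hom2 CwF X Y m n. d = on2 to_compr X Y m n c"
      by (rule bexI[rotated]) (simp add: dd)
  qed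
qed

lemma to_compr_bij1:
  assumes X: "X \<in> Obj CwF" and Y: "Y \<in> Obj CwF"
  shows "bij_betw (on1 to_compr X Y) (Hom1 CwF X Y) (Hom1 DscCompCat (on0 to_compr X) (on0 to_compr Y))"
proof -
  obtain U V B U' V' B' where XY: "cwf X U V B" "cwf Y U' V' B'" using X Y cwf_exists by blast
  interpret X: cwf X U V B by fact
  interpret Y: cwf Y U' V' B' by fact
  show ?thesis unfolding to_compr_simps(1)
  proof (rule bij_betwI')
    fix m n assume mn: "m \<in> Hom1 CwF X Y" "n \<in> Hom1 CwF X Y"
    obtain C1 H1 H1' C2 H2 H2' where e: "m = (C1, H1, H1')" "n = (C2, H2, H2')" by (metis prod_cases3)
    interpret m: cwf_mor X Y U V B U' V' B' C1 H1 H1' using mn Hom1_iff[OF XY] e by blast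
    interpret n: cwf_mor X Y U V B U' V' B' C2 H2 H2' using mn Hom1_iff[OF XY] e by blast
    have "H1' = H2'" if "C1 = C2" "H1 = H2" "zeta X Y C1 H1 m.z = zeta X Y C2 H2 n.z"
    proof -
      \<comment> \<open>Reading the second morphism over \<open>C1\<close> and \<open>H1\<close>
        makes the two families \<open>z\<close> comparable.\<close>
      note n = n.cwf_mor_axioms[folded that(1,2)]
      show ?thesis
        using m.zeta_inj[of m.z "cwf_mor.z X Y C1 H1 H2'"] that
        by (intro cwf_mor_unique[OF m.cwf_mor_axioms n]) simp
    qed
    then show "on1 to_compr X Y m = on1 to_compr X Y n \<longleftrightarrow> m = n"
      unfolding e m.on1_eq n.on1_eq by auto
  next
    fix m assume m: "m \<in> Hom1 CwF X Y"
    obtain C H H' where e: "m = (C, H, H')" by (metis prod_cases3)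
    interpret m: cwf_mor X Y U V B U' V' B' C H H' using m Hom1_iff[OF XY] e by blast
    show "on1 to_compr X Y m \<in> Hom1 DscCompCat (ty X, compr X) (ty Y, compr Y)"
      unfolding e by (rule m.on1_Hom1)
  next
    fix f assume f: "f \<in> Hom1 DscCompCat (ty X, compr X) (ty Y, compr Y)"
    obtain C H \<zeta> where e: "f = (C, H, \<zeta>)" by (metis prod_cases3)
    interpret m: cwf_base_mor X Y U V B U' V' B' C H
      using f XY unfolding e DscCompCat_Hom1[OF X.u.disc Y.u.disc] X.u.Src X.u.Trg Y.u.Src Y.u.Trg
      by unfold_locales blast+
    obtain z where z: "m.coherent z" "\<zeta> = zeta X Y C H z"
      using f unfolding e m.Hom1_DscCompCat by (blast elim: m.zeta_surj)
    note d = m.dotted_mor[OF z(1)]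
    let ?H' = "m.dotted z"
    have "zeta X Y C H (cwf_mor.z X Y C H ?H') = \<zeta>"
      unfolding z(2) by (rule zeta_cong) (simp add: X.Ty m.dotted_z[OF z(1)])
    then have "on1 to_compr X Y (C, H, ?H') = f" unfolding cwf_mor.on1_eq[OF d] e by simp
    moreover have "(C, H, ?H') \<in> Hom1 CwF X Y" using d Hom1_iff[OF XY] by blast
    ultimately show "\<exists>m \<in> Hom1 CwF X Y. f = on1 to_compr X Y m" by blast
  qed
qed

text \<open>Any preimage will do on objects: the counit compares it with the original gcwf.\<close>

definition lift0 :: "'v cc \<Rightarrow> 'v gcwf_data" where
  "lift0 P = (SOME X. X \<in> Obj CwF \<and> (ty X, compr X) = P)"
definition lift1 where "lift1 X Y = inv_into (Hom1 CwF X Y) (on1 to_compr X Y)"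
definition lift2 where "lift2 X Y m n = inv_into (Hom2 CwF X Y m n) (on2 to_compr X Y m n)"

lemma to_compr_id:
  assumes X: "X \<in> Obj CwF"
  shows "on1 to_compr X X (id1 CwF X) = id1 DscCompCat (on0 to_compr X)"
proof -
  obtain U V B where c: "cwf X U V B" using X cwf_exists by blast
  interpret X: cwf X U V B by fact
  show ?thesis
    unfolding CwF_ops X.Ty X.Tm X.base cwf_mor.on1_eq[OF X.id_mor] to_compr_simps(1) DscCompCat_ops X.u.Src X.u.Trg X.zeta_id ..
qed

lemma cwf_mor_compI:
  assumes "X \<in> Obj CwF" "Y \<in> Obj CwF" "Z \<in> Obj CwF" "(C1, H1, H1') \<in> Hom1 CwF X Y" "(C2, H2, H2') \<in> Hom1 CwF Y Z"
  obtains U V B U' V' B' U'' V'' B'' where "cwf_mor_comp X Y Z U V B U' V' B' U'' V'' B'' C1 H1 H1' C2 H2 H2'"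
proof -
  obtain U V B U' V' B' U'' V'' B'' where c: "cwf X U V B" "cwf Y U' V' B'" "cwf Z U'' V'' B''"
    using assms(1-3) cwf_exists by metis
  have "cwf_mor_comp X Y Z U V B U' V' B' U'' V'' B'' C1 H1 H1' C2 H2 H2'"
    using assms(4,5) Hom1_iff[OF c(1,2)] Hom1_iff[OF c(2,3)] by (simp add: cwf_mor_comp_def)
  then show thesis by (rule that)
qed

lemma to_compr_comp:
  assumes "X \<in> Obj CwF" "Y \<in> Obj CwF" "Z \<in> Obj CwF" "m \<in> Hom1 CwF X Y" "n \<in> Hom1 CwF Y Z"
  shows "on1 to_compr X Z (comp1 CwF n m) = comp1 DscCompCat (on1 to_compr Y Z n) (on1 to_compr X Y m)"
proof -
  obtain C1 H1 H1' C2 H2 H2' where e: "m = (C1, H1, H1')" "n = (C2, H2, H2')" by (metis prod_cases3)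
  obtain U V B U' V' B' U'' V'' B'' where "cwf_mor_comp X Y Z U V B U' V' B' U'' V'' B'' C1 H1 H1' C2 H2 H2'"
    using cwf_mor_compI assms unfolding e by blast
  then interpret cwf_mor_comp X Y Z U V B U' V' B' U'' V'' B'' C1 H1 H1' C2 H2 H2' .
  show ?thesis unfolding e CwF_ops nm.on1_eq m.on1_eq n.on1_eq DscCompCat_ops zeta_comp ..
qed

lemma strict_surjective_equivalence_to_compr:
  assumes inf: "infinite (UNIV :: 'v set)"
  shows "strict_surjective_equivalence (CwF :: ('v gcwf_data, _, _) two_cat) DscCompCat to_compr lift0 lift1 lift2"
proof (intro strict_surjective_equivalence.intro two_category_CwF strict_surjective_equivalence_axioms.intro)
  fix P :: "'v cc" assume "P \<in> Obj DscCompCat"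
  from someI_ex[OF DscCompCat_surj[OF inf this]] show "lift0 P \<in> Obj CwF" "on0 to_compr (lift0 P) = P"
    by (simp_all add: lift0_def)
next
  fix X Y :: "'v gcwf_data" assume X: "X \<in> Obj CwF"
  then show "on0 to_compr X \<in> Obj DscCompCat" using cwf_exists cwf.compr_Obj by fastforce
  assume Y: "Y \<in> Obj CwF"
  note b = to_compr_bij1[OF X Y]
  show "on1 to_compr X Y f \<in> Hom1 DscCompCat (on0 to_compr X) (on0 to_compr Y)" if "f \<in> Hom1 CwF X Y" for f
    using b that by (auto dest: bij_betwE)
  show "f = g" if "f \<in> Hom1 CwF X Y" "g \<in> Hom1 CwF X Y" "on1 to_compr X Y f = on1 to_compr X Y g" for f g
    using bij_betw_imp_inj_on[OF b] that by (auto dest: inj_onD)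
  show "lift1 X Y f \<in> Hom1 CwF X Y" "on1 to_compr X Y (lift1 X Y f) = f"
    if "f \<in> Hom1 DscCompCat (on0 to_compr X) (on0 to_compr Y)" for f
    using that bij_betw_imp_surj_on[OF b] unfolding lift1_def by (metis inv_into_into, metis f_inv_into_f)
  fix f g assume f: "f \<in> Hom1 CwF X Y" and g: "g \<in> Hom1 CwF X Y"
  note b = to_compr_bij2[OF X Y f g]
  show "on2 to_compr X Y f g c \<in> Hom2 DscCompCat (on0 to_compr X) (on0 to_compr Y) (on1 to_compr X Y f) (on1 to_compr X Y g)"
    if "c \<in> Hom2 CwF X Y f g" for c
    using b that by (auto dest: bij_betwE)
  show "c = d" if "c \<in> Hom2 CwF X Y f g" "d \<in> Hom2 CwF X Y f g" "on2 to_compr X Y f g c = on2 to_compr X Y f g d" for c d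
    using bij_betw_imp_inj_on[OF b] that by (auto dest: inj_onD)
  show "lift2 X Y f g c \<in> Hom2 CwF X Y f g" "on2 to_compr X Y f g (lift2 X Y f g c) = c"
    if "c \<in> Hom2 DscCompCat (on0 to_compr X) (on0 to_compr Y) (on1 to_compr X Y f) (on1 to_compr X Y g)" for c
    using that bij_betw_imp_surj_on[OF b] unfolding lift2_def by (metis inv_into_into, metis f_inv_into_f)
next
  show "on1 to_compr X X (id1 CwF X) = id1 DscCompCat (on0 to_compr X)" if "X \<in> Obj CwF" for X :: "'v gcwf_data"
    using that by (rule to_compr_id)
  show "on1 to_compr X Z (comp1 CwF n m) = comp1 DscCompCat (on1 to_compr Y Z n) (on1 to_compr X Y m)"
    if "X \<in> Obj CwF" "Y \<in> Obj CwF" "Z \<in> Obj CwF" "m \<in> Hom1 CwF X Y" "n \<in> Hom1 CwF Y Z" for X Y Z :: "'v gcwf_data" and m n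
    using that by (rule to_compr_comp)
next
  show "on2 to_compr X Y f f (id2 CwF f) = id2 DscCompCat (on1 to_compr X Y f)" for X Y :: "'v gcwf_data" and f
    by (cases f) (simp add: CwF_ops DscCompCat_ops)
  show "on2 to_compr X Y f h (vcomp CwF \<beta> \<alpha>) = vcomp DscCompCat (on2 to_compr X Y g h \<beta>) (on2 to_compr X Y f g \<alpha>)"
    for X Y :: "'v gcwf_data" and f g h \<alpha> \<beta>
    by (cases \<alpha>; cases \<beta>) (simp add: CwF_ops DscCompCat_ops)
  show "on2 to_compr X Z (comp1 CwF g f) (comp1 CwF g' f') (hcomp CwF \<beta> \<alpha>) =
      hcomp DscCompCat (on2 to_compr Y Z g g' \<beta>) (on2 to_compr X Y f f' \<alpha>)" for X Y Z :: "'v gcwf_data" and f g f' g' \<alpha> \<beta>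
    by (cases \<alpha>; cases \<beta>) (simp add: CwF_ops DscCompCat_ops)
qed

section \<open>Pseudo and strict morphisms\<close>

lemma (in cwf_mor) pseudo_iff:
  "pseudo_gcwf X Y (C, H, H') \<longleftrightarrow> (\<forall>A \<in> Ob U. iso_arr B' (z A))"
  "pseudo_cc (on0 to_compr X) (on0 to_compr Y) (on1 to_compr X Y (C, H, H')) \<longleftrightarrow> (\<forall>A \<in> Ob U. iso_arr B' (z A))"
  unfolding on1_eq pseudo_cc_def prod.case pseudo_gcwf_def invertible_mt invertible_zeta[OF z_coherent] by (rule refl)+

lemma (in cwf_mor) strict_iff:
  "strict_gcwf X Y (C, H, H') \<longleftrightarrow> (\<forall>A \<in> Ob U. z A = Idn B' (FO C (ext X A)))"
  "strict_cc (on0 to_compr X) (on0 to_compr Y) (on1 to_compr X Y (C, H, H')) \<longleftrightarrow> (\<forall>A \<in> Ob U. z A = Idn B' (FO C (ext X A)))"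
  unfolding on1_eq strict_cc_def prod.case strict_gcwf_def identity_mt identity_zeta[OF z_coherent] by (rule refl)+

text \<open>On both sides each notion reduces to one condition on the same family \<open>z\<close>:
  the fibration of terms reflects isomorphisms and identities from the base, and the squares of
  \<open>zeta\<close> have identities as bottom sides.\<close>

lemma pseudo_strict_iff:
  assumes X: "X \<in> Obj CwF" and Y: "Y \<in> Obj CwF" and m: "m \<in> Hom1 CwF X Y"
  shows "pseudo_cc (on0 to_compr X) (on0 to_compr Y) (on1 to_compr X Y m) \<longleftrightarrow> pseudo_gcwf X Y m"
    and "strict_cc (on0 to_compr X) (on0 to_compr Y) (on1 to_compr X Y m) \<longleftrightarrow> strict_gcwf X Y m"
proof -
  obtain U V B U' V' B' where XY: "cwf X U V B" "cwf Y U' V' B'" using X Y cwf_exists by blast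
  obtain C H H' where e: "m = (C, H, H')" by (metis prod_cases3)
  interpret m: cwf_mor X Y U V B U' V' B' C H H' using m Hom1_iff[OF XY] e by blast
  show "pseudo_cc (on0 to_compr X) (on0 to_compr Y) (on1 to_compr X Y m) \<longleftrightarrow> pseudo_gcwf X Y m"
    "strict_cc (on0 to_compr X) (on0 to_compr Y) (on1 to_compr X Y m) \<longleftrightarrow> strict_gcwf X Y m"
    unfolding e m.pseudo_iff m.strict_iff by (rule refl)+
qed

lemma pseudo_strict_id:
  assumes X: "X \<in> Obj CwF"
  shows "pseudo_gcwf X X (id1 CwF X)" and "strict_gcwf X X (id1 CwF X)"
proof -
  obtain U V B where c: "cwf X U V B" using X cwf_exists by blast
  interpret X: cwf X U V B by fact
  interpret i: cwf_mor X X U V B U V B "id_func B" "id_func U" "id_func V" by (rule X.id_mor)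
  show "pseudo_gcwf X X (id1 CwF X)" "strict_gcwf X X (id1 CwF X)"
    unfolding CwF_ops X.Ty X.Tm X.base i.pseudo_iff i.strict_iff by (simp_all add: X.z_id X.u.D.iso_Idn)
qed

lemma pseudo_strict_comp:
  assumes "X \<in> Obj CwF" "Y \<in> Obj CwF" "Z \<in> Obj CwF" "m \<in> Hom1 CwF X Y" "n \<in> Hom1 CwF Y Z"
  shows "pseudo_gcwf X Y m \<Longrightarrow> pseudo_gcwf Y Z n \<Longrightarrow> pseudo_gcwf X Z (comp1 CwF n m)"
    and "strict_gcwf X Y m \<Longrightarrow> strict_gcwf Y Z n \<Longrightarrow> strict_gcwf X Z (comp1 CwF n m)"
proof -
  obtain C1 H1 H1' C2 H2 H2' where e: "m = (C1, H1, H1')" "n = (C2, H2, H2')" by (metis prod_cases3)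
  obtain U V B U' V' B' U'' V'' B'' where "cwf_mor_comp X Y Z U V B U' V' B' U'' V'' B'' C1 H1 H1' C2 H2 H2'"
    using cwf_mor_compI assms unfolding e by blast
  then interpret cwf_mor_comp X Y Z U V B U' V' B' U'' V'' B'' C1 H1 H1' C2 H2 H2' .
  show "pseudo_gcwf X Y m \<Longrightarrow> pseudo_gcwf Y Z n \<Longrightarrow> pseudo_gcwf X Z (comp1 CwF n m)"
    unfolding e CwF_ops nm.pseudo_iff m.pseudo_iff n.pseudo_iff
    by (auto simp: z_comp m.z_def n.z_def intro!: n.Y.u.D.iso_Cmp n.C.iso_FA)
  assume s: "strict_gcwf X Y m" "strict_gcwf Y Z n"
  show "strict_gcwf X Z (comp1 CwF n m)"
    unfolding e CwF_ops nm.strict_iff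
  proof
    fix A assume A: "A \<in> Ob U"
    have zm: "m.z A = Idn B' (FO C1 (ext X A))" and zn: "n.z (FO H1 A) = Idn B'' (FO C2 (ext Y (FO H1 A)))"
      using s A unfolding e m.strict_iff n.strict_iff by auto
    \<comment> \<open>Strictness of the first factor identifies the two context extensions, so that
      the identity supplied by the second factor is one on the image of
      \<open>ext X A\<close>.\<close>
    have "ext Y (FO H1 A) = FO C1 (ext X A)" using arg_cong[OF zm, of "Cod B'"] A by (simp add: m.z_def)
    then show "nm.z A = Idn B'' (FO (C2 \<odot> C1) (ext X A))" using A by (simp add: z_comp zm zn)
  qed
qed

theorem corollary4p16:
  assumes "infinite (UNIV :: 'v set)"
  shows "\<exists>F G \<eta> \<epsilon>.
    adjoint_2equivalence (DscCompCat :: ('v cc, 'v cc_mor, 'v snt \<times> 'v snt) two_cat)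
      (CwF :: ('v gcwf_data, 'v gcwf_mor, 'v gcwf_cell) two_cat) F G \<eta> \<epsilon> \<and>
    adjoint_2equivalence (wide_2full_sub (DscCompCat :: ('v cc, 'v cc_mor, 'v snt \<times> 'v snt) two_cat) pseudo_cc)
      (wide_2full_sub (CwF :: ('v gcwf_data, 'v gcwf_mor, 'v gcwf_cell) two_cat) pseudo_gcwf) F G \<eta> \<epsilon> \<and>
    adjoint_2equivalence (wide_2full_sub (DscCompCat :: ('v cc, 'v cc_mor, 'v snt \<times> 'v snt) two_cat) strict_cc)
      (wide_2full_sub (CwF :: ('v gcwf_data, 'v gcwf_mor, 'v gcwf_cell) two_cat) strict_gcwf) F G \<eta> \<epsilon>"
proof -
  interpret e: strict_surjective_equivalence "CwF :: ('v gcwf_data, _, _) two_cat" DscCompCat to_compr lift0 lift1 lift2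
    by (rule strict_surjective_equivalence_to_compr[OF assms])
  interpret ps: strict_surjective_equivalence "wide_2full_sub (CwF :: ('v gcwf_data, _, _) two_cat) pseudo_gcwf"
    "wide_2full_sub DscCompCat pseudo_cc" to_compr lift0 lift1 lift2
    by (rule e.wide_2full_sub) (rule pseudo_strict_iff pseudo_strict_id pseudo_strict_comp; assumption)+
  interpret st: strict_surjective_equivalence "wide_2full_sub (CwF :: ('v gcwf_data, _, _) two_cat) strict_gcwf"
    "wide_2full_sub DscCompCat strict_cc" to_compr lift0 lift1 lift2
    by (rule e.wide_2full_sub) (rule pseudo_strict_iff pseudo_strict_id pseudo_strict_comp; assumption)+
  \<comment> \<open>\<open>inverse_2func\<close> depends only on the chosen lifts, which are the
    same in all three instances. \<open>counit\<close> also mentions the identity 1-cells, which the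
    sub-2-categories share, so the three adjoint 2-equivalences have the same data.\<close>
  have id1: "id1 (wide_2full_sub K P) = id1 K" for K :: "('x, 'f, 'c) two_cat" and P
    by (simp add: wide_2full_sub_def)
  have "ps.counit = e.counit" "st.counit = e.counit"
    by (simp_all add: fun_eq_iff ps.counit_def st.counit_def e.counit_def id1)
  then show ?thesis
    using e.adjoint_2equivalence ps.adjoint_2equivalence st.adjoint_2equivalence unfolding id1 by metis
qed

end
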